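(* There exist universal constants $C>0$, $\rho\in(0,1)$ and $\tau>0$ such that the following holds. Let $\{\Psi_\nu\}_{\nu\in\mathbb{N}_0^d}$ be the orthonormal Chebyshev system, in which case set $\beta'=\frac{\log3}{\log2}-1$, or the orthonormal Legendre system, in which case set $\beta'=1$. Let $s\ge2$ be an integer, $0<\gamma<1$, $\mathcal{J}=\mathcal{H}_s$, $N=\#(\mathcal{H}_s)$, and let the integer $m$ satisfy $$m\ \ge\ C\,s^{1+\beta'}\max\{\log^2(s)\,(\log(s)+d),\ \log(s)\log(\log(s)/\gamma)\}.$$ Let $y_1,\dots,y_m$ be drawn independently from the orthogonalization measure $\varrho$ associated to $\{\Psi_\nu\}$, and let $A\in\mathbb{C}^{m\times N}$ be the normalized sampling matrix. For a function $g$ let $(c^n)_{n\ge0}$ be a sequence of iterates of iterative hard thresholding on lower sets, that is, $c^0$ is an $s$-sparse lower vector and $$c^{n+1}=H_s^\ell\big(c^n+A^*(\tilde g-Ac^n)\big),\qquad \tilde g=\Big(\frac{g(y_i)}{\sqrt m}\Big)_{1\le i\le m},$$ and let $g^n=\sum_{\nu\in\mathcal{H}_s}c^n_\nu\Psi_\nu$. Let $\Lambda^*$ be the support of the best lower $s$-term approximation of $g$ in the $\ell_2$-norm. Then: (i) With probability exceeding $1-\gamma$, the following holds for all $g=\sum_{\nu\in\mathbb{N}_0^d}c_\nu\Psi_\nu$ (and all $n\in\mathbb{N}$): $$\|g^n-g_{\Lambda^*}\|_2\le\rho^n\|g^0-g_{\Lambda^*}\|_2+\frac{\tau}{\sqrt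 m}\|\tilde\xi\|_2,\qquad\tilde\xi=\big(g_{(\Lambda^* )^c}(y_i)\big)_{1\le i\le m}.$$ (ii) For a fixed function $g=\sum_{\nu\in\mathbb{N}_0^d}c_\nu\Psi_\nu$ with $\|g\|_{\omega,1}<\infty$, with probability exceeding $1-\gamma$, for all $n\in\mathbb{N}$: $$\|g^n-g\|_2\le\rho^n\|g^0-g_{\Lambda^*}\|_2+(\tau\sqrt2+1)\,\sigma_s^{(\ell)}(g)_2+\frac{\tau\sqrt2}{\sqrt{K(s)}}\,\|g_{(\Lambda^* )^c}\|_{\omega,1}.$$
   Context: Let $\mathcal{U}=[-1,1]^d$. The orthonormal Legendre (resp. Chebyshev) system is $\Psi_\nu(y)=\prod_{k=1}^d\Psi_{\nu_k}(y_k)$, $\nu\in\mathbb{N}_0^d$, where $\Psi_n$ is the degree-$n$ univariate polynomial of the family orthonormal with respect to the uniform probability measure $dy/2$ (resp. the Chebyshev probability measure $dy/(\pi\sqrt{1-y^2})$) on $[-1,1]$; $\varrho$ is the corresponding product probability measure on $\mathcal{U}$. A set $\Lambda\subset\mathbb{N}_0^d$ is lower if $\nu\in\Lambda$ and $\mu\le\nu$ componentwise imply $\mu\in\Lambda$. The hyperbolic cross is $\mathcal{H}_s=\{\nu\in\mathbb{N}_0^d:\prod_{k=1}^d(\nu_k+1)\le s\}$; it is the union of all lower sets of cardinality $s$. For $\mathcal{H}_s=\{\nu_1,\dots,\nu_N\}$ the normalized sampling matrix is $A=(\Psi_{\nu_j}(y_i)/\sqrt m)_{1\le i\le m,1\le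 j\le N}$; vectors in $\mathbb{C}^N$ are indexed by $\mathcal{H}_s$; $A^*$ is the conjugate transpose. $K(\Lambda)=\|\sum_{\nu\in\Lambda}|\Psi_\nu|^2\|_{L^\infty(\mathcal{U})}$ and $K(s)=\sup\{K(\Lambda):\Lambda\subset\mathcal{H}_s\text{ lower},\ \#(\Lambda)=s\}$. Weights: $\omega_\nu=\|\Psi_\nu\|_{L^\infty(\mathcal{U})}$, and $\|g\|_{\omega,1}=\sum_\nu\omega_\nu|c_\nu|$ for $g=\sum_\nu c_\nu\Psi_\nu$. An $s$-sparse lower vector is a $z\in\mathbb{C}^N$ whose support is contained in a lower set of cardinality $s$. The hard lower thresholding operator $H_s^\ell(z)$ is a minimizer of $\|z-\tilde z\|_2$ over all $s$-sparse lower vectors $\tilde z\in\mathbb{C}^N$. For $\Lambda\subset\mathbb{N}_0^d$, $g_\Lambda=\sum_{\nu\in\Lambda}c_\nu\Psi_\nu$ and $\Lambda^c$ is the complement in $\mathbb{N}_0^d$. $\Lambda^*$ is a lower set with $\#(\Lambda^* )\le s$ minimizing $\|g-g_\Lambda\|_2$ among lower sets $\Lambda$ with $\#(\Lambda)\le s$, and $\sigma_s^{(\ell)}(g)_2=\|g_{(\Lambda^* )^c}\|_2$ is the best lower $s$-term error in the $\ell_2$-norm. For functions, $\|\cdot\|_2$ is the $L^2(\mathcal{U},d\varrho)$ norm (equivalently, the $\ell_2$ norm of the coefficients); $g$ is understood as a function defined at the sample points, with $g_{(\Lambda^* )^c}(y_i)=g(y_i)-g_{\Lambda^*}(y_i)$.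 *)

theory Defs
  imports
    "HOL-Probability.Probability"
    "HOL-Probability.Essential_Supremum"
    "HOL-Computational_Algebra.Polynomial"
begin

datatype poly_family = Chebyshev | Legendre

text \<open>The two orthogonalization measures live on the real line and are concentrated on
  \<open>[-1, 1]\<close>; hence the cube \<open>[-1, 1]^d\<close> has full measure for their products.\<close>

fun base_measure :: "poly_family \<Rightarrow> real measure" where
  "base_measure Legendre = uniform_measure lborel {-1..1}"
| "base_measure Chebyshev =
     density lborel (\<lambda>t. ennreal (indicator {-1..1} t / (pi * sqrt (1 - t\<^sup>2))))"

fun beta' :: "poly_family \<Rightarrow> real" where
  "beta' Chebyshev = ln 3 / ln 2 - 1"
| "beta' Legendre = 1"

text \<open>For a given measure such a system is unique up to the sign of each polynomial.\<close>

definition orthonormal_polys :: "real measure \<Rightarrow> (nat \<Rightarrow> real poly) \<Rightarrow> bool" where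
  "orthonormal_polys \<mu> P \<longleftrightarrow>
     (\<forall>n. degree (P n) = n) \<and>
     (\<forall>n k. integrable \<mu> (\<lambda>t. poly (P n) t * poly (P k) t) \<and>
        (\<integral>t. poly (P n) t * poly (P k) t \<partial>\<mu>) = (if n = k then 1 else 0))"

text \<open>Points of \<open>\<real>\<^sup>d\<close> and multi-indices are extensional functions on \<open>{..<d}\<close>, so that
  \<open>d\<close> can be quantified over.\<close>

definition orth_measure :: "poly_family \<Rightarrow> nat \<Rightarrow> (nat \<Rightarrow> real) measure" where
  "orth_measure fam d = (\<Pi>\<^sub>M k\<in>{..<d}. base_measure fam)"

definition sample_measure :: "poly_family \<Rightarrow> nat \<Rightarrow> nat \<Rightarrow> (nat \<Rightarrow> nat \<Rightarrow> real) measure" where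
  "sample_measure fam d m = (\<Pi>\<^sub>M i\<in>{..<m}. orth_measure fam d)"

definition multi_indices :: "nat \<Rightarrow> (nat \<Rightarrow> nat) set" where
  "multi_indices d = {..<d} \<rightarrow>\<^sub>E UNIV"

definition Psi :: "(nat \<Rightarrow> real poly) \<Rightarrow> nat \<Rightarrow> (nat \<Rightarrow> nat) \<Rightarrow> (nat \<Rightarrow> real) \<Rightarrow> real" where
  "Psi P d \<nu> y = (\<Prod>k<d. poly (P (\<nu> k)) (y k))"

definition lower_set :: "nat \<Rightarrow> (nat \<Rightarrow> nat) set \<Rightarrow> bool" where
  "lower_set d \<Lambda> \<longleftrightarrow> \<Lambda> \<subseteq> multi_indices d \<and>
     (\<forall>\<nu>\<in>\<Lambda>. \<forall>\<mu>\<in>multi_indices d. (\<forall>k<d. \<mu> k \<le> \<nu> k) \<longrightarrow> \<mu> \<in> \<Lambda>)"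

definition hyperbolic_cross :: "nat \<Rightarrow> nat \<Rightarrow> (nat \<Rightarrow> nat) set" where
  "hyperbolic_cross d s = {\<nu> \<in> multi_indices d. (\<Prod>k<d. \<nu> k + 1) \<le> s}"

definition L2_norm :: "'a measure \<Rightarrow> ('a \<Rightarrow> complex) \<Rightarrow> real" where
  "L2_norm M f = sqrt (\<integral>y. (cmod (f y))\<^sup>2 \<partial>M)"

text \<open>On the cube, the product measure has the same null sets as Lebesgue measure, so this is
  the norm of \<open>L\<^sup>\<infinity>([-1, 1]^d)\<close>.\<close>

definition Linf_norm :: "'a measure \<Rightarrow> ('a \<Rightarrow> real) \<Rightarrow> real" where
  "Linf_norm M f = real_of_ereal (esssup M (\<lambda>y. ereal \<bar>f y\<bar>))"

definition weight :: "poly_family \<Rightarrow> (nat \<Rightarrow> real poly) \<Rightarrow> nat \<Rightarrow> (nat \<Rightarrow> nat) \<Rightarrow> real" where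
  "weight fam P d \<nu> = Linf_norm (orth_measure fam d) (Psi P d \<nu>)"

definition K_set ::
  "poly_family \<Rightarrow> (nat \<Rightarrow> real poly) \<Rightarrow> nat \<Rightarrow> (nat \<Rightarrow> nat) set \<Rightarrow> real" where
  "K_set fam P d \<Lambda> = Linf_norm (orth_measure fam d) (\<lambda>y. \<Sum>\<nu>\<in>\<Lambda>. \<bar>Psi P d \<nu> y\<bar>\<^sup>2)"

definition K_sup :: "poly_family \<Rightarrow> (nat \<Rightarrow> real poly) \<Rightarrow> nat \<Rightarrow> nat \<Rightarrow> real" where
  "K_sup fam P d s =
     (SUP \<Lambda> \<in> {\<Lambda>. \<Lambda> \<subseteq> hyperbolic_cross d s \<and> lower_set d \<Lambda> \<and> card \<Lambda> = s}. K_set fam P d \<Lambda>)"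

definition expansion_on ::
  "(nat \<Rightarrow> real poly) \<Rightarrow> nat \<Rightarrow> ((nat \<Rightarrow> nat) \<Rightarrow> complex) \<Rightarrow> (nat \<Rightarrow> nat) set
     \<Rightarrow> (nat \<Rightarrow> real) \<Rightarrow> complex" where
  "expansion_on P d c \<Lambda> y = (\<Sum>\<nu>\<in>\<Lambda>. c \<nu> * complex_of_real (Psi P d \<nu> y))"

text \<open>\<open>g\<close> is a function with prescribed point values, equal to the series
  \<open>\<Sum>\<nu>. c \<nu> * \<Psi>\<^sub>\<nu>\<close> in the sense of unconditional \<open>L\<^sup>2\<close> convergence.\<close>

definition has_expansion ::
  "poly_family \<Rightarrow> (nat \<Rightarrow> real poly) \<Rightarrow> nat \<Rightarrow> ((nat \<Rightarrow> real) \<Rightarrow> complex)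
     \<Rightarrow> ((nat \<Rightarrow> nat) \<Rightarrow> complex) \<Rightarrow> bool" where
  "has_expansion fam P d g c \<longleftrightarrow>
     g \<in> borel_measurable (orth_measure fam d) \<and>
     integrable (orth_measure fam d) (\<lambda>y. (cmod (g y))\<^sup>2) \<and>
     ((\<lambda>F. L2_norm (orth_measure fam d) (\<lambda>y. g y - expansion_on P d c F y)) \<longlongrightarrow> 0)
       (finite_subsets_at_top (multi_indices d))"

text \<open>The part of \<open>g\<close> supported on the complement of a finite set \<open>\<Lambda>\<close>, as a function
  defined at every point.\<close>

definition expansion_compl ::
  "(nat \<Rightarrow> real poly) \<Rightarrow> nat \<Rightarrow> ((nat \<Rightarrow> real) \<Rightarrow> complex) \<Rightarrow> ((nat \<Rightarrow> nat) \<Rightarrow> complex)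
     \<Rightarrow> (nat \<Rightarrow> nat) set \<Rightarrow> (nat \<Rightarrow> real) \<Rightarrow> complex" where
  "expansion_compl P d g c \<Lambda> y = g y - expansion_on P d c \<Lambda> y"

text \<open>\<open>weighted_l1 fam P d c S\<close> is the \<open>\<omega>,1\<close>-norm of the part of the series supported on
  \<open>S\<close>; it is meaningful if \<open>weighted_l1_finite fam P d c\<close>.\<close>

definition weighted_l1_finite ::
  "poly_family \<Rightarrow> (nat \<Rightarrow> real poly) \<Rightarrow> nat \<Rightarrow> ((nat \<Rightarrow> nat) \<Rightarrow> complex) \<Rightarrow> bool" where
  "weighted_l1_finite fam P d c \<longleftrightarrow>
     (\<lambda>\<nu>. weight fam P d \<nu> * cmod (c \<nu>)) summable_on multi_indices d"

definition weighted_l1 ::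
  "poly_family \<Rightarrow> (nat \<Rightarrow> real poly) \<Rightarrow> nat \<Rightarrow> ((nat \<Rightarrow> nat) \<Rightarrow> complex)
     \<Rightarrow> (nat \<Rightarrow> nat) set \<Rightarrow> real" where
  "weighted_l1 fam P d c S = (\<Sum>\<^sub>\<infinity>\<nu>\<in>S. weight fam P d \<nu> * cmod (c \<nu>))"

text \<open>Minimizers need not be unique; this says that \<open>\<Lambda>\<close> is one of them.\<close>

definition best_lower_support ::
  "poly_family \<Rightarrow> (nat \<Rightarrow> real poly) \<Rightarrow> nat \<Rightarrow> nat \<Rightarrow> ((nat \<Rightarrow> real) \<Rightarrow> complex)
     \<Rightarrow> ((nat \<Rightarrow> nat) \<Rightarrow> complex) \<Rightarrow> (nat \<Rightarrow> nat) set \<Rightarrow> bool" where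
  "best_lower_support fam P d s g c \<Lambda> \<longleftrightarrow>
     is_arg_min (\<lambda>\<Lambda>. L2_norm (orth_measure fam d) (expansion_compl P d g c \<Lambda>))
       (\<lambda>\<Lambda>. lower_set d \<Lambda> \<and> finite \<Lambda> \<and> card \<Lambda> \<le> s) \<Lambda>"

text \<open>A vector indexed by \<open>hyperbolic_cross d s\<close> is a function vanishing off that set.\<close>

definition sparse_lower :: "nat \<Rightarrow> nat \<Rightarrow> ((nat \<Rightarrow> nat) \<Rightarrow> complex) \<Rightarrow> bool" where
  "sparse_lower d s z \<longleftrightarrow>
     (\<forall>\<nu>. \<nu> \<notin> hyperbolic_cross d s \<longrightarrow> z \<nu> = 0) \<and>
     (\<exists>\<Lambda>. lower_set d \<Lambda> \<and> finite \<Lambda> \<and> card \<Lambda> = s \<and> {\<nu>. z \<nu> \<noteq> 0} \<subseteq> \<Lambda>)"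

text \<open>\<open>w\<close> is an admissible value of the hard lower thresholding operator at \<open>z\<close>.\<close>

definition hard_lower_threshold ::
  "nat \<Rightarrow> nat \<Rightarrow> ((nat \<Rightarrow> nat) \<Rightarrow> complex) \<Rightarrow> ((nat \<Rightarrow> nat) \<Rightarrow> complex) \<Rightarrow> bool" where
  "hard_lower_threshold d s z w \<longleftrightarrow>
     is_arg_min (\<lambda>w. L2_set (\<lambda>\<nu>. cmod (z \<nu> - w \<nu>)) (hyperbolic_cross d s)) (sparse_lower d s) w"

definition sampling_matrix ::
  "(nat \<Rightarrow> real poly) \<Rightarrow> nat \<Rightarrow> nat \<Rightarrow> (nat \<Rightarrow> nat \<Rightarrow> real) \<Rightarrow> nat \<Rightarrow> (nat \<Rightarrow> nat) \<Rightarrow> complex" where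
  "sampling_matrix P d m y i \<nu> = complex_of_real (Psi P d \<nu> (y i) / sqrt (real m))"

definition matrix_apply ::
  "(nat \<Rightarrow> (nat \<Rightarrow> nat) \<Rightarrow> complex) \<Rightarrow> (nat \<Rightarrow> nat) set \<Rightarrow> ((nat \<Rightarrow> nat) \<Rightarrow> complex)
     \<Rightarrow> nat \<Rightarrow> complex" where
  "matrix_apply A J z i = (\<Sum>\<nu>\<in>J. A i \<nu> * z \<nu>)"

definition adjoint_apply ::
  "(nat \<Rightarrow> (nat \<Rightarrow> nat) \<Rightarrow> complex) \<Rightarrow> nat \<Rightarrow> (nat \<Rightarrow> nat) set \<Rightarrow> (nat \<Rightarrow> complex)
     \<Rightarrow> (nat \<Rightarrow> nat) \<Rightarrow> complex" where
  "adjoint_apply A m J v \<nu> = (if \<nu> \<in> J then \<Sum>i<m. cnj (A i \<nu>) * v i else 0)"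

definition iht_iterates ::
  "(nat \<Rightarrow> real poly) \<Rightarrow> nat \<Rightarrow> nat \<Rightarrow> nat \<Rightarrow> (nat \<Rightarrow> nat \<Rightarrow> real) \<Rightarrow> ((nat \<Rightarrow> real) \<Rightarrow> complex)
     \<Rightarrow> (nat \<Rightarrow> (nat \<Rightarrow> nat) \<Rightarrow> complex) \<Rightarrow> bool" where
  "iht_iterates P d s m y g x \<longleftrightarrow>
     sparse_lower d s (x 0) \<and>
     (\<forall>n. let A = sampling_matrix P d m y;
              J = hyperbolic_cross d s;
              residual = (\<lambda>i. g (y i) / complex_of_real (sqrt (real m)) - matrix_apply A J (x n) i)
          in hard_lower_threshold d s (\<lambda>\<nu>. x n \<nu> + adjoint_apply A m J residual \<nu>) (x (Suc n)))"

end

theory Submission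
  imports Defs
begin

text \<open>The core is a restricted isometry property for the sampling matrix on all lower sets of
  cardinality at most \<open>3 s\<close>, proved along the lines of Bourgain and of Haviv and Regev.  A unit
  vector supported on such a set has weighted \<open>\<ell>\<^sub>1\<close>-norm at most \<open>R = (3 s)\<^bsup>(1 + \<beta>') / 2\<^esup>\<close>, so the
  function it represents lies in \<open>R\<close> times the convex hull of finitely many functions bounded by
  \<open>1\<close>.  Its square is split into layers at dyadic scales \<open>t\<close>; in the layer at scale \<open>t\<close> the
  function is replaced by an average of about \<open>(R / t)\<^sup>2 log R\<close> elements of the hull's vertex
  set (Maurey's argument), simultaneously for the true and for the empirical measure.  A coarse
  scale needs few such elements, and there Bernstein's inequality is weak; a fine scale needs
  many, and there it is strong, so a union bound costs the same at each of the about
  \<open>log s\<close> scales.  The weights come from the bounds \<open>\<Psi>\<^sub>n\<^sup>2 \<le> 2 n + 1\<close> (Legendre) and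
  \<open>\<Psi>\<^sub>n\<^sup>2 \<le> 2\<close> (Chebyshev), both read off the Sturm-Liouville equation.

  Given the isometry with constant \<open>1 / 4\<close>, one step of hard thresholding halves the distance to
  \<open>g\<^sub>\<Lambda>\<close> up to a multiple of the residual, since the old iterate, the new iterate and \<open>g\<^sub>\<Lambda>\<close>
  are supported on a lower set of cardinality at most \<open>3 s\<close>.  For a fixed \<open>g\<close> the residual is
  controlled by a Chernoff bound for \<open>\<bar>g - g\<^sub>\<Lambda>\<bar>\<^sup>2\<close>, which is bounded by the square of the
  weighted norm.\<close>

section \<open>Concentration and empirical approximation\<close>

text \<open>The logarithms in the sample size have separate sources. Every layer mean is compared up
  to a relative error \<open>l\<close> and an additive error \<open>k\<close>. The relative errors
  cost only about \<open>l\<close> in total, since the layer means of a function sum to at most its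
  second moment; the additive ones are paid once per scale, which forces \<open>k\<close> to be of
  order \<open>1 / L\<close> with \<open>L\<close> of order \<open>log s\<close>. A Maurey average
  may be wrong on a set of mass \<open>eta\<close>, where a layer can be as large as the squared sup
  norm; so \<open>eta\<close> is of order \<open>1 / R\<^sup>2\<close>, and the length of the
  averages carries the factor \<open>ln (4 / eta)\<close>, again of order \<open>log s\<close>. The
  factor \<open>log s + d\<close> is the logarithm of the number of vertices of the hull, that is,
  of the size of the hyperbolic cross. The term with \<gamma> comes from sharing the failure
  probability among the scales. The obstacle is that the approximating average depends on the
  sample, so concentration cannot be applied to it directly. It is applied beforehand to all
  averages of the given length, of which there are finitely many.\<close>

lemma exp_le_quadratic:
  fixes x :: real
  assumes "\<bar>x\<bar> \<le> 1"
  shows "exp x \<le> 1 + x + x\<^sup>2"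
proof (cases "x \<ge> 0")
  case True
  then show ?thesis using exp_bound[of x] assms by simp
next
  case False
  define t where "t = - x"
  have t: "0 \<le> t" "t \<le> 1" using False assms by (auto simp: t_def)
  \<comment> \<open>The claim is multiplied by \<open>exp t\<close>, and \<open>exp t\<close> is
    bounded below by its quadratic Taylor polynomial; all terms of the product beyond 1 are
    nonnegative.\<close>
  have "1 \<le> (1 - t + t\<^sup>2) * (1 + t + t\<^sup>2 / 2)"
  proof -
    have "(1 - t + t\<^sup>2) * (1 + t + t\<^sup>2 / 2) = 1 + t^2/2 + t^3/2 + t^4/2"
      by (simp add: field_simps power2_eq_square power3_eq_cube power4_eq_xxxx)
    then show ?thesis using t by simp
  qed
  also have "\<dots> \<le> (1 - t + t\<^sup>2) * exp t"
    using t exp_lower_Taylor_quadratic[of t] by (intro mult_left_mono) auto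
  finally have "exp (- t) \<le> 1 - t + t\<^sup>2"
    by (simp add: exp_minus field_simps)
  then show ?thesis by (simp add: t_def)
qed

text \<open>On [0, 1] the square of \<open>X\<close> is at most \<open>X\<close>, so the
  second-order term is again a multiple of the mean. The exponent
  \<open>(l + l\<^sup>2) * expectation X\<close> is what makes the later deviation bounds relative
  to the mean.\<close>

lemma (in prob_space) iid_exp_moment:
  fixes X :: "'a \<Rightarrow> real"
  assumes [measurable]: "X \<in> borel_measurable M"
    and AE: "AE x in M. 0 \<le> X x \<and> X x \<le> 1" and l: "\<bar>l\<bar> \<le> 1"
  shows "integrable (\<Pi>\<^sub>M i\<in>{..<m::nat}. M) (\<lambda>w. exp (l * (\<Sum>i<m. X (w i))))"
    and "(\<integral>w. exp (l * (\<Sum>i<m. X (w i))) \<partial>(\<Pi>\<^sub>M i\<in>{..<m::nat}. M))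
           \<le> exp (real m * ((l + l\<^sup>2) * expectation X))"
proof -
  interpret P: product_prob_space "\<lambda>_. M" "{..<m}" by unfold_locales
  have Xi: "integrable M X"
    using AE by (intro integrable_const_bound[where B=1]) auto
  have ae: "AE x in M. exp (l * X x) \<le> 1 + (l + l\<^sup>2) * X x"
    using AE
  proof eventually_elim
    case (elim x)
    have "\<bar>l * X x\<bar> \<le> 1" using elim l by (auto simp: abs_mult intro: mult_le_one)
    then have "exp (l * X x) \<le> 1 + l * X x + l\<^sup>2 * (X x)\<^sup>2"
      using exp_le_quadratic[of "l * X x"] by (simp add: power_mult_distrib)
    also have "\<dots> \<le> 1 + l * X x + l\<^sup>2 * X x"
      using elim by (auto intro!: mult_left_mono simp: power2_eq_square mult_left_le)
    finally show ?case by (simp add: algebra_simps)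
  qed
  have ei: "integrable M (\<lambda>x. exp (l * X x))"
  proof (rule integrable_const_bound[where B="exp 1"])
    show "AE x in M. norm (exp (l * X x)) \<le> exp 1"
      using AE
    proof eventually_elim
      case (elim x)
      have "\<bar>l * X x\<bar> \<le> 1" using elim l by (auto simp: abs_mult intro: mult_le_one)
      then show ?case by auto
    qed
  qed measurable
  have "expectation (\<lambda>x. exp (l * X x)) \<le> expectation (\<lambda>x. 1 + (l + l\<^sup>2) * X x)"
    using ae ei Xi by (intro integral_mono_AE) auto
  also have "\<dots> = 1 + (l + l\<^sup>2) * expectation X"
    using Xi by (simp add: prob_space)
  also have "\<dots> \<le> exp ((l + l\<^sup>2) * expectation X)" by (rule exp_ge_add_one_self)
  finally have e1: "expectation (\<lambda>x. exp (l * X x)) \<le> exp ((l + l\<^sup>2) * expectation X)" .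
  have eq: "exp (l * (\<Sum>i<m. X (w i))) = (\<Prod>i<m. exp (l * X (w i)))" for w
    by (simp add: sum_distrib_left exp_sum)
  show "integrable (\<Pi>\<^sub>M i\<in>{..<m::nat}. M) (\<lambda>w. exp (l * (\<Sum>i<m. X (w i))))"
    unfolding eq by (rule P.product_integrable_prod) (use ei in auto)
  have "(\<integral>w. exp (l * (\<Sum>i<m. X (w i))) \<partial>(\<Pi>\<^sub>M i\<in>{..<m::nat}. M))
      = (\<Prod>i<m. expectation (\<lambda>x. exp (l * X x)))"
    unfolding eq by (rule P.product_integral_prod) (use ei in auto)
  also have "\<dots> \<le> exp ((l + l\<^sup>2) * expectation X) ^ m"
    by (auto intro!: power_mono e1 Bochner_Integration.integral_nonneg)
  also have "\<dots> = exp (real m * ((l + l\<^sup>2) * expectation X))"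
    by (simp add: exp_of_nat_mult)
  finally show "(\<integral>w. exp (l * (\<Sum>i<m. X (w i))) \<partial>(\<Pi>\<^sub>M i\<in>{..<m::nat}. M))
           \<le> exp (real m * ((l + l\<^sup>2) * expectation X))" .
qed

text \<open>Positive \<open>l\<close> gives the upper tail and negative \<open>l\<close> the lower tail.\<close>

lemma (in prob_space) relative_chernoff:
  fixes X :: "'a \<Rightarrow> real"
  assumes X[measurable]: "X \<in> borel_measurable M"
    and AE: "AE x in M. 0 \<le> X x \<and> X x \<le> B" and B: "0 < B" and l: "\<bar>l\<bar> \<le> 1"
  shows "measure (\<Pi>\<^sub>M i\<in>{..<m::nat}. M)
           {w \<in> space (\<Pi>\<^sub>M i\<in>{..<m::nat}. M).
              l * (\<Sum>i<m. X (w i)) \<ge> real m * ((l + l\<^sup>2) * expectation X + h)}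
         \<le> exp (- real m * h / B)"
proof -
  let ?P = "\<Pi>\<^sub>M i\<in>{..<m::nat}. M"
  let ?Y = "\<lambda>x. X x / B"
  interpret P: product_prob_space "\<lambda>_. M" "{..<m}" by unfold_locales
  have Ym: "?Y \<in> borel_measurable M" by measurable
  have YAE: "AE x in M. 0 \<le> ?Y x \<and> ?Y x \<le> 1"
    using AE by eventually_elim (use B in auto)
  note mom = iid_exp_moment[OF Ym YAE l, of m]
  let ?c = "exp (real m * ((l + l\<^sup>2) * expectation X + h) / B)"
  have iff: "(exp (l * (\<Sum>i<m. ?Y (w i))) \<ge> ?c)
      \<longleftrightarrow> (l * (\<Sum>i<m. X (w i)) \<ge> real m * ((l + l\<^sup>2) * expectation X + h))" for w
  proof -
    have "l * (\<Sum>i<m. ?Y (w i)) = (l * (\<Sum>i<m. X (w i))) / B"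
      by (simp flip: sum_divide_distrib)
    then show ?thesis using B by (simp add: divide_le_cancel)
  qed
  have "measure ?P {w \<in> space ?P. exp (l * (\<Sum>i<m. ?Y (w i))) \<ge> ?c}
      \<le> (\<integral>w. exp (l * (\<Sum>i<m. ?Y (w i))) \<partial>?P) / ?c"
    by (rule integral_Markov_inequality_measure[OF mom(1), of "space ?P"]) auto
  also have "\<dots> \<le> exp (real m * ((l + l\<^sup>2) * expectation ?Y)) / ?c"
    by (intro divide_right_mono mom(2)) auto
  also have "\<dots> = exp (- real m * h / B)"
    using B by (simp add: exp_diff[symmetric] field_simps)
  finally show ?thesis unfolding iff .
qed

text \<open>The left-hand side is the probability that the average of \<open>v\<close> over
  \<open>r\<close> independent draws from \<open>p\<close> exceeds \<open>c\<close>, written out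
  over index tuples. The values are centred and bounded by 2, so the exponential moment gives a
  sub-Gaussian tail.\<close>

lemma weighted_tail:
  fixes p v :: "'i \<Rightarrow> real"
  assumes fin: "finite I" and p0: "\<And>a. a \<in> I \<Longrightarrow> p a \<ge> 0" and p1: "sum p I = 1"
    and v: "\<And>a. a \<in> I \<Longrightarrow> \<bar>v a\<bar> \<le> 2" and mean: "(\<Sum>a\<in>I. p a * v a) = 0"
    and c: "0 \<le> c" "c \<le> 4"
  shows "(\<Sum>h\<in>{..<r::nat} \<rightarrow>\<^sub>E I. (\<Prod>l<r. p (h l)) * (if (\<Sum>l<r. v (h l)) > real r * c then 1 else 0))
           \<le> exp (- (real r * c\<^sup>2 / 16))"
proof -
  \<comment> \<open>This choice minimizes \<open>4 * L\<^sup>2 - L * c\<close>, with minimum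
    \<open>- c\<^sup>2 / 16\<close>; the bound \<open>c \<le> 4\<close> keeps \<open>L * v a\<close>
    within the range of \<open>exp_le_quadratic\<close>.\<close>
  define L where "L = c / 8"
  have L: "0 \<le> L" "L \<le> 1/2" using c by (auto simp: L_def)
  have one: "(\<Sum>a\<in>I. p a * exp (L * v a)) \<le> exp (4 * L\<^sup>2)"
  proof -
    have "(\<Sum>a\<in>I. p a * exp (L * v a)) \<le> (\<Sum>a\<in>I. p a * (1 + L * v a + 4 * L\<^sup>2))"
    proof (intro sum_mono mult_left_mono p0)
      fix a assume a: "a \<in> I"
      have "\<bar>L * v a\<bar> \<le> 1/2 * 2" unfolding abs_mult using L v[OF a] by (intro mult_mono) auto
      then have "exp (L * v a) \<le> 1 + L * v a + (L * v a)\<^sup>2" by (intro exp_le_quadratic) simp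
      also have "(L * v a)\<^sup>2 \<le> 4 * L\<^sup>2"
      proof -
        have "(v a)\<^sup>2 \<le> 2\<^sup>2" using v[OF a] by (subst abs_le_square_iff[symmetric]) simp
        then show ?thesis unfolding power_mult_distrib
          using mult_left_mono[of "(v a)\<^sup>2" 4 "L\<^sup>2"] by simp
      qed
      finally show "exp (L * v a) \<le> 1 + L * v a + 4 * L\<^sup>2" by simp
    qed
    also have "\<dots> = sum p I + L * (\<Sum>a\<in>I. p a * v a) + 4 * L\<^sup>2 * sum p I"
      by (simp add: algebra_simps sum.distrib sum_distrib_left sum_distrib_right)
    also have "\<dots> \<le> exp (4 * L\<^sup>2)" unfolding mean p1 by simp
    finally show ?thesis .
  qed
  have "(\<Sum>h\<in>{..<r} \<rightarrow>\<^sub>E I. (\<Prod>l<r. p (h l)) * (if (\<Sum>l<r. v (h l)) > real r * c then 1 else 0))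
      \<le> (\<Sum>h\<in>{..<r} \<rightarrow>\<^sub>E I. (\<Prod>l<r. p (h l)) * exp (L * (\<Sum>l<r. v (h l)) - L * (real r * c)))"
  proof (intro sum_mono mult_left_mono)
    fix h assume h: "h \<in> {..<r} \<rightarrow>\<^sub>E I"
    show "(if (\<Sum>l<r. v (h l)) > real r * c then 1 else 0) \<le> exp (L * (\<Sum>l<r. v (h l)) - L * (real r * c))"
      using L by (auto intro: mult_left_mono)
    show "0 \<le> (\<Prod>l<r. p (h l))" using h by (intro prod_nonneg) (auto intro: p0)
  qed
  also have "\<dots> = exp (- (L * (real r * c))) * (\<Sum>h\<in>{..<r} \<rightarrow>\<^sub>E I. (\<Prod>l<r. p (h l) * exp (L * v (h l))))"
    by (simp add: sum_distrib_left prod.distrib exp_diff exp_minus exp_sum field_simps)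
  also have "\<dots> = exp (- (L * (real r * c))) * (\<Sum>a\<in>I. p a * exp (L * v a)) ^ r"
    by (subst prod_sum_PiE[symmetric]) (auto simp: fin)
  also have "\<dots> \<le> exp (- (L * (real r * c))) * exp (4 * L\<^sup>2) ^ r"
    by (intro mult_left_mono power_mono one sum_nonneg mult_nonneg_nonneg p0) auto
  also have "\<dots> = exp (- (real r * c\<^sup>2 / 16))"
    by (simp add: exp_of_nat_mult[symmetric] exp_add[symmetric] L_def power2_eq_square field_simps)
  finally show ?thesis .
qed

text \<open>At each fixed point a random average of \<open>r\<close> functions misses the convex
  combination by more than \<open>c\<close> with probability at most \<open>eta / 2\<close>.
  Averaging over \<open>M\<close> and over the points \<open>y i\<close> bounds the expected sum of
  the two bad masses by \<open>eta\<close>, so some tuple keeps both below \<open>eta\<close>. The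
  approximation holds off a small set only, and the tuple comes from a finite set that depends on
  \<open>I\<close> and \<open>r\<close> alone.\<close>

lemma (in prob_space) maurey_approximation:
  fixes I :: "'i set" and psi :: "'i \<Rightarrow> 'a \<Rightarrow> real" and y :: "nat \<Rightarrow> 'a" and p :: "'i \<Rightarrow> real"
  defines "D \<equiv> (\<lambda>c r h u. \<bar>(\<Sum>a\<in>I. p a * psi a u) - (\<Sum>l<r. psi (h l) u) / real r\<bar> > c)"
  assumes fin: "finite I" and psi[measurable]: "\<And>a. a \<in> I \<Longrightarrow> psi a \<in> borel_measurable M"
    and bd: "\<And>a u. a \<in> I \<Longrightarrow> \<bar>psi a u\<bar> \<le> 1"
    and p0: "\<And>a. a \<in> I \<Longrightarrow> p a \<ge> 0" and p1: "sum p I = 1"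
    and c: "0 \<le> c" "c \<le> 4" and m: "m > 0" and r: "r > 0"
    and eta: "4 * exp (- (real r * c\<^sup>2 / 16)) \<le> eta"
  shows "\<exists>h\<in>{..<r} \<rightarrow>\<^sub>E I. prob {u \<in> space M. D c r h u} \<le> eta \<and>
           (\<Sum>i<m. if D c r h (y i) then 1 else 0) / real m \<le> eta"
proof -
  define H where "H = {..<r} \<rightarrow>\<^sub>E I"
  define w where "w h = (\<Prod>l<r. p (h l))" for h
  define d where "d h u = (if D c r h u then 1 else 0 :: real)" for h u
  define e where "e = exp (- (real r * c\<^sup>2 / 16))"
  have finH: "finite H" unfolding H_def by (intro finite_PiE fin) auto
  have HI: "h l \<in> I" if "h \<in> H" "l < r" for h l using that by (auto simp: H_def)
  have w0: "w h \<ge> 0" if "h \<in> H" for h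
    unfolding w_def using HI[OF that] by (intro prod_nonneg) (auto intro: p0)
  have w1: "sum w H = 1"
    unfolding w_def H_def by (subst prod_sum_PiE[symmetric]) (auto simp: fin p1)
  have pw: "(\<Sum>h\<in>H. w h * d h u) \<le> 2 * e" for u
  proof -
    define mu where "mu = (\<Sum>a\<in>I. p a * psi a u)"
    have mu: "\<bar>mu\<bar> \<le> 1"
    proof -
      have "\<bar>mu\<bar> \<le> (\<Sum>a\<in>I. \<bar>p a * psi a u\<bar>)" unfolding mu_def by (rule sum_abs)
      also have "\<dots> \<le> (\<Sum>a\<in>I. p a)"
      proof (rule sum_mono)
        fix a assume a: "a \<in> I"
        show "\<bar>p a * psi a u\<bar> \<le> p a"
          unfolding abs_mult using mult_left_le[OF bd[OF a, of u] p0[OF a]] p0[OF a] by simp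
      qed
      finally show ?thesis using p1 by simp
    qed
    have mean: "(\<Sum>a\<in>I. p a * (psi a u - mu)) = 0"
      by (simp add: right_diff_distrib sum_subtractf sum_distrib_right[symmetric] p1 mu_def)
    have mean': "(\<Sum>a\<in>I. p a * (mu - psi a u)) = 0"
      by (simp add: right_diff_distrib sum_subtractf sum_distrib_right[symmetric] p1 mu_def)
    have b2: "\<bar>psi a u - mu\<bar> \<le> 2" "\<bar>mu - psi a u\<bar> \<le> 2" if "a \<in> I" for a
      using bd[OF that, of u] mu by auto
    have dle: "d h u \<le> (if (\<Sum>l<r. psi (h l) u - mu) > real r * c then 1 else 0)
        + (if (\<Sum>l<r. mu - psi (h l) u) > real r * c then 1 else 0)" for h
    proof (cases "D c r h u")
      case True
      then have "\<bar>mu - (\<Sum>l<r. psi (h l) u) / real r\<bar> > c" by (simp add: D_def mu_def)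
      then have "\<bar>real r * mu - (\<Sum>l<r. psi (h l) u)\<bar> > real r * c"
      proof -
        assume *: "\<bar>mu - (\<Sum>l<r. psi (h l) u) / real r\<bar> > c"
        have "real r * c < real r * \<bar>mu - (\<Sum>l<r. psi (h l) u) / real r\<bar>"
          using * r by simp
        also have "\<dots> = \<bar>real r * (mu - (\<Sum>l<r. psi (h l) u) / real r)\<bar>" by (simp add: abs_mult)
        also have "real r * (mu - (\<Sum>l<r. psi (h l) u) / real r) = real r * mu - (\<Sum>l<r. psi (h l) u)"
          using r by (simp add: right_diff_distrib)
        finally show ?thesis .
      qed
      then show ?thesis by (auto simp: d_def True sum_subtractf abs_if split: if_splits)
    qed (simp add: d_def)
    have "(\<Sum>h\<in>H. w h * d h u) \<le>
        (\<Sum>h\<in>H. w h * (if (\<Sum>l<r. psi (h l) u - mu) > real r * c then 1 else 0))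
      + (\<Sum>h\<in>H. w h * (if (\<Sum>l<r. mu - psi (h l) u) > real r * c then 1 else 0))"
      unfolding sum.distrib[symmetric] distrib_left[symmetric]
      by (intro sum_mono mult_left_mono dle w0)
    also have "\<dots> \<le> e + e" unfolding w_def H_def e_def
      by (intro add_mono weighted_tail[OF fin p0 p1 _ _ c] b2 mean mean')
    finally show ?thesis by simp
  qed
  have Dm[measurable]: "Measurable.pred M (D c r h)" if "h \<in> H" for h
  proof -
    have [measurable]: "(\<lambda>u. \<Sum>l<r. psi (h l) u) \<in> borel_measurable M"
      by (intro borel_measurable_sum psi HI[OF that]) auto
    show ?thesis unfolding D_def by measurable
  qed
  have di: "integrable M (d h)" if "h \<in> H" for h
    using Dm[OF that] unfolding d_def by (intro integrable_const_bound[where B=1]) auto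
  have dp: "expectation (d h) = prob {u \<in> space M. D c r h u}" if "h \<in> H" for h
  proof -
    have "expectation (d h) = expectation (indicator {u \<in> space M. D c r h u})"
      by (intro Bochner_Integration.integral_cong) (auto simp: d_def)
    also have "\<dots> = prob {u \<in> space M. D c r h u}" using Dm[OF that] by simp
    finally show ?thesis .
  qed
  \<comment> \<open>Adding the two masses lets a single tuple serve both measures: both summands are
    nonnegative, so a bound on the sum bounds each of them.\<close>
  define Z where "Z h = expectation (d h) + (\<Sum>i<m. d h (y i)) / real m" for h
  have "(\<Sum>h\<in>H. w h * Z h) = expectation (\<lambda>u. \<Sum>h\<in>H. w h * d h u) + (\<Sum>i<m. \<Sum>h\<in>H. w h * d h (y i)) / real m"
    unfolding Z_def using di
    by (subst sum.swap) (simp add: distrib_left sum.distrib sum_divide_distrib sum_distrib_left)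
  also have "\<dots> \<le> expectation (\<lambda>u. 2 * e) + (\<Sum>i<m. 2 * e) / real m"
    by (intro add_mono integral_mono divide_right_mono sum_mono pw) (use di in auto)
  also have "\<dots> = 4 * e" using m by (simp add: prob_space)
  also have "\<dots> \<le> eta" using eta by (simp add: e_def)
  finally have le: "(\<Sum>h\<in>H. w h * Z h) \<le> eta" .
  have "\<exists>h\<in>H. Z h \<le> eta"
  proof (rule ccontr)
    assume "\<not> (\<exists>h\<in>H. Z h \<le> eta)"
    then have gt: "\<And>h. h \<in> H \<Longrightarrow> Z h > eta" by auto
    have "(\<Sum>h\<in>H. w h * (Z h - eta)) \<le> 0"
      using le w1 by (simp add: right_diff_distrib sum_subtractf flip: sum_distrib_right)
    moreover have nn: "0 \<le> w h * (Z h - eta)" if "h \<in> H" for h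
      using w0[OF that] gt[OF that] by auto
    ultimately have "(\<Sum>h\<in>H. w h * (Z h - eta)) = 0"
      by (meson order_antisym sum_nonneg)
    then have "\<forall>h\<in>H. w h * (Z h - eta) = 0" using nn finH by (simp add: sum_nonneg_eq_0_iff)
    then have "\<forall>h\<in>H. w h = 0" using gt by force
    then show False using w1 by simp
  qed
  then obtain h where h: "h \<in> H" "Z h \<le> eta" by auto
  have "expectation (d h) \<ge> 0" "(\<Sum>i<m. d h (y i)) / real m \<ge> 0"
    by (auto intro!: Bochner_Integration.integral_nonneg divide_nonneg_nonneg sum_nonneg simp: d_def)
  then have "prob {u \<in> space M. D c r h u} \<le> eta" "(\<Sum>i<m. d h (y i)) / real m \<le> eta"
    using h(2) dp[OF h(1)] unfolding Z_def by linarith+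
  then show ?thesis using h(1) unfolding H_def d_def by blast
qed

section \<open>Dyadic layers of a square\<close>

definition layer :: "real \<Rightarrow> real \<Rightarrow> real" where
  "layer t u = min (u\<^sup>2) (4 * t\<^sup>2) - min (u\<^sup>2) (t\<^sup>2)"

lemma layer_nonneg: "0 \<le> layer t u" and layer_le: "layer t u \<le> 3 * t\<^sup>2"
proof -
  have "0 \<le> t\<^sup>2" by simp
  then show "0 \<le> layer t u" "layer t u \<le> 3 * t\<^sup>2"
    unfolding layer_def by linarith+
qed

lemma borel_measurable_layer [measurable]:
  "f \<in> borel_measurable M \<Longrightarrow> (\<lambda>x. layer t (f x)) \<in> borel_measurable M"
  unfolding layer_def
  by (intro borel_measurable_diff borel_measurable_min borel_measurable_power borel_measurable_const)

lemma sum_layer: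
  "(\<Sum>i<L. layer (t * 2 ^ i) u) = min (u\<^sup>2) ((t * 2 ^ L)\<^sup>2) - min (u\<^sup>2) (t\<^sup>2)"
proof (induction L)
  case (Suc L)
  have "4 * (t * 2 ^ L)\<^sup>2 = (t * 2 ^ Suc L)\<^sup>2" by (simp add: power2_eq_square)
  then show ?case using Suc by (simp add: layer_def)
qed simp

lemma sum_layer_le: "(\<Sum>i<L. layer (t * 2 ^ i) u) \<le> u\<^sup>2"
proof -
  have "min (u\<^sup>2) ((t * 2 ^ L)\<^sup>2) \<le> u\<^sup>2" "0 \<le> min (u\<^sup>2) (t\<^sup>2)" by auto
  then show ?thesis unfolding sum_layer by linarith
qed

text \<open>Up to the constant \<open>t\<^sup>2\<close>, a layer is the square of the absolute value
  clamped to the interval from \<open>t\<close> to \<open>2 * t\<close>. The clamp is 1-Lipschitz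
  and two clamped values sum to at most \<open>4 * t\<close>. A layer cut out by an indicator would
  not be Lipschitz.\<close>

lemma layer_lipschitz:
  assumes t: "0 \<le> t"
  shows "\<bar>layer t u - layer t v\<bar> \<le> 4 * t * \<bar>u - v\<bar>"
proof -
  define clip where "clip x = max t (min \<bar>x\<bar> (2 * t))" for x
  have eq: "layer t x = (clip x)\<^sup>2 - t\<^sup>2" for x
  proof -
    have 1: "x\<^sup>2 \<le> t\<^sup>2 \<longleftrightarrow> \<bar>x\<bar> \<le> t" "x\<^sup>2 \<le> 4 * t\<^sup>2 \<longleftrightarrow> \<bar>x\<bar> \<le> 2 * t"
      using t abs_le_square_iff[of x t] abs_le_square_iff[of x "2*t"] by (auto simp: power_mult_distrib)
    show ?thesis using t by (auto simp: layer_def clip_def min_def max_def 1 power_mult_distrib)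
  qed
  have "\<bar>layer t u - layer t v\<bar> = \<bar>clip u - clip v\<bar> * \<bar>clip u + clip v\<bar>"
    by (simp add: eq abs_mult[symmetric] algebra_simps power2_eq_square)
  also have "\<dots> \<le> \<bar>u - v\<bar> * (4 * t)"
    using t by (intro mult_mono) (auto simp: clip_def max_def min_def abs_if)
  finally show ?thesis by (simp add: mult_ac)
qed

text \<open>If \<open>\<bar>u\<bar> < t / 2\<close> then both layers vanish, so the Lipschitz error is charged to the
  layer of \<open>u\<close> at scale \<open>t / 4\<close>; these layers sum to at most \<open>u\<^sup>2\<close>.\<close>

lemma layer_approx:
  assumes t: "0 < t" and e: "0 \<le> e" "e \<le> 1/2"
  shows "\<bar>layer t u - layer t v\<bar> \<le> 22 * e * layer (t / 4) u
           + 3 * t\<^sup>2 * (if \<bar>u - v\<bar> > e * t then 1 else 0)"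
proof (cases "\<bar>u - v\<bar> > e * t")
  case True
  have "\<bar>layer t u - layer t v\<bar> \<le> 3 * t\<^sup>2"
    using layer_nonneg[of t] layer_le[of t] by (smt (verit))
  moreover have "0 \<le> 22 * e * layer (t / 4) u" using e layer_nonneg by simp
  ultimately show ?thesis using True by simp
next
  case close: False
  show ?thesis
  proof (cases "\<bar>u\<bar> < t / 2")
    case True
    have "\<bar>v\<bar> \<le> \<bar>u\<bar> + e * t" using close by auto
    also have "\<dots> \<le> \<bar>u\<bar> + t / 2" using e t by (simp add: mult_right_mono)
    finally have "\<bar>v\<bar> \<le> t" using True by simp
    moreover have "\<bar>u\<bar> \<le> t" using True t by simp
    ultimately have "u\<^sup>2 \<le> t\<^sup>2" "v\<^sup>2 \<le> t\<^sup>2" using t by (auto simp: abs_le_square_iff[symmetric])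
    moreover have "t\<^sup>2 \<le> 4 * t\<^sup>2" by simp
    ultimately have "layer t u = 0" "layer t v = 0" unfolding layer_def by linarith+
    then show ?thesis using e layer_nonneg by simp
  next
    case False
    then have "(t / 2)\<^sup>2 \<le> u\<^sup>2" using t by (auto simp: abs_le_square_iff[symmetric])
    then have "layer (t / 4) u = 3 * t\<^sup>2 / 16"
    proof -
      assume *: "(t / 2)\<^sup>2 \<le> u\<^sup>2"
      have "4 * (t / 4)\<^sup>2 = (t / 2)\<^sup>2" "(t / 4)\<^sup>2 = t\<^sup>2 / 16" "(t / 2)\<^sup>2 = t\<^sup>2 / 4" "0 \<le> t\<^sup>2"
        by (simp_all add: power_divide)
      then show ?thesis using * unfolding layer_def by linarith
    qed
    moreover have "\<bar>layer t u - layer t v\<bar> \<le> 4 * t * (e * t)"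
      using layer_lipschitz[of t u v] mult_left_mono[of "\<bar>u - v\<bar>" "e * t" "4 * t"] close t by linarith
    \<comment> \<open>The origin of \<open>22\<close>: it is the least integer whose product with
      \<open>3 / 16\<close>, the saturated layer at \<open>t / 4\<close> relative to
      \<open>t\<^sup>2\<close>, reaches the \<open>4\<close> of the Lipschitz bound.\<close>
    moreover have "4 * t * (e * t) \<le> 22 * e * (3 * t\<^sup>2 / 16)"
      using e t by (simp add: power2_eq_square)
    moreover have "22 * e * layer (t / 4) u = 22 * e * (3 * t\<^sup>2 / 16)"
      using calculation(1) by simp
    ultimately have "\<bar>layer t u - layer t v\<bar> \<le> 22 * e * layer (t / 4) u" by linarith
    then show ?thesis using close by simp
  qed
qed

text \<open>When \<open>layer_approx\<close> is summed over the scales, the shifted layers telescope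
  below \<open>(f x)\<^sup>2\<close>, and the exceptional terms form a geometric sum dominated by
  the top scale. The abstract probability space allows a second use for the empirical
  measure.\<close>

lemma (in prob_space) layer_approx_expectation:
  fixes f :: "'a \<Rightarrow> real" and g :: "nat \<Rightarrow> 'a \<Rightarrow> real"
  assumes f[measurable]: "f \<in> borel_measurable M" and fi: "integrable M (\<lambda>x. (f x)\<^sup>2)"
    and g[measurable]: "\<And>i. i < L \<Longrightarrow> g i \<in> borel_measurable M"
    and t: "0 < t" and e: "0 \<le> e" "e \<le> 1/2" and eta: "0 \<le> eta"
    and close: "\<And>i. i < L \<Longrightarrow> prob {x \<in> space M. \<bar>f x - g i x\<bar> > e * (t * 2 ^ i)} \<le> eta"
  shows "(\<Sum>i<L. expectation (\<lambda>x. \<bar>layer (t * 2 ^ i) (f x) - layer (t * 2 ^ i) (g i x)\<bar>))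
           \<le> 22 * e * expectation (\<lambda>x. (f x)\<^sup>2) + eta * (t * 2 ^ L)\<^sup>2"
proof -
  have li: "integrable M (\<lambda>x. layer s (f x))" for s
    by (intro integrable_const_bound[where B="3 * s\<^sup>2"]) (auto simp: layer_nonneg layer_le)
  have "(\<Sum>i<L. expectation (\<lambda>x. \<bar>layer (t * 2 ^ i) (f x) - layer (t * 2 ^ i) (g i x)\<bar>))
     \<le> (\<Sum>i<L. 22 * e * expectation (\<lambda>x. layer (t / 4 * 2 ^ i) (f x)) + 3 * (t * 2 ^ i)\<^sup>2 * eta)"
  proof (rule sum_mono)
    fix i assume "i \<in> {..<L}"
    then have i: "i < L" by simp
    have [measurable]: "g i \<in> borel_measurable M" using g i by simp
    let ?s = "t * 2 ^ i"
    let ?B = "{x \<in> space M. \<bar>f x - g i x\<bar> > e * ?s}"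
    have [measurable]: "?B \<in> sets M" by measurable
    have gi: "integrable M (\<lambda>x. layer ?s (g i x))"
      by (intro integrable_const_bound[where B="3 * ?s\<^sup>2"]) (auto simp: layer_nonneg layer_le)
    have bi: "integrable M (indicator ?B :: 'a \<Rightarrow> real)"
      by (simp add: integrable_real_indicator emeasure_eq_measure)
    have "expectation (\<lambda>x. \<bar>layer ?s (f x) - layer ?s (g i x)\<bar>)
      \<le> expectation (\<lambda>x. 22 * e * layer (?s / 4) (f x) + 3 * ?s\<^sup>2 * indicator ?B x)"
    proof (rule integral_mono)
      fix x assume "x \<in> space M"
      then show "\<bar>layer ?s (f x) - layer ?s (g i x)\<bar> \<le> 22 * e * layer (?s / 4) (f x) + 3 * ?s\<^sup>2 * indicator ?B x"
        using layer_approx[of ?s e "f x" "g i x"] t e by (cases "x \<in> ?B") auto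
    qed (intro integrable_abs Bochner_Integration.integrable_diff Bochner_Integration.integrable_add
          integrable_mult_right li gi bi)+
    also have "\<dots> = 22 * e * expectation (\<lambda>x. layer (?s / 4) (f x)) + 3 * ?s\<^sup>2 * prob ?B"
      using li[of "?s / 4"] bi by (simp del: integrable_indicator_iff)
    also have "\<dots> \<le> 22 * e * expectation (\<lambda>x. layer (?s / 4) (f x)) + 3 * ?s\<^sup>2 * eta"
      using close[OF i] by (intro add_left_mono mult_left_mono) auto
    finally show "expectation (\<lambda>x. \<bar>layer ?s (f x) - layer ?s (g i x)\<bar>)
      \<le> 22 * e * expectation (\<lambda>x. layer (t / 4 * 2 ^ i) (f x)) + 3 * ?s\<^sup>2 * eta" by simp
  qed
  also have "\<dots> = 22 * e * expectation (\<lambda>x. \<Sum>i<L. layer (t / 4 * 2 ^ i) (f x)) + eta * (\<Sum>i<L. 3 * (t * 2 ^ i)\<^sup>2)"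
    using li by (simp add: sum.distrib sum_distrib_left sum_distrib_right mult_ac)
  also have "\<dots> \<le> 22 * e * expectation (\<lambda>x. (f x)\<^sup>2) + eta * (t * 2 ^ L)\<^sup>2"
  proof (intro add_mono mult_left_mono integral_mono)
    have "(\<Sum>i<L. 3 * (t * 2 ^ i)\<^sup>2) = (t * 2 ^ L)\<^sup>2 - t\<^sup>2"
      by (induction L) (auto simp: power_mult_distrib algebra_simps)
    then show "(\<Sum>i<L. 3 * (t * 2 ^ i)\<^sup>2) \<le> (t * 2 ^ L)\<^sup>2" by simp
  qed (use li fi e eta in \<open>auto intro: sum_layer_le[of "t / 4", simplified]\<close>)
  finally show ?thesis .
qed

section \<open>Uniform deviation over a convex hull\<close>

lemma integral_uniform_count_lessThan:
  fixes F :: "nat \<Rightarrow> real"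
  shows "integral\<^sup>L (uniform_count_measure {..<m}) F = (\<Sum>i<m. F i) / real m"
  by (subst integral_uniform_count_measure) auto

text \<open>For a fixed sample, each layer of \<open>f\<close> is replaced by that of
  \<open>g i\<close> under both measures, compared there by \<open>dev\<close>, and replaced back.
  Summed over the layers, \<open>l\<close> multiplies little more than the second moment and
  \<open>k\<close> is counted \<open>L\<close> times; \<open>t\<^sup>2\<close> pays for the part of
  the square below the lowest layer.\<close>

lemma (in prob_space) layered_deviation:
  fixes f :: "'a \<Rightarrow> real" and g :: "nat \<Rightarrow> 'a \<Rightarrow> real" and w :: "nat \<Rightarrow> 'a"
  assumes f[measurable]: "f \<in> borel_measurable M" and fb: "\<And>x. \<bar>f x\<bar> \<le> t * 2 ^ L"
    and g[measurable]: "\<And>i. i < L \<Longrightarrow> g i \<in> borel_measurable M"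
    and t: "0 < t" and e: "0 \<le> e" "e \<le> 1/2" and eta: "0 \<le> eta" and m: "0 < m" and l: "0 \<le> l"
    and close: "\<And>i. i < L \<Longrightarrow> prob {x \<in> space M. \<bar>f x - g i x\<bar> > e * (t * 2 ^ i)} \<le> eta"
    and close': "\<And>i. i < L \<Longrightarrow>
        (\<Sum>k<m. if \<bar>f (w k) - g i (w k)\<bar> > e * (t * 2 ^ i) then 1 else 0) / real m \<le> eta"
    and dev: "\<And>i. i < L \<Longrightarrow>
        \<bar>(\<Sum>k<m. layer (t * 2 ^ i) (g i (w k))) / real m - expectation (\<lambda>x. layer (t * 2 ^ i) (g i x))\<bar>
          \<le> l * expectation (\<lambda>x. layer (t * 2 ^ i) (g i x)) + k"
  defines "A \<equiv> expectation (\<lambda>x. (f x)\<^sup>2)" and "B \<equiv> (\<Sum>k<m. (f (w k))\<^sup>2) / real m"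
    and "z \<equiv> eta * (t * 2 ^ L)\<^sup>2"
  shows "\<bar>B - A\<bar> \<le> t\<^sup>2 + (22 * e * B + z) + (22 * e * A + z) + l * (A + 22 * e * A + z) + real L * k"
proof -
  \<comment> \<open>The empirical measure, on the sample indices, is itself a probability space, so
    \<open>layer_approx_expectation\<close> applies to \<open>f\<close> and \<open>g i\<close>
    composed with \<open>w\<close>.\<close>
  let ?N = "uniform_count_measure {..<m}"
  interpret N: prob_space ?N by (rule prob_space_uniform_count_measure) (use m in auto)
  have Nm: "h \<in> borel_measurable ?N" for h :: "nat \<Rightarrow> real"
    by (simp add: measurable_def sets_uniform_count_measure space_uniform_count_measure)
  have Ni: "integrable ?N (\<lambda>k. (f (w k))\<^sup>2)"
    by (rule N.integrable_const_bound[where B="(t * 2 ^ L)\<^sup>2", OF _ Nm])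
       (use power_mono[OF fb abs_ge_zero, where n=2] in auto)
  note Nint = integral_uniform_count_lessThan
  have fint: "integrable M (\<lambda>x. (f x)\<^sup>2)"
    by (rule integrable_const_bound[where B="(t * 2 ^ L)\<^sup>2"])
       (use fb power_mono[OF fb abs_ge_zero, where n=2] in auto)
  have Lf: "integrable M (\<lambda>x. layer s (f x))" for s
    by (intro integrable_const_bound[where B="3 * s\<^sup>2"]) (auto simp: layer_nonneg layer_le)
  have Lg: "integrable M (\<lambda>x. layer s (g i x))" if "i < L" for s i
    using g[OF that]
    by (intro integrable_const_bound[where B="3 * s\<^sup>2"]) (auto simp: layer_nonneg layer_le)
  define s where "s i = t * 2 ^ i" for i :: nat
  define P where "P i = expectation (\<lambda>x. layer (s i) (f x))" for i
  define Q where "Q i = (\<Sum>k<m. layer (s i) (f (w k))) / real m" for i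
  define P' where "P' i = expectation (\<lambda>x. layer (s i) (g i x))" for i
  define Q' where "Q' i = (\<Sum>k<m. layer (s i) (g i (w k))) / real m" for i
  define DP where "DP i = expectation (\<lambda>x. \<bar>layer (s i) (f x) - layer (s i) (g i x)\<bar>)" for i
  define DQ where "DQ i = (\<Sum>k<m. \<bar>layer (s i) (f (w k)) - layer (s i) (g i (w k))\<bar>) / real m" for i
  have DP: "(\<Sum>i<L. DP i) \<le> 22 * e * A + z"
    unfolding DP_def A_def s_def z_def using close
    by (intro layer_approx_expectation fint t e eta) auto
  have DQ: "(\<Sum>i<L. DQ i) \<le> 22 * e * B + z"
  proof -
    have "(\<Sum>i<L. N.expectation (\<lambda>k. \<bar>layer (t * 2 ^ i) (f (w k)) - layer (t * 2 ^ i) (g i (w k))\<bar>))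
        \<le> 22 * e * N.expectation (\<lambda>k. (f (w k))\<^sup>2) + eta * (t * 2 ^ L)\<^sup>2"
    proof (rule N.layer_approx_expectation[OF _ _ _ t e eta])
      fix i assume i: "i < L"
      let ?S = "{x \<in> space ?N. \<bar>f (w x) - g i (w x)\<bar> > e * (t * 2 ^ i)}"
      have "N.prob ?S = N.expectation (indicator ?S)" by simp
      also have "\<dots> = (\<Sum>k<m. indicator ?S k) / real m" by (rule Nint)
      also have "(\<Sum>k<m. indicator ?S k) = (\<Sum>k<m. if \<bar>f (w k) - g i (w k)\<bar> > e * (t * 2 ^ i) then 1 else (0::real))"
        by (intro sum.cong) (auto simp: indicator_def space_uniform_count_measure)
      also have "\<dots> / real m \<le> eta" by (rule close'[OF i])
      finally show "N.prob ?S \<le> eta" .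
    qed (rule Nm Ni)+
    then show ?thesis unfolding DQ_def B_def s_def z_def Nint .
  qed
  have dP: "\<bar>P i - P' i\<bar> \<le> DP i" if "i < L" for i
    unfolding P_def P'_def DP_def using Lf Lg[OF that]
      integral_abs_bound[of M "\<lambda>x. layer (s i) (f x) - layer (s i) (g i x)"] by simp
  have dQ: "\<bar>Q i - Q' i\<bar> \<le> DQ i" for i
    unfolding Q_def Q'_def DQ_def diff_divide_distrib[symmetric] sum_subtractf[symmetric]
    using m by (auto simp: abs_divide intro!: divide_right_mono sum_abs)
  have key: "\<bar>Q i - P i\<bar> \<le> DQ i + DP i + l * (P i + DP i) + k" if i: "i < L" for i
  proof -
    have "\<bar>Q' i - P' i\<bar> \<le> l * P' i + k" using dev[OF i] by (simp add: Q'_def P'_def s_def)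
    also have "\<dots> \<le> l * (P i + DP i) + k" using dP[OF i] l by (auto intro!: mult_left_mono)
    finally show ?thesis using dP[OF i] dQ[of i] by linarith
  qed
  \<comment> \<open>Nothing is lost above the top layer, because \<open>fb\<close> bounds
    \<open>f\<close> by \<open>t * 2 ^ L\<close>.\<close>
  have sumP: "(\<Sum>i<L. P i) \<le> A" "A \<le> (\<Sum>i<L. P i) + t\<^sup>2"
  proof -
    have eq: "(\<Sum>i<L. P i) = expectation (\<lambda>x. \<Sum>i<L. layer (t * 2 ^ i) (f x))"
      using Lf by (simp add: P_def s_def)
    show "(\<Sum>i<L. P i) \<le> A" unfolding eq A_def
      by (intro integral_mono sum_layer_le fint Bochner_Integration.integrable_sum Lf)
    have "A \<le> expectation (\<lambda>x. (\<Sum>i<L. layer (t * 2 ^ i) (f x)) + t\<^sup>2)"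
      unfolding A_def
    proof (intro integral_mono fint Bochner_Integration.integrable_add Bochner_Integration.integrable_sum Lf)
      fix x
      show "(f x)\<^sup>2 \<le> (\<Sum>i<L. layer (t * 2 ^ i) (f x)) + t\<^sup>2"
        unfolding sum_layer using power_mono[OF fb abs_ge_zero, where n=2, of x] by simp
    qed auto
    then show "A \<le> (\<Sum>i<L. P i) + t\<^sup>2" unfolding eq using Lf by (simp add: prob_space)
  qed
  have sumQ: "(\<Sum>i<L. Q i) \<le> B" "B \<le> (\<Sum>i<L. Q i) + t\<^sup>2"
  proof -
    have eq: "(\<Sum>i<L. Q i) = (\<Sum>k<m. \<Sum>i<L. layer (t * 2 ^ i) (f (w k))) / real m"
      unfolding Q_def s_def by (simp add: sum_divide_distrib[symmetric] sum.swap[of _ "{..<m}"])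
    show "(\<Sum>i<L. Q i) \<le> B" unfolding eq B_def
      by (intro divide_right_mono sum_mono sum_layer_le) auto
    have "B \<le> (\<Sum>k<m. (\<Sum>i<L. layer (t * 2 ^ i) (f (w k))) + t\<^sup>2) / real m"
      unfolding B_def
    proof (intro divide_right_mono sum_mono)
      fix x
      show "(f (w x))\<^sup>2 \<le> (\<Sum>i<L. layer (t * 2 ^ i) (f (w x))) + t\<^sup>2"
        unfolding sum_layer using power_mono[OF fb abs_ge_zero, where n=2, of "w x"] by simp
    qed auto
    also have "\<dots> = (\<Sum>i<L. Q i) + t\<^sup>2" unfolding eq using m by (simp add: sum.distrib add_divide_distrib)
    finally show "B \<le> (\<Sum>i<L. Q i) + t\<^sup>2" .
  qed
  have "\<bar>(\<Sum>i<L. Q i) - (\<Sum>i<L. P i)\<bar> \<le> (\<Sum>i<L. \<bar>Q i - P i\<bar>)"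
    unfolding sum_subtractf[symmetric] by (rule sum_abs)
  also have "\<dots> \<le> (\<Sum>i<L. DQ i + DP i + l * (P i + DP i) + k)"
    by (intro sum_mono key) auto
  also have "\<dots> = (\<Sum>i<L. DQ i) + (\<Sum>i<L. DP i) + l * ((\<Sum>i<L. P i) + (\<Sum>i<L. DP i)) + real L * k"
    by (simp add: sum.distrib flip: sum_distrib_left)
  also have "\<dots> \<le> (22 * e * B + z) + (22 * e * A + z) + l * (A + (22 * e * A + z)) + real L * k"
    by (intro add_mono mult_left_mono DP DQ sumP l order_refl)
  finally show ?thesis using sumP sumQ by (simp add: add.assoc) 
qed

text \<open>At scale \<open>s i\<close> there are \<open>card I ^ r i\<close> approximants with \<open>r i\<close> of order \<open>1 / (s i)\<^sup>2\<close>, and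
  the deviation of a layer bounded by \<open>3 (s i)\<^sup>2\<close> has probability at most
  \<open>exp (- const m / (s i)\<^sup>2)\<close>, so the union bound balances at every scale.\<close>

lemma (in prob_space) uniform_quadratic_deviation:
  fixes I :: "'i set" and psi :: "'i \<Rightarrow> 'a \<Rightarrow> real" and R \<gamma> :: real and L m :: nat
  defines "F \<equiv> (\<lambda>p x. R * (\<Sum>a\<in>I. p a * psi a x))"
  assumes fin: "finite I" and ne: "I \<noteq> {}"
    and psi[measurable]: "\<And>a. a \<in> I \<Longrightarrow> psi a \<in> borel_measurable M"
    and bd: "\<And>a x. a \<in> I \<Longrightarrow> \<bar>psi a x\<bar> \<le> 1"
    and R: "1 \<le> R" and L1: "R \<le> 2 ^ L / 6" and L2: "2 ^ L / 6 \<le> 2 * R"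
    and \<gamma>: "0 < \<gamma>" "\<gamma> < 1"
    and m: "real m \<ge> 3072 * real L * R\<^sup>2 *
              ((2 ^ 24 * ln (1536 * R\<^sup>2) + 1) * ln (real (card I)) + ln (4 * real L / \<gamma>))"
  shows "\<exists>E \<in> sets (\<Pi>\<^sub>M i\<in>{..<m}. M). measure (\<Pi>\<^sub>M i\<in>{..<m}. M) E \<ge> 1 - \<gamma> / 2 \<and>
           (\<forall>w\<in>E. \<forall>p. (\<forall>a\<in>I. 0 \<le> p a) \<and> sum p I = 1 \<and> expectation (\<lambda>x. (F p x)\<^sup>2) \<le> 1 \<longrightarrow>
              \<bar>(\<Sum>k<m. (F p (w k))\<^sup>2) / real m - expectation (\<lambda>x. (F p x)\<^sup>2)\<bar> \<le> 1 / 4)"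
proof -
  let ?PM = "\<Pi>\<^sub>M i\<in>{..<m}. M"
  interpret P: product_prob_space "\<lambda>_. M" "{..<m}" by unfold_locales
  \<comment> \<open>The constants form an error budget: the part below the lowest layer contributes
    \<open>1 / 36\<close>, the exceptional sets \<open>1 / 96\<close> for each measure, the additive
    errors \<open>1 / 32\<close> in total, and the terms proportional to the two means have
    coefficients small enough to keep the sum below \<open>1 / 4\<close>.\<close>
  define t :: real where "t = 1 / 6"
  define e :: real where "e = 1 / 1024"
  define s where "s i = t * 2 ^ i" for i :: nat
  define eta where "eta = 1 / (96 * (t * 2 ^ L)\<^sup>2)"
  \<comment> \<open>\<open>F p\<close> is \<open>R\<close> times a convex combination, so accuracy
    \<open>e * s i\<close> for \<open>F p\<close> means accuracy \<open>c i\<close> in the hull. The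
    length \<open>r i\<close> is then the least one for which the tail bound of Maurey's argument
    drops to \<open>eta\<close>.\<close>
  define c where "c i = e * s i / R" for i
  define r where "r i = nat \<lceil>16 / (c i)\<^sup>2 * ln (4 / eta)\<rceil>" for i
  define l :: real where "l = 1 / 32"
  define k where "k = 1 / (32 * real L)"
  define G where "G i h x = R * ((\<Sum>j<r i. psi (h j) x) / real (r i))" for i h x
  define Y where "Y i h x = layer (s i) (G i h x)" for i h x
  define H where "H i = {..<r i} \<rightarrow>\<^sub>E I" for i
  \<comment> \<open>\<open>u\<close> will be \<open>l\<close> or \<open>- l\<close>, one for each
    tail; the term \<open>l * k\<close> turns into the additive error \<open>k\<close> after
    division by \<open>l\<close>.\<close>
  define Bad where "Bad u i h = {w \<in> space ?PM. u * (\<Sum>j<m. Y i h (w j))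
      \<ge> real m * ((u + u\<^sup>2) * expectation (Y i h) + l * k)}" for u i h
  have L0: "L \<noteq> 0" using L1 R by (intro notI) simp
  then have L: "1 \<le> L" by simp
  have s0: "0 < s i" for i by (simp add: s_def t_def)
  have R2: "1 \<le> R\<^sup>2" using R by simp
  have sR: "s i \<le> R" if "i < L" for i
  proof -
    have "2 ^ Suc i \<le> (2::real) ^ L" using that by (intro power_increasing) auto
    then show ?thesis using L2 by (simp add: s_def t_def)
  qed
  have c0: "0 < c i" for i using s0 R by (auto simp: c_def e_def)
  have c4: "c i \<le> 4" if "i < L" for i
    using sR[OF that] R by (simp add: c_def e_def divide_simps)
  have TL: "1 \<le> t * 2 ^ L" "t * 2 ^ L \<le> 2 * R" using L1 L2 R by (auto simp: t_def)
  have TL2: "1 \<le> (t * 2 ^ L)\<^sup>2" "(t * 2 ^ L)\<^sup>2 \<le> 4 * R\<^sup>2"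
    using one_le_power[OF TL(1), of 2] power_mono[OF TL(2), of 2] TL by (auto simp: power_mult_distrib)
  have eta0: "0 < eta" using TL by (auto simp: eta_def)
  have eta4: "4 / eta \<le> 1536 * R\<^sup>2" "384 \<le> 4 / eta" using TL2 by (auto simp: eta_def)
  have lneta: "0 < ln (4 / eta)" using eta4 by (intro ln_gt_zero) simp
  have lnle: "ln (4 / eta) \<le> ln (1536 * R\<^sup>2)" 
  proof -
    have "0 < 4 / eta" "0 < 1536 * R\<^sup>2" using eta0 R2 by auto
    then show ?thesis using ln_le_cancel_iff[of "4 / eta" "1536 * R\<^sup>2"] eta4(1) by blast
  qed
  have r_lower: "16 / (c i)\<^sup>2 * ln (4 / eta) \<le> real (r i)" for i
    unfolding r_def by (rule real_nat_ceiling_ge)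
  have r0: "0 < r i" for i
  proof -
    have "0 < 16 / (c i)\<^sup>2 * ln (4 / eta)" using c0[of i] lneta by simp
    then have "0 < real (r i)" using r_lower[of i] by linarith
    then show ?thesis by simp
  qed
  have r_upper: "real (r i) \<le> 16 / (c i)\<^sup>2 * ln (4 / eta) + 1" for i
  proof -
    have "0 \<le> 16 / (c i)\<^sup>2 * ln (4 / eta)" using lneta by simp
    then show ?thesis unfolding r_def by linarith
  qed
  have expr: "4 * exp (- (real (r i) * (c i)\<^sup>2 / 16)) \<le> eta" for i
  proof -
    have "ln (4 / eta) \<le> real (r i) * (c i)\<^sup>2 / 16"
      using r_lower[of i] c0[of i] by (simp add: field_simps)
    then have "exp (- (real (r i) * (c i)\<^sup>2 / 16)) \<le> exp (- ln (4 / eta))" by simp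
    also have "\<dots> = eta / 4" using eta0 by (simp add: exp_minus)
    finally show ?thesis by simp
  qed
  define n where "n = real (card I)"
  have n1: "1 \<le> n" using fin ne by (simp add: n_def Suc_le_eq card_gt_0_iff)
  have lnn: "0 \<le> ln n" using n1 by simp
  have ln4: "0 < ln (4 * real L / \<gamma>)"
  proof -
    have "1 < 4 * real L" using L by simp
    also have "\<dots> \<le> 4 * real L / \<gamma>" using \<gamma> mult_right_mono[of \<gamma> 1 "real L"] by (simp add: field_simps)
    finally show ?thesis by simp
  qed
  define V where "V = (2 ^ 24 * ln (1536 * R\<^sup>2) + 1) * ln n + ln (4 * real L / \<gamma>)"
  have lnR: "0 < ln (1536 * R\<^sup>2)" using lneta lnle by linarith
  have V0: "0 < V" unfolding V_def using lnn ln4 lnR by (intro add_nonneg_pos mult_nonneg_nonneg) auto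
  have mV: "real m \<ge> 3072 * real L * R\<^sup>2 * V" using m by (simp add: V_def n_def)
  have "0 < 3072 * real L * R\<^sup>2 * V" using V0 L R by (intro mult_pos_pos) auto
  then have m0: "0 < m" using mV by (metis less_le_trans of_nat_0_less_iff)
  have expo: "real m * (l * k) / (3 * (s i)\<^sup>2) \<ge> real (r i) * ln n + ln (4 * real L / \<gamma>)" if i: "i < L" for i
  proof -
    have s2: "(s i)\<^sup>2 \<le> R\<^sup>2" using sR[OF i] s0[of i] by (intro power_mono) auto
    \<comment> \<open>Here the scales balance: \<open>c i\<close> is proportional to
      \<open>s i\<close>, so this product has the same bound at every scale. The factor
      \<open>2 ^ 24\<close> is \<open>16 / e\<^sup>2\<close>, and \<open>3072\<close> is the
      \<open>3\<close> of \<open>layer_le\<close> times the \<open>32\<close> in \<open>l\<close>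
      and the \<open>32\<close> in \<open>k\<close>.\<close>
    have "(s i)\<^sup>2 * real (r i) \<le> (s i)\<^sup>2 * (16 / (c i)\<^sup>2 * ln (4 / eta) + 1)"
      by (intro mult_left_mono r_upper) auto
    also have "\<dots> = 2 ^ 24 * R\<^sup>2 * ln (4 / eta) + (s i)\<^sup>2"
      using s0[of i] R by (simp add: c_def e_def power2_eq_square field_simps)
    also have "\<dots> \<le> 2 ^ 24 * R\<^sup>2 * ln (1536 * R\<^sup>2) + R\<^sup>2"
      using lnle s2 by (intro add_mono mult_left_mono) auto
    finally have "(s i)\<^sup>2 * real (r i) \<le> R\<^sup>2 * (2 ^ 24 * ln (1536 * R\<^sup>2) + 1)" by (simp add: algebra_simps)
    then have "(s i)\<^sup>2 * real (r i) * ln n + (s i)\<^sup>2 * ln (4 * real L / \<gamma>)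
       \<le> R\<^sup>2 * (2 ^ 24 * ln (1536 * R\<^sup>2) + 1) * ln n + R\<^sup>2 * ln (4 * real L / \<gamma>)"
      using lnn ln4 s2 by (intro add_mono mult_right_mono) auto
    also have "\<dots> = R\<^sup>2 * V" by (simp add: V_def algebra_simps)
    also have "\<dots> \<le> real m / (3072 * real L)" using mV L by (simp add: field_simps)
    finally have "(s i)\<^sup>2 * (real (r i) * ln n + ln (4 * real L / \<gamma>)) \<le> real m * (l * k) / 3"
      using L by (simp add: l_def k_def algebra_simps)
    then show ?thesis using s0[of i] by (simp add: field_simps)
  qed
  have HI: "h j \<in> I" if "h \<in> H i" "j < r i" for h i j using that by (auto simp: H_def)
  have Gm: "G i h \<in> borel_measurable M" if "h \<in> H i" for i h
  proof -
    have [measurable]: "(\<lambda>u. \<Sum>j<r i. psi (h j) u) \<in> borel_measurable M"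
      by (intro borel_measurable_sum psi HI[OF that]) auto
    show ?thesis unfolding G_def by measurable
  qed
  have Ym: "Y i h \<in> borel_measurable M" if "h \<in> H i" for i h
    unfolding Y_def using Gm[OF that] by measurable
  have Badm: "Bad u i h \<in> sets ?PM" if "h \<in> H i" for u i h
  proof -
    note [measurable] = Ym[OF that]
    show ?thesis unfolding Bad_def by measurable
  qed
  \<comment> \<open>The share of one bad event: over two signs, \<open>n ^ r i\<close> tuples and
    \<open>L\<close> scales the shares add up to \<open>\<gamma> / 2\<close>.\<close>
  have Badp: "measure ?PM (Bad u i h) \<le> \<gamma> / (4 * real L) / n ^ r i"
    if h: "h \<in> H i" and i: "i < L" and u: "u = l \<or> u = - l" for u i h
  proof -
    have "measure ?PM (Bad u i h) \<le> exp (- real m * (l * k) / (3 * (s i)\<^sup>2))"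
      unfolding Bad_def
      by (rule relative_chernoff[OF Ym[OF h]])
         (use s0[of i] u in \<open>auto simp: Y_def layer_nonneg layer_le l_def\<close>)
    also have "\<dots> \<le> exp (- (real (r i) * ln n + ln (4 * real L / \<gamma>)))"
      using expo[OF i] by simp
    also have "\<dots> = \<gamma> / (4 * real L) / n ^ r i"
    proof -
      have "exp (real (r i) * ln n) = n ^ r i" using n1 by (simp add: exp_of_nat_mult)
      moreover have "exp (ln (4 * real L / \<gamma>)) = 4 * real L / \<gamma>"
        by (rule exp_ln) (use L \<gamma> in auto)
      ultimately have "exp (- (real (r i) * ln n + ln (4 * real L / \<gamma>))) = inverse (n ^ r i * (4 * real L / \<gamma>))"
        by (simp only: exp_minus exp_add)
      also have "\<dots> = \<gamma> / (4 * real L) / n ^ r i" 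
        using L \<gamma> n1 by (simp add: field_simps)
      finally show ?thesis .
    qed
    finally show ?thesis .
  qed
  have finH: "finite (H i)" for i unfolding H_def by (intro finite_PiE fin) auto
  have cardH: "real (card (H i)) = n ^ r i" for i
    unfolding H_def by (simp add: card_PiE n_def)
  define B where "B = (\<Union>i<L. \<Union>h\<in>H i. Bad l i h \<union> Bad (- l) i h)"
  have Um: "(\<Union>h\<in>H i. Bad l i h \<union> Bad (- l) i h) \<in> sets ?PM" for i
    by (rule sets.finite_UN[OF finH sets.Un[OF Badm Badm]])
  have Bm: "B \<in> sets ?PM" unfolding B_def by (rule sets.finite_UN[OF finite_lessThan Um])
  have "measure ?PM B \<le> (\<Sum>i<L. measure ?PM (\<Union>h\<in>H i. Bad l i h \<union> Bad (- l) i h))"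
    unfolding B_def by (rule measure_UNION_le[OF finite_lessThan Um])
  also have "\<dots> \<le> (\<Sum>i<L. \<Sum>h\<in>H i. measure ?PM (Bad l i h \<union> Bad (- l) i h))"
    by (rule sum_mono) (rule measure_UNION_le[OF finH sets.Un[OF Badm Badm]])
  also have "\<dots> \<le> (\<Sum>i<L. \<Sum>h\<in>H i. \<gamma> / (4 * real L) / n ^ r i + \<gamma> / (4 * real L) / n ^ r i)"
  proof (intro sum_mono)
    fix i h assume "i \<in> {..<L}" and h: "h \<in> H i"
    then have i: "i < L" by simp
    have "measure ?PM (Bad l i h \<union> Bad (- l) i h) \<le> measure ?PM (Bad l i h) + measure ?PM (Bad (- l) i h)"
      by (rule measure_Un_le[OF Badm[OF h] Badm[OF h]])
    also have "\<dots> \<le> \<gamma> / (4 * real L) / n ^ r i + \<gamma> / (4 * real L) / n ^ r i"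
      by (intro add_mono Badp[OF h i]) auto
    finally show "measure ?PM (Bad l i h \<union> Bad (- l) i h) \<le> \<gamma> / (4 * real L) / n ^ r i + \<gamma> / (4 * real L) / n ^ r i" .
  qed
  also have "\<dots> = \<gamma> / 2" using n1 L by (simp add: cardH)
  finally have PB: "measure ?PM B \<le> \<gamma> / 2" .
  define E where "E = space ?PM - B"
  have Em: "E \<in> sets ?PM" unfolding E_def using Bm by auto
  have PE: "measure ?PM E \<ge> 1 - \<gamma> / 2"
    using PB P.prob_compl[OF Bm] by (simp add: E_def)
  \<comment> \<open>The tuples chosen below depend on \<open>p\<close> and on the sample
    \<open>w\<close>. This is harmless, since \<open>E\<close> excludes the bad events of all tuples
    in every \<open>H i\<close> at once.\<close>
  have main: "\<bar>(\<Sum>j<m. (F p (w j))\<^sup>2) / real m - expectation (\<lambda>x. (F p x)\<^sup>2)\<bar> \<le> 1 / 4"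
    if w: "w \<in> E" and p0: "\<forall>a\<in>I. 0 \<le> p a" and p1: "sum p I = 1" and A1: "expectation (\<lambda>x. (F p x)\<^sup>2) \<le> 1" for w p
  proof -
    have ex: "\<exists>h\<in>H i. prob {u \<in> space M. \<bar>(\<Sum>a\<in>I. p a * psi a u) - (\<Sum>j<r i. psi (h j) u) / real (r i)\<bar> > c i} \<le> eta \<and>
           (\<Sum>j<m. if \<bar>(\<Sum>a\<in>I. p a * psi a (w j)) - (\<Sum>j'<r i. psi (h j') (w j)) / real (r i)\<bar> > c i then 1 else 0) / real m \<le> eta"
      if i: "i < L" for i
      unfolding H_def
      by (rule maurey_approximation[OF fin psi bd _ p1 _ c4[OF i] m0 r0 expr]) (use p0 c0[of i] in auto)
    have conv: "(\<bar>(\<Sum>a\<in>I. p a * psi a u) - (\<Sum>j<r i. psi (h j) u) / real (r i)\<bar> > c i)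
        \<longleftrightarrow> (\<bar>F p u - G i h u\<bar> > e * (t * 2 ^ i))" for u i h
    proof -
      have "\<bar>F p u - G i h u\<bar> = R * \<bar>(\<Sum>a\<in>I. p a * psi a u) - (\<Sum>j<r i. psi (h j) u) / real (r i)\<bar>"
      proof -
        have "F p u - G i h u = R * ((\<Sum>a\<in>I. p a * psi a u) - (\<Sum>j<r i. psi (h j) u) / real (r i))"
          by (simp add: F_def G_def right_diff_distrib)
        then show ?thesis using R by (simp add: abs_mult)
      qed
      then show ?thesis using R unfolding c_def s_def by (simp add: field_simps)
    qed
    have "\<forall>i. \<exists>h. i < L \<longrightarrow> h \<in> H i \<and> prob {u \<in> space M. \<bar>F p u - G i h u\<bar> > e * (t * 2 ^ i)} \<le> eta \<and>
        (\<Sum>j<m. if \<bar>F p (w j) - G i h (w j)\<bar> > e * (t * 2 ^ i) then 1 else 0) / real m \<le> eta"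
      using ex unfolding conv by blast
    from choice[OF this] obtain h where hh: "\<forall>i. i < L \<longrightarrow> h i \<in> H i \<and>
        prob {u \<in> space M. \<bar>F p u - G i (h i) u\<bar> > e * (t * 2 ^ i)} \<le> eta \<and>
        (\<Sum>j<m. if \<bar>F p (w j) - G i (h i) (w j)\<bar> > e * (t * 2 ^ i) then 1 else 0) / real m \<le> eta"
      by blast
    have h: "h i \<in> H i"
      and h1: "prob {u \<in> space M. \<bar>F p u - G i (h i) u\<bar> > e * (t * 2 ^ i)} \<le> eta"
      and h2: "(\<Sum>j<m. if \<bar>F p (w j) - G i (h i) (w j)\<bar> > e * (t * 2 ^ i) then 1 else 0) / real m \<le> eta"
      if "i < L" for i
      using hh[rule_format, OF that] by blast+
    have dev: "\<bar>(\<Sum>j<m. layer (t * 2 ^ i) (G i (h i) (w j))) / real m - expectation (\<lambda>x. layer (t * 2 ^ i) (G i (h i) x))\<bar>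
          \<le> l * expectation (\<lambda>x. layer (t * 2 ^ i) (G i (h i) x)) + k" if i: "i < L" for i
    proof -
      have nb: "w \<notin> Bad l i (h i)" "w \<notin> Bad (- l) i (h i)" and ws: "w \<in> space ?PM"
        using w i h[OF i] unfolding E_def B_def by auto
      define S where "S = (\<Sum>j<m. Y i (h i) (w j))"
      define \<mu> where "\<mu> = expectation (Y i (h i))"
      have a: "l * S < real m * ((l + l\<^sup>2) * \<mu> + l * k)"
        and b: "(- l) * S < real m * ((- l + l\<^sup>2) * \<mu> + l * k)"
        using nb ws unfolding Bad_def S_def \<mu>_def by auto
      have "l * S < l * (real m * ((1 + l) * \<mu> + k))" using a by (simp add: power2_eq_square algebra_simps)
      then have a': "S / real m < (1 + l) * \<mu> + k" using m0 by (simp add: l_def field_simps)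
      have "l * (real m * ((1 - l) * \<mu> - k)) < l * S" using b by (simp add: power2_eq_square algebra_simps)
      then have b': "(1 - l) * \<mu> - k < S / real m" using m0 by (simp add: l_def field_simps)
      have "\<bar>S / real m - \<mu>\<bar> \<le> l * \<mu> + k" using a' b' by (simp add: algebra_simps abs_le_iff)
      then show ?thesis unfolding S_def \<mu>_def Y_def s_def by simp
    qed
    have Fm: "F p \<in> borel_measurable M" unfolding F_def by (intro borel_measurable_times borel_measurable_sum borel_measurable_const psi)
    have Fb: "\<bar>F p x\<bar> \<le> t * 2 ^ L" for x
    proof -
      have "\<bar>\<Sum>a\<in>I. p a * psi a x\<bar> \<le> (\<Sum>a\<in>I. \<bar>p a * psi a x\<bar>)" by (rule sum_abs)
      also have "\<dots> \<le> sum p I"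
      proof (rule sum_mono)
        fix a assume a: "a \<in> I"
        show "\<bar>p a * psi a x\<bar> \<le> p a"
          unfolding abs_mult using mult_left_le[OF bd[OF a, of x], of "p a"] p0 a by simp
      qed
      finally have "\<bar>F p x\<bar> \<le> R * 1" unfolding F_def abs_mult using R p1 by (intro mult_mono) auto
      then show ?thesis using L1 by (simp add: t_def)
    qed
    define A where "A = expectation (\<lambda>x. (F p x)\<^sup>2)"
    define B where "B = (\<Sum>j<m. (F p (w j))\<^sup>2) / real m"
    define z where "z = eta * (t * 2 ^ L)\<^sup>2"
    have z: "z = 1 / 96" using TL2 by (auto simp: z_def eta_def)
    have "\<bar>B - A\<bar> \<le> t\<^sup>2 + (22 * e * B + z) + (22 * e * A + z) + l * (A + 22 * e * A + z) + real L * k"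
      unfolding A_def B_def z_def
    proof (rule layered_deviation[OF Fm Fb, where eta=eta and k=k])
      show "G i (h i) \<in> borel_measurable M" if "i < L" for i by (rule Gm[OF h[OF that]])
      show "0 < t" "0 \<le> e" "e \<le> 1 / 2" "0 \<le> l" by (simp_all add: t_def e_def l_def)
      show "0 \<le> eta" "0 < m" using eta0 m0 by simp_all
    qed (rule h1 h2 dev; assumption)+
    moreover have "real L * k = 1 / 32" using L by (simp add: k_def)
    moreover have "0 \<le> A" unfolding A_def by (intro Bochner_Integration.integral_nonneg) auto
    ultimately have "\<bar>B - A\<bar> \<le> 1 / 36 + (22 / 1024 * B + 1 / 96) + (22 / 1024 * A + 1 / 96)
        + 1 / 32 * (A + 22 / 1024 * A + 1 / 96) + 1 / 32" and A0: "0 \<le> A"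
      unfolding z t_def e_def l_def by (simp_all add: power2_eq_square)
    \<comment> \<open>\<open>B\<close> stands on both sides, on the right with coefficient
      \<open>22 / 1024\<close> only; together with \<open>A \<le> 1\<close> this is a linear
      problem.\<close>
    then have "\<bar>B - A\<bar> \<le> 1 / 4" using A1[folded A_def] unfolding abs_le_iff
      by argo
    then show ?thesis by (simp add: A_def B_def)
  qed
  show ?thesis by (intro bexI[of _ E] conjI Em PE ballI allI impI) (use main in auto)
qed

section \<open>Legendre and Chebyshev polynomials\<close>

fun base_density :: "poly_family \<Rightarrow> real \<Rightarrow> real" where
  "base_density Legendre t = indicator {-1..1} t / 2"
| "base_density Chebyshev t = indicator {-1..1} t / (pi * sqrt (1 - t\<^sup>2))"

lemma base_density_nonneg: "0 \<le> base_density fam t"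
proof (cases "t \<in> {-1..1}")
  case True
  then have "t\<^sup>2 \<le> 1" by (auto simp: power_le_one_iff abs_square_le_1)
  then show ?thesis by (cases fam) auto
qed (cases fam; simp)

lemma borel_measurable_base_density [measurable]: "base_density fam \<in> borel_measurable borel"
proof -
  have "base_density fam = (\<lambda>t. base_density fam t)" by simp
  then show ?thesis by (cases fam) (simp_all, measurable)
qed

lemma base_measure_eq: "base_measure fam = density lborel (\<lambda>t. ennreal (base_density fam t))"
proof (cases fam)
  case Legendre
  have "(\<lambda>t. indicator {-1..1} t / emeasure lborel {-1..1::real}) = (\<lambda>t. ennreal (base_density Legendre t))"
  proof
    fix t :: real
    have "ennreal (indicator {-1..1} t / 2) = ennreal (indicator {-1..1} t) / ennreal 2"
      by (rule divide_ennreal[symmetric]) auto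
    then show "indicator {-1..1} t / emeasure lborel {-1..1::real} = ennreal (base_density Legendre t)"
      by (simp add: ennreal_indicator)
  qed
  then show ?thesis by (simp add: Legendre uniform_measure_def)
qed simp

lemma sets_base_measure [simp, measurable_cong]: "sets (base_measure fam) = sets borel"
  and space_base_measure [simp]: "space (base_measure fam) = UNIV"
  by (simp_all add: base_measure_eq)

lemma AE_base_measure: "AE t in base_measure fam. t \<in> {-1..1}"
  unfolding base_measure_eq
proof (subst AE_density)
  show "AE t in lborel. 0 < ennreal (base_density fam t) \<longrightarrow> t \<in> {-1..1}"
    by (cases fam) (auto intro!: AE_I2 split: split_indicator)
qed measurable

text \<open>The density is unbounded at the endpoints, so the fundamental theorem is used on the
  open interval with one-sided limits of \<open>F\<close>. Integrability comes from nonnegativity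
  for the total mass, where \<open>F\<close> is a multiple of arcsin, and from elsewhere for the
  boundary term, whose integrand may change sign.\<close>

lemma chebyshev_density_FTC:
  fixes F f :: "real \<Rightarrow> real"
  assumes F: "\<And>x. -1 < x \<Longrightarrow> x < 1 \<Longrightarrow> (F has_real_derivative f x / (pi * sqrt (1 - x\<^sup>2))) (at x)"
    and f: "\<And>x. isCont f x" and contF: "continuous_on {-1..1} F"
    and int: "(\<forall>x. 0 \<le> f x) \<or> integrable lborel (\<lambda>x. base_density Chebyshev x * f x)"
  shows "has_bochner_integral lborel (\<lambda>x. base_density Chebyshev x * f x) (F 1 - F (-1))"
proof -
  let ?g = "\<lambda>x. f x / (pi * sqrt (1 - x\<^sup>2))"
  have pos: "0 < 1 - x\<^sup>2" if "-1 < x" "x < 1" for x :: real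
    using that by (simp add: abs_square_less_1 abs_less_iff)
  have g: "isCont ?g x" if "-1 < x" "x < 1" for x
    using pos[OF that] by (intro continuous_intros f) auto
  have lim1: "((F \<circ> real_of_ereal) \<longlongrightarrow> F (-1)) (at_right (ereal (-1)))"
    unfolding comp_def ereal_tendsto_simps1(2)[unfolded comp_def]
    using contF by (auto simp: continuous_on_Icc_at_rightD)
  have lim2: "((F \<circ> real_of_ereal) \<longlongrightarrow> F 1) (at_left (ereal 1))"
    unfolding comp_def ereal_tendsto_simps1(1)[unfolded comp_def]
    using contF by (auto simp: continuous_on_Icc_at_leftD)
  \<comment> \<open>At \<open>1\<close> and \<open>-1\<close> the density is a division by zero,
    hence 0, so the closed and the open interval give the same function everywhere.\<close>
  have eq: "(\<lambda>x. base_density Chebyshev x * f x) = (\<lambda>x. indicator (einterval (ereal (-1)) (ereal 1)) x *\<^sub>R ?g x)"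
  proof
    fix x :: real
    have "x = 1 \<or> x = -1 \<or> (x \<noteq> 1 \<and> x \<noteq> -1)" by auto
    then show "base_density Chebyshev x * f x = indicator (einterval (ereal (-1)) (ereal 1)) x *\<^sub>R ?g x"
      by (auto simp: einterval_def indicator_def)
  qed
  have si: "set_integrable lborel (einterval (ereal (-1)) (ereal 1)) ?g"
  proof (rule disjE[OF int])
    assume nn: "\<forall>x. 0 \<le> f x"
    show ?thesis
      by (rule interval_integral_FTC_nonneg[of _ _ F, OF _ _ _ _ lim1 lim2])
         (use F g pos nn in \<open>auto intro!: AE_I2 divide_nonneg_nonneg mult_nonneg_nonneg simp: less_imp_le\<close>)
  next
    assume "integrable lborel (\<lambda>x. base_density Chebyshev x * f x)"
    then show ?thesis unfolding eq set_integrable_def .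
  qed
  have "(LBINT x=ereal (-1)..ereal 1. ?g x) = F 1 - F (-1)"
    by (rule interval_integral_FTC_integrable[OF _ _ _ si lim1 lim2])
       (use F g in \<open>auto simp flip: has_real_derivative_iff_has_vector_derivative\<close>)
  then have "(\<integral>x. indicator (einterval (ereal (-1)) (ereal 1)) x *\<^sub>R ?g x \<partial>lborel) = F 1 - F (-1)"
    by (simp add: interval_lebesgue_integral_def set_lebesgue_integral_def)
  then show ?thesis unfolding eq using si by (simp add: has_bochner_integral_iff set_integrable_def)
qed

lemma has_bochner_integral_base_density: "has_bochner_integral lborel (base_density fam) 1"
proof (cases fam)
  case Legendre
  have "has_bochner_integral lborel (\<lambda>x::real. (1/2) * indicator {-1..1} x) ((\<lambda>x. x / 2) 1 - (\<lambda>x. x / 2) (-1 :: real))"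
  proof (rule has_bochner_integral_FTC_Icc_real[of "-1" 1 "\<lambda>x. x / 2" "\<lambda>_. 1 / 2"])
    show "((\<lambda>x. x / 2) has_real_derivative 1 / 2) (at x)" for x :: real
      by (auto intro!: derivative_eq_intros)
  qed auto
  then show ?thesis by (simp add: Legendre fun_eq_iff cong: has_bochner_integral_cong)
next
  case Chebyshev
  have "has_bochner_integral lborel (\<lambda>x. base_density Chebyshev x * 1) (arcsin 1 / pi - arcsin (-1) / pi)"
  proof (rule chebyshev_density_FTC)
    fix x :: real assume "-1 < x" "x < 1"
    then show "((\<lambda>x. arcsin x / pi) has_real_derivative 1 / (pi * sqrt (1 - x\<^sup>2))) (at x)"
      by (auto intro!: derivative_eq_intros simp: field_simps)
  qed (auto intro!: continuous_intros)
  then show ?thesis by (simp add: Chebyshev field_simps cong: has_bochner_integral_cong)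
qed

lemma prob_space_base_measure: "prob_space (base_measure fam)"
proof
  have "emeasure (base_measure fam) (space (base_measure fam)) = (\<integral>\<^sup>+x. ennreal (base_density fam x) \<partial>lborel)"
    unfolding base_measure_eq by (simp add: emeasure_density)
  also have "\<dots> = 1"
    using has_bochner_integral_base_density[of fam]
    by (subst nn_integral_eq_integral) (auto simp: has_bochner_integral_iff base_density_nonneg)
  finally show "emeasure (base_measure fam) (space (base_measure fam)) = 1" .
qed

lemma poly_borel_measurable [measurable]:
  fixes p :: "real poly"
  assumes "f \<in> borel_measurable M"
  shows "(\<lambda>x. poly p (f x)) \<in> borel_measurable M"
proof -
  have "poly p \<in> borel_measurable borel"
    by (intro borel_measurable_continuous_onI continuous_intros)
  then show ?thesis using assms by (rule measurable_compose_rev)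
qed

lemma poly_bounded_cube:
  fixes p :: "real poly"
  obtains B where "\<forall>t\<in>{-1..1}. \<bar>poly p t\<bar> \<le> B"
proof -
  have "compact (poly p ` {-1..1})"
    by (intro compact_continuous_image continuous_intros compact_Icc)
  then have "bounded (poly p ` {-1..1})" by (rule compact_imp_bounded)
  then obtain B where B: "\<forall>x\<in>poly p ` {-1..1}. norm x \<le> B" by (auto simp: bounded_iff)
  show thesis by (rule that[of B]) (use B in auto)
qed

lemma integrable_poly_base_measure: "integrable (base_measure fam) (poly p)"
proof -
  interpret prob_space "base_measure fam" by (rule prob_space_base_measure)
  obtain B where B: "\<forall>t\<in>{-1..1}. \<bar>poly p t\<bar> \<le> B" by (rule poly_bounded_cube)
  show ?thesis
  proof (rule integrable_const_bound[where B=B])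
    show "AE x in base_measure fam. norm (poly p x) \<le> B"
      using AE_base_measure[of fam] by eventually_elim (use B in auto)
  qed measurable
qed

text \<open>The coefficient of \<open>x p'\<close> in the Sturm-Liouville operator of the
  family.\<close>

fun drift :: "poly_family \<Rightarrow> real" where
  "drift Legendre = 2" | "drift Chebyshev = 1"

lemma integrable_base_measure_iff:
  assumes [measurable]: "f \<in> borel_measurable borel"
  shows "integrable (base_measure fam) f \<longleftrightarrow> integrable lborel (\<lambda>x. base_density fam x * (f x :: real))"
  unfolding base_measure_eq by (subst integrable_density) (simp_all add: base_density_nonneg)

lemma integral_base_measure_eqI:
  assumes [measurable]: "f \<in> borel_measurable borel"
    and "has_bochner_integral lborel (\<lambda>x. base_density fam x * f x) (c::real)"
  shows "integral\<^sup>L (base_measure fam) f = c"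
  using assms(2) unfolding base_measure_eq
  by (subst integral_density) (auto simp: base_density_nonneg has_bochner_integral_iff)

lemma integral_Legendre_pderiv:
  "integral\<^sup>L (base_measure Legendre) (poly (pderiv r)) = (poly r 1 - poly r (-1)) / 2"
proof (rule integral_base_measure_eqI)
  have "has_bochner_integral lborel (\<lambda>x. (poly (pderiv r) x / 2) * indicator {-1..1} x) (poly r 1 / 2 - poly r (-1) / 2)"
    by (rule has_bochner_integral_FTC_Icc_real[where F="\<lambda>x. poly r x / 2"])
       (auto intro!: derivative_eq_intros continuous_intros)
  then show "has_bochner_integral lborel (\<lambda>x. base_density Legendre x * poly (pderiv r) x) ((poly r 1 - poly r (-1)) / 2)"
    by (simp add: field_simps cong: has_bochner_integral_cong)
qed measurable

text \<open>The operator \<open>(1 - x\<^sup>2) p'' - b x p'\<close> is symmetric because, with \<open>w\<close> the density,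
  \<open>(1 - x\<^sup>2) w\<close> has derivative \<open>- b x w\<close> and vanishes at \<open>1\<close> and \<open>-1\<close>.\<close>

lemma integral_base_measure_boundary_term:
  "integral\<^sup>L (base_measure fam) (poly ([:1, 0, -1:] * pderiv r - smult (drift fam) ([:0, 1:] * r))) = 0"
proof (cases fam)
  case Legendre
  have "[:1, 0, -1:] * pderiv r - smult (drift fam) ([:0, 1:] * r) = pderiv ([:1, 0, -1:] * r)"
    by (rule poly_ext) (simp only: pderiv_mult poly_mult poly_add poly_diff poly_smult, simp add: Legendre pderiv_pCons algebra_simps)
  moreover have "poly ([:1, 0, -1:] * r) 1 = 0" "poly ([:1, 0, -1:] * r) (-1) = 0" by simp_all
  ultimately show ?thesis by (simp only: Legendre integral_Legendre_pderiv diff_self div_0)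
next
  case Chebyshev
  let ?f = "poly ([:1, 0, -1:] * pderiv r - smult (drift fam) ([:0, 1:] * r))"
  let ?F = "\<lambda>x. sqrt (1 - x\<^sup>2) * poly r x / pi"
  have "has_bochner_integral lborel (\<lambda>x. base_density Chebyshev x * ?f x) (?F 1 - ?F (-1))"
  proof (rule chebyshev_density_FTC)
    fix x :: real assume x: "-1 < x" "x < 1"
    then have pos: "0 < 1 - x\<^sup>2" by (simp add: abs_square_less_1 abs_less_iff)
    have sq: "sqrt (1 - x\<^sup>2) * sqrt (1 - x\<^sup>2) = 1 - x\<^sup>2" using pos by simp
    have "(?F has_real_derivative (sqrt (1 - x\<^sup>2) * poly (pderiv r) x + (- (2 * x)) * (inverse (sqrt (1 - x\<^sup>2)) / 2) * poly r x) / pi) (at x)"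
      using pos by (auto intro!: derivative_eq_intros)
    moreover have "(sqrt (1 - x\<^sup>2) * poly (pderiv r) x + (- (2 * x)) * (inverse (sqrt (1 - x\<^sup>2)) / 2) * poly r x) / pi = ?f x / (pi * sqrt (1 - x\<^sup>2))"
    proof -
      have "?f x = (1 - x\<^sup>2) * poly (pderiv r) x - x * poly r x"
        by (simp add: Chebyshev power2_eq_square algebra_simps)
      also have "\<dots> = sqrt (1 - x\<^sup>2) * sqrt (1 - x\<^sup>2) * poly (pderiv r) x - x * poly r x" using sq by simp
      finally have fx: "?f x = \<dots>" .
      show ?thesis unfolding fx using pos by (simp add: field_simps)
    qed
    ultimately show "(?F has_real_derivative ?f x / (pi * sqrt (1 - x\<^sup>2))) (at x)" by simp
  next
    have "integrable lborel (\<lambda>x. base_density Chebyshev x * ?f x)"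
      by (subst integrable_base_measure_iff[symmetric]) (measurable, rule integrable_poly_base_measure)
    then show "(\<forall>x. 0 \<le> ?f x) \<or> integrable lborel (\<lambda>x. base_density Chebyshev x * ?f x)" ..
  qed (auto intro!: continuous_intros)
  then have "has_bochner_integral lborel (\<lambda>x. base_density Chebyshev x * ?f x) 0" by simp
  then show ?thesis unfolding Chebyshev by (intro integral_base_measure_eqI) measurable
qed

text \<open>Squared maxima on the interval. The Chebyshev value at index 0 has to be exactly
  \<open>1\<close>: with \<open>2\<close> there, the first slice in \<open>powr_layer_step\<close>
  would already break the bound.\<close>

fun sup_sq :: "poly_family \<Rightarrow> nat \<Rightarrow> real" where
  "sup_sq Legendre n = 2 * real n + 1"
| "sup_sq Chebyshev n = (if n = 0 then 1 else 2)"

lemma sup_sq_ge_1: "1 \<le> sup_sq fam n"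
  by (cases fam) auto

lemma poly_fun:
  "poly (p + q) = (\<lambda>x. poly p x + poly q x)" "poly (p * q) = (\<lambda>x. poly p x * poly q x)"
  "poly (smult a p) = (\<lambda>x. a * poly p x)" "poly 0 = (\<lambda>x. 0)"
  by (simp_all add: fun_eq_iff)

section \<open>Sturm-Liouville equation and pointwise bounds\<close>

locale orthonormal_family =
  fixes fam :: poly_family and P :: "nat \<Rightarrow> real poly"
  assumes orth: "orthonormal_polys (base_measure fam) P"
begin

text \<open>Integration as a linear functional on polynomials keeps the arguments algebraic; all
  that is given of \<open>P\<close> is degrees and orthonormality, so every property has to be
  extracted from these.\<close>

definition mean :: "real poly \<Rightarrow> real" where
  "mean p = integral\<^sup>L (base_measure fam) (poly p)"

definition diff_op :: "real poly \<Rightarrow> real poly" where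
  "diff_op p = [:1, 0, -1:] * pderiv (pderiv p) - smult (drift fam) ([:0, 1:] * pderiv p)"

lemma degree_P [simp]: "degree (P n) = n"
  using orth by (simp add: orthonormal_polys_def)

lemma mean_P_mult: "mean (P n * P k) = (if n = k then 1 else 0)"
  using orth by (simp add: orthonormal_polys_def mean_def poly_fun)

lemma mean_add: "mean (p + q) = mean p + mean q"
  using integrable_poly_base_measure[of fam p] integrable_poly_base_measure[of fam q]
  by (simp add: mean_def poly_fun)

lemma mean_smult: "mean (smult a p) = a * mean p"
  by (simp add: mean_def poly_fun)

lemma mean_minus: "mean (- p) = - mean p"
  using mean_smult[of "-1" p] by simp

lemma mean_0 [simp]: "mean 0 = 0"
  by (simp add: mean_def poly_fun)

lemma lead_coeff_P: "lead_coeff (P n) \<noteq> 0"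
proof -
  have "P n \<noteq> 0"
  proof
    assume "P n = 0"
    then have "mean (P n * P n) = 0" by simp
    then show False by (simp add: mean_P_mult)
  qed
  then show ?thesis using leading_coeff_0_iff[of "P n"] by auto
qed

lemma poly_split:
  fixes q :: "real poly"
  obtains a q' where "q = smult a (P (degree q)) + q'" "q' = 0 \<or> degree q' < degree q"
    "a = lead_coeff q / lead_coeff (P (degree q))"
proof -
  define d where "d = degree q"
  define a where "a = lead_coeff q / lead_coeff (P d)"
  define q' where "q' = q - smult a (P d)"
  have c0: "coeff q' d = 0" using lead_coeff_P[of d] by (simp add: q'_def a_def d_def)
  have dle: "degree q' \<le> d" unfolding q'_def by (intro degree_diff_le) (auto simp: d_def degree_smult_le intro: order_trans[OF degree_smult_le])
  have "q' = 0 \<or> degree q' < d"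
  proof (rule ccontr)
    assume "\<not> (q' = 0 \<or> degree q' < d)"
    then have "degree q' = d" "q' \<noteq> 0" using dle by auto
    then show False using c0 by (metis leading_coeff_0_iff)
  qed
  then show thesis by (intro that[of a q']) (auto simp: q'_def a_def d_def)
qed

lemma mean_P_lower:
  assumes "q = 0 \<or> degree q < n"
  shows "mean (P n * q) = 0"
  using assms
proof (induction "degree q" arbitrary: q rule: less_induct)
  case less
  show ?case
  proof (cases "q = 0")
    case False
    obtain a q' where q: "q = smult a (P (degree q)) + q'" "q' = 0 \<or> degree q' < degree q"
      by (rule poly_split)
    have dq: "degree q < n" using less.prems False by simp
    have q': "mean (P n * q') = 0"
    proof (cases "q' = 0")
      case False
      then show ?thesis using q(2) dq by (intro less.hyps) auto
    qed simp
    have "mean (P n * q) = a * mean (P n * P (degree q)) + mean (P n * q')"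
      by (subst q(1)) (simp add: algebra_simps mean_add mean_smult)
    then show ?thesis using q' dq by (simp add: mean_P_mult)
  qed simp
qed

lemma mean_P_degree:
  assumes "degree q = n"
  shows "mean (P n * q) = lead_coeff q / lead_coeff (P n)"
proof -
  obtain a q' where q: "q = smult a (P (degree q)) + q'" "q' = 0 \<or> degree q' < degree q"
    "a = lead_coeff q / lead_coeff (P (degree q))" by (rule poly_split)
  have "mean (P n * q) = a * mean (P n * P (degree q)) + mean (P n * q')"
    by (subst q(1)) (simp add: algebra_simps mean_add mean_smult)
  then show ?thesis using q assms mean_P_lower[of q' n] by (simp add: mean_P_mult)
qed

text \<open>Integration by parts, obtained from \<open>integral_base_measure_boundary_term\<close>
  with \<open>pderiv p * q\<close> as \<open>r\<close>. The right-hand side is symmetric in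
  \<open>p\<close> and \<open>q\<close>, hence so is the left.\<close>

lemma mean_diff_op: "mean (diff_op p * q) = - mean ([:1, 0, -1:] * (pderiv p * pderiv q))"
proof -
  have eq: "[:1, 0, -1:] * pderiv (pderiv p * q) - smult (drift fam) ([:0, 1:] * (pderiv p * q))
      = diff_op p * q + [:1, 0, -1:] * (pderiv p * pderiv q)"
    by (rule poly_ext) (simp add: diff_op_def pderiv_mult algebra_simps)
  have "mean ([:1, 0, -1:] * pderiv (pderiv p * q) - smult (drift fam) ([:0, 1:] * (pderiv p * q))) = 0"
    unfolding mean_def by (rule integral_base_measure_boundary_term)
  then show ?thesis unfolding eq mean_add by simp
qed

lemma mean_diff_op_sym: "mean (diff_op p * q) = mean (p * diff_op q)"
  using mean_diff_op[of p q] mean_diff_op[of q p] by (simp add: mult.commute)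

text \<open>Each coefficient of the image depends only on those at \<open>k\<close> and
  \<open>k + 2\<close>, so the operator does not raise degrees, and it multiplies the leading
  coefficient by what becomes the eigenvalue.\<close>

lemma coeff_diff_op:
  "coeff (diff_op p) k = real (k + 2) * real (k + 1) * coeff p (k + 2) - real k * (real k - 1 + drift fam) * coeff p k"
proof -
  have e: "[:1, 0, -1:] * q = q - pCons 0 (pCons 0 q)" for q :: "real poly" by (simp add: algebra_simps)
  show ?thesis
    unfolding diff_op_def e
    by (cases k; cases "k - 1") (auto simp: coeff_pderiv coeff_pCons algebra_simps split: nat.splits)
qed

text \<open>In \<open>q\<close> the leading terms cancel, so its degree is below \<open>n\<close>.
  Testing \<open>q\<close> against \<open>P (degree q)\<close> moves the operator, by symmetry, onto
  a polynomial of degree below \<open>n\<close>, to which \<open>P n\<close> is orthogonal. That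
  test computes the leading coefficient of \<open>q\<close>, which must therefore vanish.\<close>

lemma diff_op_P: "diff_op (P n) = smult (- (real n * (real n - 1 + drift fam))) (P n)"
proof -
  define e where "e = real n * (real n - 1 + drift fam)"
  define q where "q = diff_op (P n) + smult e (P n)"
  have "coeff q k = 0" if "k \<ge> n" for k
  proof (cases "k = n")
    case True
    then show ?thesis by (simp add: q_def coeff_diff_op e_def coeff_eq_0)
  next
    case False
    then show ?thesis using that by (simp add: q_def coeff_diff_op coeff_eq_0)
  qed
  then have small: "q = 0 \<or> degree q < n"
    by (metis leading_coeff_0_iff not_le)
  have lowdeg: "r = 0 \<or> degree r < n \<Longrightarrow> diff_op r = 0 \<or> degree (diff_op r) < n" for r
  proof (cases "r = 0")
    case False
    assume "r = 0 \<or> degree r < n"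
    then have "degree r < n" using False by simp
    then have "\<And>k. k \<ge> n \<Longrightarrow> coeff (diff_op r) k = 0" by (simp add: coeff_diff_op coeff_eq_0)
    then show ?thesis by (metis leading_coeff_0_iff not_le)
  qed (simp add: diff_op_def)
  have "q = 0"
  proof (rule ccontr)
    assume q0: "q \<noteq> 0"
    then have d: "degree q < n" using small by simp
    have "mean (P (degree q) * q) = mean (diff_op (P n) * P (degree q)) + e * mean (P n * P (degree q))"
      unfolding q_def by (simp add: algebra_simps mean_add mean_smult)
    also have "\<dots> = mean (P n * diff_op (P (degree q)))"
      using d by (simp add: mean_diff_op_sym mean_P_mult)
    also have "\<dots> = 0" by (intro mean_P_lower lowdeg) (use d in simp)
    finally have "lead_coeff q / lead_coeff (P (degree q)) = 0" using mean_P_degree[of q] by simp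
    then show False using q0 lead_coeff_P by simp
  qed
  then show ?thesis by (simp add: q_def e_def add_eq_0_iff2)
qed

lemma mean_energy: "mean ([:1, 0, -1:] * (pderiv (P n) * pderiv (P n))) = real n * (real n - 1 + drift fam)"
proof -
  have "mean (diff_op (P n) * P n) = - (real n * (real n - 1 + drift fam))"
    by (simp add: diff_op_P mean_minus mean_smult mean_P_mult)
  then show ?thesis unfolding mean_diff_op by linarith
qed

lemma poly_diff_op_P:
  "(1 - x\<^sup>2) * poly (pderiv (pderiv (P n))) x
     = drift fam * x * poly (pderiv (P n)) x - real n * (real n - 1 + drift fam) * poly (P n) x"
  using arg_cong[OF diff_op_P[of n], of "\<lambda>p. poly p x"]
  by (simp add: diff_op_def algebra_simps power2_eq_square)

lemma mean_const: "mean [:c:] = c"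
proof -
  interpret prob_space "base_measure fam" by (rule prob_space_base_measure)
  have "poly [:c:] = (\<lambda>x. c)" by (simp add: fun_eq_iff)
  then show ?thesis using prob_space by (simp add: mean_def)
qed

lemma P_0_square: "(poly (P 0) x)\<^sup>2 = 1"
proof -
  obtain c where c: "P 0 = [:c:]" by (metis degree_P degree_eq_zeroE)
  have "mean (P 0 * P 0) = 1" by (simp add: mean_P_mult)
  then have "mean [:c * c:] = 1" by (simp add: c)
  then show ?thesis by (simp add: c mean_const power2_eq_square)
qed

lemma poly_pderiv_quadratic_mult:
  "poly (pderiv ([:1, 0, -1:] * q)) x = (1 - x\<^sup>2) * poly (pderiv q) x - 2 * x * poly q x"
  for x :: real
  unfolding pderiv_mult by (simp add: pderiv_pCons algebra_simps power2_eq_square)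

text \<open>For the Chebyshev cosines, \<open>Q\<close> is a multiple of cosine squared plus sine
  squared. The differential equation makes it constant, and its mean, \<open>1\<close> from the norm
  and \<open>1\<close> from \<open>mean_energy\<close>, identifies the constant as 2.\<close>

lemma P_bound_Chebyshev:
  assumes fam: "fam = Chebyshev" and n: "0 < n" and x: "\<bar>x\<bar> \<le> 1"
  shows "(poly (P n) x)\<^sup>2 \<le> 2"
proof -
  define Q where "Q = P n * P n + smult (1 / (real n)\<^sup>2) ([:1, 0, -1:] * (pderiv (P n) * pderiv (P n)))"
  have pd: "pderiv Q = 0"
  proof (rule poly_ext)
    fix x
    have "poly (pderiv Q) x = 2 * poly (P n) x * poly (pderiv (P n)) x
       + 1 / (real n)\<^sup>2 * (2 * poly (pderiv (P n)) x * ((1 - x\<^sup>2) * poly (pderiv (pderiv (P n))) x) - 2 * x * (poly (pderiv (P n)) x)\<^sup>2)"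
      unfolding Q_def pderiv_add pderiv_smult poly_add poly_smult poly_pderiv_quadratic_mult
      by (simp add: pderiv_mult algebra_simps power2_eq_square)
    also have "\<dots> = 0" unfolding poly_diff_op_P using n by (simp add: fam field_simps power2_eq_square)
    finally show "poly (pderiv Q) x = poly 0 x" by simp
  qed
  then obtain c where c: "Q = [:c:]" by (metis pderiv_eq_0_iff degree_eq_zeroE)
  have "mean Q = 1 + 1 / (real n)\<^sup>2 * (real n)\<^sup>2"
  proof -
    have d: "drift fam = 1" by (simp add: fam)
    show ?thesis unfolding Q_def mean_add mean_smult mean_energy d mean_P_mult
      by (simp add: power2_eq_square)
  qed
  then have "c = 2" using n by (simp add: c mean_const)
  then have "poly Q x = 2" by (simp add: c)
  moreover have "poly Q x = (poly (P n) x)\<^sup>2 + 1 / (real n)\<^sup>2 * ((1 - x\<^sup>2) * (poly (pderiv (P n)) x)\<^sup>2)"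
    by (simp add: Q_def algebra_simps power2_eq_square)
  moreover have "0 \<le> 1 / (real n)\<^sup>2 * ((1 - x\<^sup>2) * (poly (pderiv (P n)) x)\<^sup>2)"
    using x by (intro mult_nonneg_nonneg) (auto simp: abs_square_le_1)
  ultimately show ?thesis by linarith
qed

text \<open>Two exact derivatives are integrated. That of \<open>P n * P n\<close> shows that the
  endpoint squares agree, since \<open>P n\<close> is orthogonal to its derivative; that of
  \<open>x\<close> times this square gives their sum, where the mean of \<open>P n\<close> against
  \<open>x\<close> times its derivative is \<open>n\<close> by comparison of leading
  coefficients.\<close>

lemma P_endpoints_Legendre:
  assumes fam: "fam = Legendre"
  shows "(poly (P n) 1)\<^sup>2 = 2 * real n + 1" "(poly (P n) (-1))\<^sup>2 = 2 * real n + 1"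
proof -
  have m: "mean (pderiv r) = (poly r 1 - poly r (-1)) / 2" for r
    unfolding mean_def by (simp only: fam integral_Legendre_pderiv)
  have low: "mean (P n * pderiv (P n)) = 0"
    by (rule mean_P_lower) (auto simp: degree_pderiv pderiv_eq_0_iff)
  have "mean (pderiv (P n * P n)) = 0" unfolding pderiv_mult mean_add using low by simp
  then have eq: "(poly (P n) 1)\<^sup>2 = (poly (P n) (-1))\<^sup>2"
    using m[of "P n * P n"] by (simp add: power2_eq_square)
  have top: "mean (P n * pCons 0 (pderiv (P n))) = real n"
  proof (cases "n = 0")
    case True
    then have "pderiv (P n) = 0" by (simp add: pderiv_eq_0_iff)
    then show ?thesis by (simp add: True)
  next
    case False
    then have nz: "pderiv (P n) \<noteq> 0" by (simp add: pderiv_eq_0_iff)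
    have d: "degree (pCons 0 (pderiv (P n))) = n" using nz False by (simp add: degree_pderiv)
    have "lead_coeff (pCons 0 (pderiv (P n))) = real n * lead_coeff (P n)"
      unfolding d using False by (cases n) (auto simp: coeff_pderiv)
    then show ?thesis using mean_P_degree[OF d] lead_coeff_P[of n] by simp
  qed
  have "pderiv ([:0, 1:] * (P n * P n)) = P n * P n + smult 2 (P n * pCons 0 (pderiv (P n)))"
    by (rule poly_ext) (simp only: pderiv_mult poly_add poly_mult poly_smult, simp add: pderiv_pCons pderiv_mult algebra_simps)
  then have "mean (pderiv ([:0, 1:] * (P n * P n))) = 1 + 2 * real n"
    using top by (simp only: mean_add mean_smult mean_P_mult) simp
  then have "(poly (P n) 1)\<^sup>2 + (poly (P n) (-1))\<^sup>2 = 2 * (2 * real n + 1)"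
    using m[of "[:0, 1:] * (P n * P n)"] by (simp add: power2_eq_square)
  then show "(poly (P n) 1)\<^sup>2 = 2 * real n + 1" "(poly (P n) (-1))\<^sup>2 = 2 * real n + 1"
    using eq by auto
qed

text \<open>The analogue of the Chebyshev energy (Sonin's function) is not constant, but its
  derivative has the sign of \<open>x\<close>. It is therefore largest at an endpoint, where its
  second term vanishes and \<open>P_endpoints_Legendre\<close> gives the value.\<close>

lemma P_bound_Legendre:
  assumes fam: "fam = Legendre" and n: "0 < n" and x: "\<bar>x\<bar> \<le> 1"
  shows "(poly (P n) x)\<^sup>2 \<le> 2 * real n + 1"
proof -
  define e where "e = real n * (real n + 1)"
  have e0: "0 < e" using n by (simp add: e_def)
  define Q where "Q = P n * P n + smult (1 / e) ([:1, 0, -1:] * (pderiv (P n) * pderiv (P n)))"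
  have pd: "poly (pderiv Q) x = 2 * x * (poly (pderiv (P n)) x)\<^sup>2 / e" for x
  proof -
    have ode: "(1 - x\<^sup>2) * poly (pderiv (pderiv (P n))) x = 2 * x * poly (pderiv (P n)) x - e * poly (P n) x"
      using poly_diff_op_P[of x n] by (simp add: fam e_def add.commute)
    have "poly (pderiv Q) x = 2 * poly (P n) x * poly (pderiv (P n)) x
       + 1 / e * (2 * poly (pderiv (P n)) x * ((1 - x\<^sup>2) * poly (pderiv (pderiv (P n))) x) - 2 * x * (poly (pderiv (P n)) x)\<^sup>2)"
      unfolding Q_def pderiv_add pderiv_smult poly_add poly_smult poly_pderiv_quadratic_mult
      by (simp add: pderiv_mult algebra_simps power2_eq_square)
    also have "\<dots> = 2 * x * (poly (pderiv (P n)) x)\<^sup>2 / e"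
      unfolding ode using e0 by (simp add: field_simps power2_eq_square)
    finally show ?thesis .
  qed
  have Qx: "poly Q x = (poly (P n) x)\<^sup>2 + 1 / e * ((1 - x\<^sup>2) * (poly (pderiv (P n)) x)\<^sup>2)" for x
    by (simp add: Q_def algebra_simps power2_eq_square)
  have "poly Q x \<le> 2 * real n + 1"
  proof (cases "0 \<le> x")
    case True
    have "poly Q x \<le> poly Q 1"
      by (rule DERIV_nonneg_imp_nondecreasing[of x 1 "poly Q"])
         (use x True e0 in \<open>auto intro!: exI[of _ "poly (pderiv Q) _"] poly_DERIV simp: pd\<close>)
    then show ?thesis using P_endpoints_Legendre[OF fam, of n] by (simp add: Qx)
  next
    case False
    have "poly Q x \<le> poly Q (-1)"
      by (rule DERIV_nonpos_imp_nonincreasing[of "-1" x "poly Q"])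
         (use x False e0 in \<open>auto intro!: exI[of _ "poly (pderiv Q) _"] poly_DERIV simp: pd divide_nonpos_pos mult_nonpos_nonneg\<close>)
    then show ?thesis using P_endpoints_Legendre[OF fam, of n] by (simp add: Qx)
  qed
  moreover have "0 \<le> 1 / e * ((1 - x\<^sup>2) * (poly (pderiv (P n)) x)\<^sup>2)"
    using x e0 by (intro mult_nonneg_nonneg) (auto simp: abs_square_le_1)
  ultimately show ?thesis using Qx[of x] by linarith
qed

lemma P_bound:
  assumes "x \<in> {-1..1}"
  shows "(poly (P n) x)\<^sup>2 \<le> sup_sq fam n"
proof (cases "n = 0")
  case True
  then show ?thesis using P_0_square sup_sq_ge_1 by simp
next
  case False
  have x: "\<bar>x\<bar> \<le> 1" using assms by auto
  show ?thesis using P_bound_Chebyshev[OF _ _ x, of n] P_bound_Legendre[OF _ _ x, of n] False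
    by (cases fam) auto
qed

end

section \<open>Lower sets and the hyperbolic cross\<close>

text \<open>The origin of the Chebyshev exponent: for \<open>a \<ge> 1\<close> the increment of
  \<open>x powr a\<close> over a unit step grows with \<open>x\<close>, and at \<open>x = 1\<close>
  it is \<open>2 powr a - 1\<close>, which equals 2 exactly when
  \<open>a = ln 3 / ln 2\<close>.\<close>

lemma powr_succ_diff_ge_2:
  fixes u :: real
  assumes "1 \<le> u"
  shows "u powr (ln 3 / ln 2) + 2 \<le> (u + 1) powr (ln 3 / ln 2)"
proof -
  define a where "a = ln 3 / ln (2::real)"
  have a1: "1 \<le> a" by (simp add: a_def)
  define f where "f x = (x + 1) powr a - x powr a" for x :: real
  have "f 1 \<le> f u"
  proof (rule DERIV_nonneg_imp_nondecreasing[OF assms])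
    fix x :: real assume x: "1 \<le> x" "x \<le> u"
    have "(f has_real_derivative a * (x + 1) powr (a - 1) - a * x powr (a - 1)) (at x)"
      unfolding f_def using x by (auto intro!: derivative_eq_intros)
    moreover have "0 \<le> a * (x + 1) powr (a - 1) - a * x powr (a - 1)"
      using a1 x powr_mono2[of "a - 1" x "x + 1"] by (simp add: mult_left_mono)
    ultimately show "\<exists>y. (f has_real_derivative y) (at x) \<and> 0 \<le> y" by blast
  qed
  moreover have "f 1 = 2" by (simp add: f_def a_def powr_def)
  ultimately show ?thesis by (simp add: f_def a_def)
qed

text \<open>One step of the induction over the slices of a lower set: slice \<open>j\<close> has size \<open>b\<close>, and the
  \<open>j\<close> slices before it, none of them smaller, have total size \<open>a\<close>.\<close>

lemma powr_layer_step:
  fixes a b :: real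
  assumes b: "0 \<le> b" and a: "real j * b \<le> a" and j0: "j = 0 \<Longrightarrow> a = 0"
  shows "a powr (1 + beta' fam) + sup_sq fam j * b powr (1 + beta' fam) \<le> (a + b) powr (1 + beta' fam)"
proof (cases "j = 0 \<or> b = 0")
  case True
  then show ?thesis using j0 by (cases fam) auto
next
  case False
  then have b0: "0 < b" and j1: "1 \<le> real j" using b by auto
  have ab: "b \<le> a" using mult_right_mono[OF j1 b] a by simp
  have a0: "0 < a" using ab b0 by simp
  show ?thesis
  proof (cases fam)
    case Legendre
    \<comment> \<open>The cross term \<open>2 * a * b\<close> is at least
      \<open>2 * real j * b\<^sup>2\<close> because \<open>real j * b \<le> a\<close>.\<close>
    have "a\<^sup>2 + (2 * real j + 1) * b\<^sup>2 \<le> (a + b)\<^sup>2"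
      using mult_right_mono[OF a b] by (simp add: algebra_simps power2_eq_square)
    then show ?thesis using a0 b0 by (simp add: Legendre)
  next
    case Chebyshev
    define e where "e = ln 3 / ln (2::real)"
    have u: "1 \<le> a / b" using ab b0 by simp
    have "((a / b) powr e + 2) * b powr e \<le> (a / b + 1) powr e * b powr e"
      unfolding e_def by (intro mult_right_mono powr_succ_diff_ge_2[OF u]) auto
    moreover have "(a / b) powr e * b powr e = a powr e"
      using a0 b0 by (simp add: powr_mult[symmetric])
    moreover have "(a / b + 1) powr e * b powr e = (a + b) powr e"
    proof -
      have "(a / b + 1) * b = a + b" using b0 by (simp add: field_simps)
      then show ?thesis using a0 b0 powr_mult[of "a / b + 1" b e] by simp
    qed
    ultimately show ?thesis using False by (simp add: Chebyshev e_def[symmetric] algebra_simps)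
  qed
qed

text \<open>Monotonicity supplies the hypothesis of \<open>powr_layer_step\<close>: the first
  \<open>J\<close> terms total at least \<open>J\<close> times the next one.\<close>

lemma sum_powr_decreasing:
  fixes n :: "nat \<Rightarrow> real"
  assumes nn: "\<And>j. 0 \<le> n j" and dec: "\<And>i j. i \<le> j \<Longrightarrow> n j \<le> n i"
  shows "(\<Sum>j<J. sup_sq fam j * n j powr (1 + beta' fam)) \<le> (\<Sum>j<J. n j) powr (1 + beta' fam)"
proof (induction J)
  case (Suc J)
  have "real J * n J \<le> (\<Sum>j<J. n j)"
    using sum_bounded_below[of "{..<J}" "n J" n] dec by simp
  then have "(\<Sum>j<J. n j) powr (1 + beta' fam) + sup_sq fam J * n J powr (1 + beta' fam)
      \<le> ((\<Sum>j<J. n j) + n J) powr (1 + beta' fam)"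
    by (intro powr_layer_step nn) auto
  then show ?case using Suc by simp
qed simp

lemma multi_indices_Suc_bij:
  assumes L: "L \<subseteq> multi_indices (Suc d)" and J: "\<And>\<nu>. \<nu> \<in> L \<Longrightarrow> \<nu> d < J"
  shows "bij_betw (\<lambda>(j, \<mu>). \<mu>(d := j)) (SIGMA j:{..<J}. {\<mu> \<in> multi_indices d. \<mu>(d := j) \<in> L}) L"
proof (rule bij_betw_imageI)
  show "inj_on (\<lambda>(j, \<mu>). \<mu>(d := j)) (SIGMA j:{..<J}. {\<mu> \<in> multi_indices d. \<mu>(d := j) \<in> L})"
  proof (rule inj_onI, clarify)
    fix i \<mu> j \<nu>
    assume m: "\<mu> \<in> multi_indices d" "\<nu> \<in> multi_indices d" and eq: "\<mu>(d := i) = \<nu>(d := j)"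
    have "i = j" using fun_cong[OF eq, of d] by simp
    moreover have "\<mu> k = \<nu> k" for k
      using fun_cong[OF eq, of k] m by (cases "k = d") (auto simp: multi_indices_def PiE_def extensional_def)
    ultimately show "i = j \<and> \<mu> = \<nu>" by auto
  qed
  show "(\<lambda>(j, \<mu>). \<mu>(d := j)) ` (SIGMA j:{..<J}. {\<mu> \<in> multi_indices d. \<mu>(d := j) \<in> L}) = L"
  proof safe
    fix \<nu> assume \<nu>: "\<nu> \<in> L"
    have "(restrict \<nu> {..<d})(d := \<nu> d) = \<nu>"
      using \<nu> L by (auto simp: multi_indices_def PiE_def extensional_def fun_eq_iff less_Suc_eq)
    moreover have "restrict \<nu> {..<d} \<in> multi_indices d" by (auto simp: multi_indices_def)
    ultimately show "\<nu> \<in> (\<lambda>(j, \<mu>). \<mu>(d := j)) ` (SIGMA j:{..<J}. {\<mu> \<in> multi_indices d. \<mu>(d := j) \<in> L})"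
      using \<nu> J[OF \<nu>] by (intro image_eqI[of _ _ "(\<nu> d, restrict \<nu> {..<d})"]) auto
  qed
qed

text \<open>Induction on the dimension by slicing along the last coordinate. The slices are lower
  and shrink as the slice index grows, so the induction hypothesis bounds each of them and
  \<open>sum_powr_decreasing\<close> combines the bounds. This estimate yields the radius
  \<open>R\<close> and bounds \<open>K_set\<close>.\<close>

lemma lower_set_sum_sup_sq:
  assumes "lower_set d L" and "finite L"
  shows "(\<Sum>\<nu>\<in>L. \<Prod>k<d. sup_sq fam (\<nu> k)) \<le> real (card L) powr (1 + beta' fam)"
  using assms
proof (induction d arbitrary: L)
  case 0
  then have "L \<subseteq> {\<lambda>_. undefined}" by (auto simp: lower_set_def multi_indices_def)
  then have "L = {} \<or> L = {\<lambda>_. undefined}" by blast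
  then show ?case by auto
next
  case (Suc d)
  \<comment> \<open>The inserted \<open>0\<close> keeps \<open>Max\<close> meaningful when
    \<open>L\<close> is empty.\<close>
  define J where "J = Suc (Max (insert 0 ((\<lambda>\<nu>. \<nu> d) ` L)))"
  define S where "S j = {\<mu> \<in> multi_indices d. \<mu>(d := j) \<in> L}" for j
  have Lsub: "L \<subseteq> multi_indices (Suc d)" using Suc.prems by (simp add: lower_set_def)
  have J: "\<nu> d < J" if "\<nu> \<in> L" for \<nu>
    unfolding J_def less_Suc_eq_le using that Suc.prems(2) by (intro Max_ge) auto
  have bij: "bij_betw (\<lambda>(j, \<mu>). \<mu>(d := j)) (Sigma {..<J} S) L"
    unfolding S_def by (rule multi_indices_Suc_bij[of L d J]) (use Lsub J in blast)+
  have upd: "\<mu>(d := j) \<in> multi_indices (Suc d)" if "\<mu> \<in> multi_indices d" for \<mu> j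
    using that by (auto simp: multi_indices_def PiE_def extensional_def)
  have down: "\<mu>(d := i) \<in> L" if "\<mu>' \<in> S j" "\<mu> \<in> multi_indices d" "\<forall>k<d. \<mu> k \<le> \<mu>' k" "i \<le> j" for \<mu> \<mu>' i j
  proof -
    have "\<mu>'(d := j) \<in> L" using that(1) by (simp add: S_def)
    moreover have "\<forall>k<Suc d. (\<mu>(d := i)) k \<le> (\<mu>'(d := j)) k" using that(3,4) by (auto simp: less_Suc_eq)
    ultimately show ?thesis using Suc.prems(1) upd[OF that(2), of i] unfolding lower_set_def by blast
  qed
  have fS: "finite (S j)" for j
  proof (rule inj_on_finite[of "\<lambda>\<mu>. \<mu>(d := j)" _ L])
    show "inj_on (\<lambda>\<mu>. \<mu>(d := j)) (S j)"
    proof (rule inj_onI)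
      fix \<mu> \<nu> assume m: "\<mu> \<in> S j" "\<nu> \<in> S j" and eq: "\<mu>(d := j) = \<nu>(d := j)"
      have "\<mu> k = \<nu> k" for k
        using fun_cong[OF eq, of k] m by (cases "k = d") (auto simp: S_def multi_indices_def PiE_def extensional_def)
      then show "\<mu> = \<nu>" by auto
    qed
  qed (auto simp: S_def Suc.prems)
  have lowS: "lower_set d (S j)" for j
    unfolding lower_set_def using down[of _ j _ j] by (auto simp: S_def)
  have decS: "real (card (S j)) \<le> real (card (S i))" if "i \<le> j" for i j
  proof -
    have "S j \<subseteq> S i" using down[of _ j _ i] that by (auto simp: S_def)
    then show ?thesis by (simp add: card_mono fS)
  qed
  have "(\<Sum>\<nu>\<in>L. \<Prod>k<Suc d. sup_sq fam (\<nu> k)) = (\<Sum>(j, \<mu>)\<in>Sigma {..<J} S. \<Prod>k<Suc d. sup_sq fam ((\<mu>(d := j)) k))"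
    by (subst sum.reindex_bij_betw[OF bij, symmetric]) (simp add: case_prod_unfold)
  also have "\<dots> = (\<Sum>j<J. \<Sum>\<mu>\<in>S j. \<Prod>k<Suc d. sup_sq fam ((\<mu>(d := j)) k))"
    by (subst sum.Sigma) (auto simp: fS)
  also have "\<dots> = (\<Sum>j<J. sup_sq fam j * (\<Sum>\<mu>\<in>S j. \<Prod>k<d. sup_sq fam (\<mu> k)))"
    by (simp add: sum_distrib_left mult.commute)
  also have "\<dots> \<le> (\<Sum>j<J. sup_sq fam j * real (card (S j)) powr (1 + beta' fam))"
    using sup_sq_ge_1[of fam] by (intro sum_mono mult_left_mono Suc.IH lowS fS) (auto intro: order_trans[OF zero_le_one])
  also have "\<dots> \<le> (\<Sum>j<J. real (card (S j))) powr (1 + beta' fam)"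
    by (rule sum_powr_decreasing) (simp, rule decS)
  also have "(\<Sum>j<J. real (card (S j))) = real (card L)"
    using bij_betw_same_card[OF bij] by (simp add: fS flip: of_nat_sum)
  finally show ?case .
qed

section \<open>Size of the hyperbolic cross and extension of lower sets\<close>

lemma hyperbolic_cross_subset: "hyperbolic_cross d s \<subseteq> {..<d} \<rightarrow>\<^sub>E {..<s}"
proof
  fix \<nu> assume \<nu>: "\<nu> \<in> hyperbolic_cross d s"
  have "\<nu> k < s" if "k < d" for k
  proof -
    have "1 \<le> (\<Prod>k\<in>{..<d} - {k}. \<nu> k + 1)" by (intro prod_ge_1) auto
    then have "(\<nu> k + 1) * 1 \<le> (\<nu> k + 1) * (\<Prod>k\<in>{..<d} - {k}. \<nu> k + 1)" by (rule mult_le_mono2)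
    also have "\<dots> = (\<Prod>k<d. \<nu> k + 1)" by (rule prod.remove[symmetric]) (use that in auto)
    finally have "\<nu> k + 1 \<le> (\<Prod>k<d. \<nu> k + 1)" by simp
    then show ?thesis using \<nu> by (simp add: hyperbolic_cross_def)
  qed
  then show "\<nu> \<in> {..<d} \<rightarrow>\<^sub>E {..<s}" using \<nu> by (auto simp: hyperbolic_cross_def multi_indices_def)
qed

lemma finite_hyperbolic_cross [simp]: "finite (hyperbolic_cross d s)"
  by (rule finite_subset[OF hyperbolic_cross_subset]) (rule finite_PiE, auto)

lemma sum_inverse_squares_le_2: "(\<Sum>j<n. 1 / (real j + 1)\<^sup>2) \<le> 2"
proof -
  have "(\<Sum>j<Suc n. 1 / (real j + 1)\<^sup>2) \<le> 2 - 1 / (real n + 1)" for n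
  proof (induction n)
    case (Suc n)
    have "1 / (real n + 2)\<^sup>2 \<le> 1 / ((real n + 1) * (real n + 2))"
      by (intro divide_left_mono) (auto simp: power2_eq_square mult_right_mono)
    also have "\<dots> = 1 / (real n + 1) - 1 / (real n + 2)"
      by (simp add: divide_simps)
    finally have "1 / (real n + 2)\<^sup>2 \<le> 1 / (real n + 1) - 1 / (real n + 2)" .
    then show ?case using Suc by (simp add: add.commute)
  qed simp
  moreover have "0 \<le> 1 / (real n + 1)" for n by simp
  ultimately have "(\<Sum>j<Suc n. 1 / (real j + 1)\<^sup>2) \<le> 2" for n
    using order_trans[of _ "2 - 1 / (real n + 1)" 2] by auto
  then show ?thesis by (cases n) auto
qed

text \<open>Rankin's trick: each index of the cross is counted with a weight of at least 1, namely
  the square of \<open>s\<close> over its product, and the sum is then extended to a box, where it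
  factors into one-dimensional sums of at most 2. The logarithm of the size is thus linear in
  \<open>log s\<close> and \<open>d\<close>.\<close>

lemma card_hyperbolic_cross_le: "real (card (hyperbolic_cross d s)) \<le> (real s)\<^sup>2 * 2 ^ d"
proof -
  have "real (card (hyperbolic_cross d s)) = (\<Sum>\<nu>\<in>hyperbolic_cross d s. 1)" by simp
  also have "\<dots> \<le> (\<Sum>\<nu>\<in>hyperbolic_cross d s. (real s)\<^sup>2 * (\<Prod>k<d. 1 / (real (\<nu> k) + 1)\<^sup>2))"
  proof (rule sum_mono)
    fix \<nu> assume "\<nu> \<in> hyperbolic_cross d s"
    then have "real (\<Prod>k<d. \<nu> k + 1) \<le> real s" unfolding hyperbolic_cross_def by (simp only: of_nat_le_iff mem_Collect_eq)
    then have le: "(\<Prod>k<d. real (\<nu> k) + 1) \<le> real s" by (simp add: of_nat_prod add.commute)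
    have pos: "0 < (\<Prod>k<d. real (\<nu> k) + 1)" by (intro prod_pos) auto
    have "1 \<le> (real s / (\<Prod>k<d. real (\<nu> k) + 1))\<^sup>2" using le pos by (intro one_le_power) simp
    also have "\<dots> = (real s)\<^sup>2 * (\<Prod>k<d. 1 / (real (\<nu> k) + 1)\<^sup>2)"
      by (simp add: power_divide prod_dividef prod_power_distrib)
    finally show "1 \<le> (real s)\<^sup>2 * (\<Prod>k<d. 1 / (real (\<nu> k) + 1)\<^sup>2)" .
  qed
  also have "\<dots> \<le> (\<Sum>\<nu>\<in>{..<d} \<rightarrow>\<^sub>E {..<s}. (real s)\<^sup>2 * (\<Prod>k<d. 1 / (real (\<nu> k) + 1)\<^sup>2))"
  proof (rule sum_mono2[OF _ hyperbolic_cross_subset])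
    show "finite ({..<d} \<rightarrow>\<^sub>E {..<s})" by (rule finite_PiE) auto
  qed (simp add: prod_nonneg)
  also have "\<dots> = (real s)\<^sup>2 * (\<Sum>j<s. 1 / (real j + 1)\<^sup>2) ^ d"
    unfolding sum_distrib_left[symmetric]
    using prod_sum_PiE[of "{..<d}" "\<lambda>_. {..<s}" "\<lambda>k j. 1 / (real j + 1)\<^sup>2"] by simp
  also have "\<dots> \<le> (real s)\<^sup>2 * 2 ^ d"
    by (intro mult_left_mono power_mono sum_inverse_squares_le_2) (auto intro: sum_nonneg)
  finally show ?thesis .
qed

text \<open>A lower set contains the whole box below each of its elements, and the size of that box
  is the product defining the cross.\<close>

lemma lower_set_subset_hyperbolic_cross:
  assumes L: "lower_set d L" "finite L" "card L \<le> s"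
  shows "L \<subseteq> hyperbolic_cross d s"
proof
  fix \<nu> assume \<nu>: "\<nu> \<in> L"
  have "PiE {..<d} (\<lambda>k. {..\<nu> k}) \<subseteq> L"
  proof
    fix \<mu> assume \<mu>: "\<mu> \<in> PiE {..<d} (\<lambda>k. {..\<nu> k})"
    then have "\<mu> \<in> multi_indices d" "\<forall>k<d. \<mu> k \<le> \<nu> k" by (auto simp: multi_indices_def)
    then show "\<mu> \<in> L" using L(1) \<nu> unfolding lower_set_def by blast
  qed
  then have "card (PiE {..<d} (\<lambda>k. {..\<nu> k})) \<le> card L" by (rule card_mono[OF L(2)])
  then have "(\<Prod>k<d. \<nu> k + 1) \<le> s" using L(3) by (simp add: card_PiE)
  then show "\<nu> \<in> hyperbolic_cross d s"
    using \<nu> L(1) by (auto simp: hyperbolic_cross_def lower_set_def)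
qed

lemma lower_set_Un: "lower_set d A \<Longrightarrow> lower_set d B \<Longrightarrow> lower_set d (A \<union> B)"
  unfolding lower_set_def by blast

text \<open>The first point of the first coordinate axis outside \<open>L\<close> can be added:
  everything below it lies on the axis and belongs to \<open>L\<close> by minimality. Such a point
  exists because the axis is infinite.\<close>

lemma lower_set_extend_one:
  assumes L: "lower_set d L" "finite L" and d: "1 \<le> d"
  obtains \<nu> where "\<nu> \<notin> L" "lower_set d (insert \<nu> L)"
proof -
  define e where "e j = (\<lambda>k\<in>{..<d}. if k = 0 then j else 0 :: nat)" for j
  have e0: "e j 0 = j" for j using d by (simp add: e_def)
  have "inj e" by (rule injI) (metis e0)
  then have "infinite (range e)" by (rule range_inj_infinite)
  then have "\<exists>j. e j \<notin> L" using L(2) by (meson finite_subset image_subsetI)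
  then have j: "e (LEAST j. e j \<notin> L) \<notin> L" by (rule LeastI_ex)
  define j where "j = (LEAST j. e j \<notin> L)"
  have less: "e i \<in> L" if "i < j" for i using not_less_Least[OF that[unfolded j_def]] by simp
  have em: "e i \<in> multi_indices d" for i by (auto simp: e_def multi_indices_def)
  have "lower_set d (insert (e j) L)"
    unfolding lower_set_def
  proof (intro conjI ballI impI)
    show "insert (e j) L \<subseteq> multi_indices d" using em L(1) by (auto simp: lower_set_def)
    fix \<nu> \<mu> assume \<nu>: "\<nu> \<in> insert (e j) L" and \<mu>: "\<mu> \<in> multi_indices d" and le: "\<forall>k<d. \<mu> k \<le> \<nu> k"
    show "\<mu> \<in> insert (e j) L"
    proof (cases "\<nu> \<in> L")
      case True
      then show ?thesis using L(1) \<mu> le unfolding lower_set_def by blast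
    next
      case False
      then have \<nu>e: "\<nu> = e j" using \<nu> by simp
      have "\<mu> k = e (\<mu> 0) k" for k
      proof (cases "k < d \<and> k \<noteq> 0")
        case True
        then show ?thesis using le[rule_format, of k] by (simp add: \<nu>e e_def)
      next
        case False
        then show ?thesis using e0 \<mu> by (cases "k = 0") (auto simp: e_def multi_indices_def PiE_def extensional_def)
      qed
      then have eq: "\<mu> = e (\<mu> 0)" by (rule ext)
      have "\<mu> 0 \<le> j" using le[rule_format, of 0] d \<nu>e e0 by simp
      then have "e (\<mu> 0) \<in> insert (e j) L" using less[of "\<mu> 0"] by (cases "\<mu> 0 = j") auto
      then show ?thesis by (subst eq)
    qed
  qed
  then show thesis using that j by (simp add: j_def)
qed

text \<open>Needed because \<open>sparse_lower\<close> asks for a lower set of exactly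
  \<open>s\<close> elements, whereas a best support may be smaller.\<close>

lemma lower_set_extend:
  assumes "lower_set d L" "finite L" "1 \<le> d" "card L \<le> s"
  shows "\<exists>L'. L \<subseteq> L' \<and> lower_set d L' \<and> finite L' \<and> card L' = s"
  using assms
proof (induction "s - card L" arbitrary: L)
  case 0
  then show ?case by auto
next
  case (Suc n)
  obtain \<nu> where \<nu>: "\<nu> \<notin> L" "lower_set d (insert \<nu> L)"
    using lower_set_extend_one[OF Suc.prems(1,2,3)] .
  have "card (insert \<nu> L) = Suc (card L)" using \<nu> Suc.prems by simp
  then have "\<exists>L'. insert \<nu> L \<subseteq> L' \<and> lower_set d L' \<and> finite L' \<and> card L' = s"
    using Suc.hyps(2) \<nu> Suc.prems by (intro Suc.hyps(1)) auto
  then show ?case by blast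
qed

section \<open>Iterative hard thresholding\<close>

lemma sum_Re_cnj_le:
  fixes a b :: "'j \<Rightarrow> complex"
  shows "(\<Sum>i\<in>S. Re (a i * cnj (b i))) \<le> L2_set (\<lambda>i. cmod (a i)) S * L2_set (\<lambda>i. cmod (b i)) S"
proof -
  have "(\<Sum>i\<in>S. Re (a i * cnj (b i))) \<le> (\<Sum>i\<in>S. \<bar>cmod (a i)\<bar> * \<bar>cmod (b i)\<bar>)"
  proof (rule sum_mono)
    fix i
    have "Re (a i * cnj (b i)) \<le> cmod (a i * cnj (b i))" by (rule complex_Re_le_cmod)
    then show "Re (a i * cnj (b i)) \<le> \<bar>cmod (a i)\<bar> * \<bar>cmod (b i)\<bar>" by (simp add: norm_mult)
  qed
  also have "\<dots> \<le> L2_set (\<lambda>i. cmod (a i)) S * L2_set (\<lambda>i. cmod (b i)) S" by (rule L2_set_mult_ineq)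
  finally show ?thesis .
qed

lemma L2_set_square: "(L2_set f S)\<^sup>2 = (\<Sum>i\<in>S. (f i)\<^sup>2)"
  by (simp add: L2_set_def sum_nonneg)

lemma cmod_real_combination:
  fixes u w :: complex and a b :: real
  shows "(cmod (of_real a * u + of_real b * w))\<^sup>2
    = a\<^sup>2 * (cmod u)\<^sup>2 + b\<^sup>2 * (cmod w)\<^sup>2 + 2 * a * b * Re (u * cnj w)"
  unfolding cmod_power2 by (simp add: algebra_simps power2_eq_square)

lemma sum_cmod_real_combination:
  fixes u w :: "'j \<Rightarrow> complex" and a b :: real
  shows "(\<Sum>i\<in>S. (cmod (of_real a * u i + of_real b * w i))\<^sup>2)
    = a\<^sup>2 * (\<Sum>i\<in>S. (cmod (u i))\<^sup>2) + b\<^sup>2 * (\<Sum>i\<in>S. (cmod (w i))\<^sup>2) + 2 * a * b * (\<Sum>i\<in>S. Re (u i * cnj (w i)))"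
  by (simp only: cmod_real_combination sum.distrib sum_distrib_left)

lemma matrix_apply_combination:
  "matrix_apply A J (\<lambda>\<nu>. a * u \<nu> + b * w \<nu>) i = a * matrix_apply A J u i + b * matrix_apply A J w i"
  by (simp add: matrix_apply_def algebra_simps sum.distrib sum_distrib_left)

definition sq_norm :: "'j set \<Rightarrow> ('j \<Rightarrow> complex) \<Rightarrow> real" where
  "sq_norm S u = (\<Sum>i\<in>S. (cmod (u i))\<^sup>2)"

text \<open>Polarization; real scalars suffice because only real parts of inner products enter.
  Scaling both vectors to a common length turns the quadratic estimate into the product of
  norms.\<close>

lemma restricted_isometry_bilinear:
  fixes u w :: "(nat \<Rightarrow> nat) \<Rightarrow> complex" and \<delta> :: real
  assumes J: "finite J" and \<delta>: "0 \<le> \<delta>"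
    and rip: "\<And>(a::real) (b::real). \<bar>sq_norm {..<m} (matrix_apply A J (\<lambda>\<nu>. a * u \<nu> + b * w \<nu>)) - sq_norm J (\<lambda>\<nu>. a * u \<nu> + b * w \<nu>)\<bar>
                 \<le> \<delta> * sq_norm J (\<lambda>\<nu>. a * u \<nu> + b * w \<nu>)"
  shows "(\<Sum>\<nu>\<in>J. Re (u \<nu> * cnj (w \<nu>))) - (\<Sum>i<m. Re (matrix_apply A J u i * cnj (matrix_apply A J w i)))
      \<le> \<delta> * L2_set (\<lambda>\<nu>. cmod (u \<nu>)) J * L2_set (\<lambda>\<nu>. cmod (w \<nu>)) J"
proof -
  define U where "U = L2_set (\<lambda>\<nu>. cmod (u \<nu>)) J"
  define W where "W = L2_set (\<lambda>\<nu>. cmod (w \<nu>)) J"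
  have U2: "(\<Sum>\<nu>\<in>J. (cmod (u \<nu>))\<^sup>2) = U\<^sup>2" and W2: "(\<Sum>\<nu>\<in>J. (cmod (w \<nu>))\<^sup>2) = W\<^sup>2"
    by (simp_all add: U_def W_def L2_set_square)
  define r where "r = (\<Sum>\<nu>\<in>J. Re (u \<nu> * cnj (w \<nu>)))"
  define t where "t = (\<Sum>i<m. Re (matrix_apply A J u i * cnj (matrix_apply A J w i)))"
  define SU where "SU = (\<Sum>i<m. (cmod (matrix_apply A J u i))\<^sup>2)"
  define SW where "SW = (\<Sum>i<m. (cmod (matrix_apply A J w i))\<^sup>2)"
  have q: "\<bar>(a\<^sup>2 * SU + b\<^sup>2 * SW + 2 * a * b * t) - (a\<^sup>2 * U\<^sup>2 + b\<^sup>2 * W\<^sup>2 + 2 * a * b * r)\<bar>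
      \<le> \<delta> * (a\<^sup>2 * U\<^sup>2 + b\<^sup>2 * W\<^sup>2 + 2 * a * b * r)" for a b
    using rip[of a b]
    unfolding sq_norm_def matrix_apply_combination sum_cmod_real_combination U2 W2
    by (simp add: r_def t_def SU_def SW_def)
  show ?thesis
  proof (cases "U = 0 \<or> W = 0")
    case True
    have z: "v \<nu> = 0" if "L2_set (\<lambda>\<nu>. cmod (v \<nu>)) J = 0" "\<nu> \<in> J" for v \<nu>
      using that J by (simp add: L2_set_eq_0_iff)
    have "(\<forall>\<nu>\<in>J. u \<nu> = 0) \<or> (\<forall>\<nu>\<in>J. w \<nu> = 0)"
      using True z[of u] z[of w] unfolding U_def W_def by blast
    then have "r = 0 \<and> t = 0" by (auto simp: r_def t_def matrix_apply_def)
    then show ?thesis using True unfolding r_def[symmetric] t_def[symmetric] U_def[symmetric] W_def[symmetric] by auto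
  next
    case False
    have U0: "0 < U" and W0: "0 < W" using False by (auto simp: U_def W_def L2_set_nonneg order_less_le)
    \<comment> \<open>The two instances of \<open>q\<close> use the scalars \<open>W, U\<close> and
      \<open>W, - U\<close>. In their sum the squared norms cancel on the left and the inner
      products cancel on the right.\<close>
    have "4 * (W * U) * (r - t) \<le> 4 * (W * U) * (\<delta> * (U * W))"
      using q[of W U, unfolded abs_le_iff, THEN conjunct2] q[of W "-U", unfolded abs_le_iff, THEN conjunct1]
      by (simp add: algebra_simps power2_eq_square)
    then have "r - t \<le> \<delta> * (U * W)" using U0 W0 by simp
    then show ?thesis unfolding r_def t_def U_def W_def by (simp add: mult.assoc)
  qed
qed

lemma adjoint_apply_inner:
  assumes "finite J"
  shows "(\<Sum>\<nu>\<in>J. Re (adjoint_apply A m J v \<nu> * cnj (w \<nu>))) = (\<Sum>i<m. Re (v i * cnj (matrix_apply A J w i)))"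
proof -
  have "(\<Sum>\<nu>\<in>J. adjoint_apply A m J v \<nu> * cnj (w \<nu>)) = (\<Sum>\<nu>\<in>J. \<Sum>i<m. v i * (cnj (A i \<nu>) * cnj (w \<nu>)))"
    by (simp add: adjoint_apply_def sum_distrib_left sum_distrib_right mult_ac)
  also have "\<dots> = (\<Sum>i<m. v i * cnj (matrix_apply A J w i))"
    by (subst sum.swap) (simp add: matrix_apply_def sum_distrib_left)
  finally show ?thesis by (metis (mono_tags, lifting) Re_sum sum.cong)
qed

text \<open>With \<open>z\<close> as in the proof, \<open>opt\<close> says that \<open>z - w\<close>
  is no longer than \<open>z\<close>, so the squared norm of \<open>w\<close> is at most twice the
  real inner product of \<open>z\<close> and \<open>w\<close>. The residual is \<open>e\<close>
  minus the image of \<open>u\<close>; inserting it leaves the isometry defect of the pair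
  \<open>u\<close>, \<open>w\<close>, at most a quarter of the product of their norms, plus a noise
  term. Division by the norm of \<open>w\<close> gives the factor \<open>1 / 2\<close>.\<close>

lemma hard_threshold_step:
  fixes x x' c :: "(nat \<Rightarrow> nat) \<Rightarrow> complex" and e :: "nat \<Rightarrow> complex"
  defines "u \<equiv> (\<lambda>\<nu>. x \<nu> - c \<nu>)" and "w \<equiv> (\<lambda>\<nu>. x' \<nu> - c \<nu>)"
  assumes J: "finite J"
    and rip: "\<And>(a::real) (b::real). \<bar>sq_norm {..<m} (matrix_apply A J (\<lambda>\<nu>. a * u \<nu> + b * w \<nu>)) - sq_norm J (\<lambda>\<nu>. a * u \<nu> + b * w \<nu>)\<bar>
                 \<le> 1 / 4 * sq_norm J (\<lambda>\<nu>. a * u \<nu> + b * w \<nu>)"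
    and res: "\<And>i. i < m \<Longrightarrow> v i = matrix_apply A J c i + e i - matrix_apply A J x i"
    and opt: "L2_set (\<lambda>\<nu>. cmod (x \<nu> + adjoint_apply A m J v \<nu> - x' \<nu>)) J
                \<le> L2_set (\<lambda>\<nu>. cmod (x \<nu> + adjoint_apply A m J v \<nu> - c \<nu>)) J"
  shows "L2_set (\<lambda>\<nu>. cmod (x' \<nu> - c \<nu>)) J
      \<le> 1 / 2 * L2_set (\<lambda>\<nu>. cmod (x \<nu> - c \<nu>)) J + 5 / 2 * L2_set (\<lambda>i. cmod (e i)) {..<m}"
proof -
  let ?T = "matrix_apply A J"
  define z where "z \<nu> = u \<nu> + adjoint_apply A m J v \<nu>" for \<nu>
  define U where "U = L2_set (\<lambda>\<nu>. cmod (u \<nu>)) J"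
  define W where "W = L2_set (\<lambda>\<nu>. cmod (w \<nu>)) J"
  define E where "E = L2_set (\<lambda>i. cmod (e i)) {..<m}"
  have nn: "0 \<le> U" "0 \<le> W" "0 \<le> E" by (simp_all add: U_def W_def E_def L2_set_nonneg)
  have W2: "(\<Sum>\<nu>\<in>J. (cmod (w \<nu>))\<^sup>2) = W\<^sup>2" by (simp add: W_def L2_set_square)
  have "(L2_set (\<lambda>\<nu>. cmod (x \<nu> + adjoint_apply A m J v \<nu> - x' \<nu>)) J)\<^sup>2
      \<le> (L2_set (\<lambda>\<nu>. cmod (x \<nu> + adjoint_apply A m J v \<nu> - c \<nu>)) J)\<^sup>2"
    using opt by (intro power_mono L2_set_nonneg)
  then have "(\<Sum>\<nu>\<in>J. (cmod (of_real 1 * z \<nu> + of_real (-1) * w \<nu>))\<^sup>2) \<le> (\<Sum>\<nu>\<in>J. (cmod (z \<nu>))\<^sup>2)"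
    by (simp add: L2_set_square z_def u_def w_def algebra_simps)
  then have "W\<^sup>2 \<le> 2 * (\<Sum>\<nu>\<in>J. Re (z \<nu> * cnj (w \<nu>)))"
    unfolding sum_cmod_real_combination W2 by simp
  also have "(\<Sum>\<nu>\<in>J. Re (z \<nu> * cnj (w \<nu>)))
      = (\<Sum>\<nu>\<in>J. Re (u \<nu> * cnj (w \<nu>))) + (\<Sum>i<m. Re (v i * cnj (?T w i)))"
    unfolding adjoint_apply_inner[OF J, symmetric] by (simp add: z_def distrib_right sum.distrib)
  also have "(\<Sum>i<m. Re (v i * cnj (?T w i))) = (\<Sum>i<m. Re (e i * cnj (?T w i))) - (\<Sum>i<m. Re (?T u i * cnj (?T w i)))"
  proof -
    have "?T u i = ?T x i - ?T c i" for i
      using matrix_apply_combination[of A J 1 x "-1" c i] by (simp add: u_def)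
    then have "v i = e i - ?T u i" if "i < m" for i using res[OF that] by simp
    then show ?thesis by (simp add: left_diff_distrib sum_subtractf)
  qed
  finally have W_le: "W\<^sup>2 \<le> 2 * (((\<Sum>\<nu>\<in>J. Re (u \<nu> * cnj (w \<nu>))) - (\<Sum>i<m. Re (?T u i * cnj (?T w i)))) + (\<Sum>i<m. Re (e i * cnj (?T w i))))"
    by simp
  have b1: "(\<Sum>\<nu>\<in>J. Re (u \<nu> * cnj (w \<nu>))) - (\<Sum>i<m. Re (?T u i * cnj (?T w i))) \<le> 1 / 4 * U * W"
    unfolding U_def W_def by (rule restricted_isometry_bilinear[OF J _ rip]) simp
  have b2: "(\<Sum>i<m. Re (e i * cnj (?T w i))) \<le> E * (5 / 4 * W)"
  proof -
    have "\<bar>sq_norm {..<m} (?T w) - sq_norm J w\<bar> \<le> 1 / 4 * sq_norm J w" using rip[of 0 1] by simp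
    then have "sq_norm {..<m} (?T w) \<le> 5 / 4 * sq_norm J w" by linarith
    also have "\<dots> = 5 / 4 * W\<^sup>2" by (simp add: sq_norm_def W2)
    \<comment> \<open>Passing from \<open>5 / 4\<close> to its square avoids a root in the
      constant.\<close>
    also have "\<dots> \<le> (5 / 4 * W)\<^sup>2" by (simp add: power_mult_distrib power2_eq_square)
    finally have "(L2_set (\<lambda>i. cmod (?T w i)) {..<m})\<^sup>2 \<le> (5 / 4 * W)\<^sup>2" by (simp add: L2_set_square sq_norm_def)
    then have "L2_set (\<lambda>i. cmod (?T w i)) {..<m} \<le> 5 / 4 * W" by (rule power2_le_imp_le) (use nn in simp)
    then have "E * L2_set (\<lambda>i. cmod (?T w i)) {..<m} \<le> E * (5 / 4 * W)" by (rule mult_left_mono[OF _ nn(3)])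
    then show ?thesis using sum_Re_cnj_le[of e "?T w" "{..<m}"] by (simp add: E_def)
  qed
  have "W\<^sup>2 \<le> 2 * (1 / 4 * U * W + E * (5 / 4 * W))"
    by (rule order_trans[OF W_le mult_left_mono[OF add_mono[OF b1 b2]]]) simp
  then have "W * W \<le> W * (1 / 2 * U + 5 / 2 * E)" by (simp add: power2_eq_square algebra_simps)
  then have "W \<le> 1 / 2 * U + 5 / 2 * E"
    using nn by (cases "W = 0") (auto simp: mult_le_cancel_left)
  then show ?thesis unfolding W_def U_def E_def u_def w_def .
qed

lemma geometric_recursion:
  fixes a :: "nat \<Rightarrow> real"
  assumes "\<And>n. a (Suc n) \<le> 1 / 2 * a n + b / 2" and "0 \<le> b"
  shows "a n \<le> (1 / 2) ^ n * a 0 + b"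
proof (induction n)
  case (Suc n)
  have "a (Suc n) \<le> 1 / 2 * a n + b / 2" by (rule assms)
  also have "\<dots> \<le> 1 / 2 * ((1 / 2) ^ n * a 0 + b) + b / 2"
    by (intro add_right_mono mult_left_mono Suc) simp
  also have "\<dots> = (1 / 2) ^ Suc n * a 0 + b" by (simp add: field_simps)
  finally show ?case .
qed (use assms in simp)

section \<open>Restricted isometry on lower sets\<close>

definition cube :: "nat \<Rightarrow> (nat \<Rightarrow> real) set" where
  "cube d = {y. \<forall>k<d. y k \<in> {-1..1}}"

text \<open>An explicit bound for the basis function on the cube; it normalizes the vertices of the
  hull in place of the essential supremum \<open>weight\<close>.\<close>

definition sup_weight :: "poly_family \<Rightarrow> nat \<Rightarrow> (nat \<Rightarrow> nat) \<Rightarrow> real" where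
  "sup_weight fam d \<nu> = sqrt (\<Prod>k<d. sup_sq fam (\<nu> k))"

lemma prod_sup_sq_ge_1: "1 \<le> (\<Prod>k<d. sup_sq fam (\<nu> k))"
  by (intro prod_ge_1 sup_sq_ge_1)

lemma sup_weight_ge_1: "1 \<le> sup_weight fam d \<nu>"
  unfolding sup_weight_def using prod_sup_sq_ge_1 by simp

lemma sup_weight_square: "(sup_weight fam d \<nu>)\<^sup>2 = (\<Prod>k<d. sup_sq fam (\<nu> k))"
  unfolding sup_weight_def using prod_sup_sq_ge_1[where d=d and fam=fam and \<nu>=\<nu>] by simp

lemma prob_space_orth_measure: "prob_space (orth_measure fam d)"
  unfolding orth_measure_def by (intro prob_space_PiM prob_space_base_measure)

lemma AE_orth_measure: "AE y in orth_measure fam d. y \<in> cube d"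
proof -
  have "AE y in orth_measure fam d. y k \<in> {-1..1}" if "k < d" for k
    unfolding orth_measure_def using that
    by (intro AE_PiM_component[where P="\<lambda>t. t \<in> {-1..1}"] prob_space_base_measure AE_base_measure) auto
  then have "AE y in orth_measure fam d. \<forall>k\<in>{..<d}. y k \<in> {-1..1}"
    by (intro AE_finite_allI) auto
  then show ?thesis by (rule eventually_mono) (auto simp: cube_def)
qed

lemma pred_cube [measurable]: "Measurable.pred (orth_measure fam d) (\<lambda>y. y \<in> cube d)"
proof -
  have "Measurable.pred (orth_measure fam d) (\<lambda>y. \<forall>k\<in>{..<d}. y k \<in> {-1..1})"
    unfolding orth_measure_def by measurable
  moreover have "(\<lambda>y. y \<in> cube d) = (\<lambda>y. \<forall>k\<in>{..<d}. y k \<in> {-1..1})"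
    by (rule ext) (auto simp only: cube_def mem_Collect_eq lessThan_iff)
  ultimately show ?thesis by (simp only:)
qed

lemma borel_measurable_Psi [measurable]: "Psi P d \<nu> \<in> borel_measurable (orth_measure fam d)"
proof -
  have "(\<lambda>y. y k) \<in> borel_measurable (orth_measure fam d)" if "k < d" for k
    using measurable_component_singleton[of k "{..<d}" "\<lambda>_. base_measure fam"] that
    by (simp add: orth_measure_def measurable_cong_sets[OF refl sets_base_measure])
  then have "(\<lambda>y. \<Prod>k<d. poly (P (\<nu> k)) (y k)) \<in> borel_measurable (orth_measure fam d)"
    by (intro borel_measurable_prod poly_borel_measurable) auto
  then show ?thesis by (simp add: Psi_def[abs_def])
qed

context orthonormal_family
begin

lemma Psi_square_le:
  assumes "y \<in> cube d"
  shows "(Psi P d \<nu> y)\<^sup>2 \<le> (\<Prod>k<d. sup_sq fam (\<nu> k))"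
  unfolding Psi_def prod_power_distrib
  using assms by (intro prod_mono conjI P_bound zero_le_power2) (simp add: cube_def)

lemma Psi_le:
  assumes "y \<in> cube d"
  shows "\<bar>Psi P d \<nu> y\<bar> \<le> sup_weight fam d \<nu>"
  unfolding sup_weight_def using Psi_square_le[OF assms] by (intro real_le_rsqrt) simp

lemma integral_Psi_mult:
  shows integrable_Psi_mult: "integrable (orth_measure fam d) (\<lambda>y. Psi P d \<nu> y * Psi P d \<mu> y)"
    and "\<nu> \<in> multi_indices d \<Longrightarrow> \<mu> \<in> multi_indices d \<Longrightarrow>
      (\<integral>y. Psi P d \<nu> y * Psi P d \<mu> y \<partial>orth_measure fam d) = (if \<nu> = \<mu> then 1 else 0)"
proof -
  interpret B: prob_space "base_measure fam" by (rule prob_space_base_measure)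
  interpret product_prob_space "\<lambda>_. base_measure fam" "{..<d}" by unfold_locales
  have eq: "Psi P d \<nu> y * Psi P d \<mu> y = (\<Prod>k<d. poly (P (\<nu> k)) (y k) * poly (P (\<mu> k)) (y k))" for y
    by (simp add: Psi_def prod.distrib)
  have i: "integrable (base_measure fam) (\<lambda>t. poly (P n) t * poly (P k) t)" for n k
    using orth unfolding orthonormal_polys_def by blast
  show "integrable (orth_measure fam d) (\<lambda>y. Psi P d \<nu> y * Psi P d \<mu> y)"
    unfolding eq orth_measure_def by (rule product_integrable_prod) (auto intro: i)
  assume m: "\<nu> \<in> multi_indices d" "\<mu> \<in> multi_indices d"
  have "(\<integral>y. Psi P d \<nu> y * Psi P d \<mu> y \<partial>orth_measure fam d)
      = (\<Prod>k<d. \<integral>t. poly (P (\<nu> k)) t * poly (P (\<mu> k)) t \<partial>base_measure fam)"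
    unfolding eq orth_measure_def by (rule product_integral_prod) (auto intro: i)
  also have "\<dots> = (\<Prod>k<d. if \<nu> k = \<mu> k then 1 else 0)"
    using orth unfolding orthonormal_polys_def by (intro prod.cong) blast+
  also have "\<dots> = (if \<nu> = \<mu> then 1 else 0)"
  proof (cases "\<nu> = \<mu>")
    case False
    then obtain k where k: "\<nu> k \<noteq> \<mu> k" by auto
    then have "k < d" using m by (auto simp: multi_indices_def PiE_def extensional_def) (metis not_less)
    then show ?thesis using False k by (auto intro!: prod_zero)
  qed simp
  finally show "(\<integral>y. Psi P d \<nu> y * Psi P d \<mu> y \<partial>orth_measure fam d) = (if \<nu> = \<mu> then 1 else 0)" .
qed

lemma integral_Psi_sum_square:
  fixes z :: "(nat \<Rightarrow> nat) \<Rightarrow> real"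
  assumes I: "finite I" "I \<subseteq> multi_indices d"
  shows "integrable (orth_measure fam d) (\<lambda>y. (\<Sum>\<nu>\<in>I. z \<nu> * Psi P d \<nu> y)\<^sup>2)"
    and "(\<integral>y. (\<Sum>\<nu>\<in>I. z \<nu> * Psi P d \<nu> y)\<^sup>2 \<partial>orth_measure fam d) = (\<Sum>\<nu>\<in>I. (z \<nu>)\<^sup>2)"
proof -
  have eq: "(\<Sum>\<nu>\<in>I. z \<nu> * Psi P d \<nu> y)\<^sup>2 = (\<Sum>\<nu>\<in>I. \<Sum>\<mu>\<in>I. z \<nu> * z \<mu> * (Psi P d \<nu> y * Psi P d \<mu> y))" for y
    by (simp add: power2_eq_square sum_product mult_ac)
  show "integrable (orth_measure fam d) (\<lambda>y. (\<Sum>\<nu>\<in>I. z \<nu> * Psi P d \<nu> y)\<^sup>2)"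
    unfolding eq by (intro Bochner_Integration.integrable_sum integrable_mult_right integrable_Psi_mult)
  have "(\<integral>y. (\<Sum>\<nu>\<in>I. z \<nu> * Psi P d \<nu> y)\<^sup>2 \<partial>orth_measure fam d)
      = (\<Sum>\<nu>\<in>I. \<Sum>\<mu>\<in>I. z \<nu> * z \<mu> * (\<integral>y. Psi P d \<nu> y * Psi P d \<mu> y \<partial>orth_measure fam d))"
    unfolding eq by (simp add: integrable_Psi_mult)
  also have "\<dots> = (\<Sum>\<nu>\<in>I. \<Sum>\<mu>\<in>I. if \<nu> = \<mu> then z \<nu> * z \<mu> else 0)"
    using I(2) by (intro sum.cong refl) (auto simp: integral_Psi_mult(2) subset_iff)
  also have "\<dots> = (\<Sum>\<nu>\<in>I. (z \<nu>)\<^sup>2)"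
    using I(1) by (simp add: power2_eq_square)
  finally show "(\<integral>y. (\<Sum>\<nu>\<in>I. z \<nu> * Psi P d \<nu> y)\<^sup>2 \<partial>orth_measure fam d) = (\<Sum>\<nu>\<in>I. (z \<nu>)\<^sup>2)" .
qed

lemma cmod_expansion_square:
  "(cmod (expansion_on P d c I y))\<^sup>2 = (\<Sum>\<nu>\<in>I. Re (c \<nu>) * Psi P d \<nu> y)\<^sup>2 + (\<Sum>\<nu>\<in>I. Im (c \<nu>) * Psi P d \<nu> y)\<^sup>2"
  by (simp add: cmod_power2 expansion_on_def)

lemma L2_norm_expansion:
  assumes I: "finite I" "I \<subseteq> multi_indices d"
  shows "integrable (orth_measure fam d) (\<lambda>y. (cmod (expansion_on P d c I y))\<^sup>2)"
    and "L2_norm (orth_measure fam d) (expansion_on P d c I) = L2_set (\<lambda>\<nu>. cmod (c \<nu>)) I"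
proof -
  show "integrable (orth_measure fam d) (\<lambda>y. (cmod (expansion_on P d c I y))\<^sup>2)"
    unfolding cmod_expansion_square by (intro Bochner_Integration.integrable_add integral_Psi_sum_square(1) I)
  show "L2_norm (orth_measure fam d) (expansion_on P d c I) = L2_set (\<lambda>\<nu>. cmod (c \<nu>)) I"
    unfolding L2_norm_def cmod_expansion_square L2_set_def
    by (subst Bochner_Integration.integral_add)
       (simp_all add: integral_Psi_sum_square[OF I] cmod_power2 sum.distrib)
qed

text \<open>A unit vector supported on \<open>\<Lambda>\<close> has weighted \<open>\<ell>\<^sub>1\<close>-norm at most \<open>R\<close>, so it
  lies in \<open>R\<close> times the convex hull of the normalized functions \<open>\<Psi>\<^sub>\<nu> / w\<^sub>\<nu>\<close> and
  their negatives.  The mass left over is split evenly between the signs.\<close>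

lemma lower_restricted_isometry_real:
  fixes s m L :: nat and \<gamma> R :: real
  assumes d: "1 \<le> d" and s: "1 \<le> s" and R: "R = sqrt (real (3 * s) powr (1 + beta' fam))"
    and L1: "R \<le> 2 ^ L / 6" and L2: "2 ^ L / 6 \<le> 2 * R"
    and \<gamma>: "0 < \<gamma>" "\<gamma> < 1"
    and m: "real m \<ge> 3072 * real L * R\<^sup>2 * ((2 ^ 24 * ln (1536 * R\<^sup>2) + 1)
              * ln (2 * real (card (hyperbolic_cross d s))) + ln (4 * real L / \<gamma>))"
  shows "\<exists>E \<in> sets (sample_measure fam d m). measure (sample_measure fam d m) E \<ge> 1 - \<gamma> / 2 \<and>
           (\<forall>y\<in>E. \<forall>\<Lambda> (z :: (nat \<Rightarrow> nat) \<Rightarrow> real).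
              lower_set d \<Lambda> \<and> \<Lambda> \<subseteq> hyperbolic_cross d s \<and> card \<Lambda> \<le> 3 * s \<longrightarrow>
              \<bar>(\<Sum>i<m. (\<Sum>\<nu>\<in>\<Lambda>. z \<nu> * Psi P d \<nu> (y i))\<^sup>2) / real m - (\<Sum>\<nu>\<in>\<Lambda>. (z \<nu>)\<^sup>2)\<bar>
                \<le> 1 / 4 * (\<Sum>\<nu>\<in>\<Lambda>. (z \<nu>)\<^sup>2))"
proof -
  let ?M = "orth_measure fam d"
  let ?H = "hyperbolic_cross d s"
  interpret M: prob_space ?M by (rule prob_space_orth_measure)
  interpret PM: product_prob_space "\<lambda>_. ?M" "{..<m}" by unfold_locales
  have alpha: "0 \<le> beta' fam" by (cases fam) auto
  have "1 \<le> real (3 * s) powr (1 + beta' fam)" using s alpha by (intro ge_one_powr_ge_zero) auto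
  then have R1: "1 \<le> R" by (simp add: R)
  define W where "W = sup_weight fam d"
  have W0: "0 < W \<nu>" for \<nu>
    using sup_weight_ge_1[of fam d \<nu>] by (simp add: W_def)
  define sg :: "bool \<Rightarrow> real" where "sg b = (if b then 1 else -1)" for b
  \<comment> \<open>The value 0 off the cube makes \<open>bd\<close> hold at every point, as
    \<open>uniform_quadratic_deviation\<close> requires; the event \<open>C\<close> below, of full
    measure, ensures agreement with \<open>Psi\<close> at the sample points.\<close>
  define \<phi> where "\<phi> \<nu> y = (if y \<in> cube d then Psi P d \<nu> y / W \<nu> else 0)" for \<nu> y
  define psi where "psi a y = sg (snd a) * \<phi> (fst a) y" for a :: "(nat \<Rightarrow> nat) \<times> bool" and y
  define I where "I = ?H \<times> (UNIV :: bool set)"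
  have fin: "finite I" by (simp add: I_def)
  have zero: "(\<lambda>k\<in>{..<d}. 0) \<in> ?H" using s by (auto simp: hyperbolic_cross_def multi_indices_def)
  then have ne: "I \<noteq> {}" and Hne: "?H \<noteq> {}" by (auto simp: I_def)
  define N where "N = real (card ?H)"
  have N0: "0 < N" using Hne by (simp add: N_def card_gt_0_iff)
  have cardI: "real (card I) = 2 * N" by (simp add: I_def N_def card_cartesian_product)
  have meas: "psi a \<in> borel_measurable ?M" for a
    unfolding psi_def \<phi>_def by measurable
  have bd: "\<bar>psi a y\<bar> \<le> 1" for a y
    using Psi_le[of y d "fst a"] W0[of "fst a"] by (auto simp: psi_def \<phi>_def sg_def W_def abs_mult)
  have mI: "real m \<ge> 3072 * real L * R\<^sup>2 *
      ((2 ^ 24 * ln (1536 * R\<^sup>2) + 1) * ln (real (card I)) + ln (4 * real L / \<gamma>))"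
    using m unfolding cardI N_def .
  from M.uniform_quadratic_deviation[where psi = psi, OF fin ne meas bd R1 L1 L2 \<gamma> mI]
  obtain E where E: "E \<in> sets (\<Pi>\<^sub>M i\<in>{..<m}. ?M)" and PE: "measure (\<Pi>\<^sub>M i\<in>{..<m}. ?M) E \<ge> 1 - \<gamma> / 2"
    and dev: "\<forall>w\<in>E. \<forall>p. (\<forall>a\<in>I. 0 \<le> p a) \<and> sum p I = 1 \<and>
        M.expectation (\<lambda>x. (R * (\<Sum>a\<in>I. p a * psi a x))\<^sup>2) \<le> 1 \<longrightarrow>
        \<bar>(\<Sum>k<m. (R * (\<Sum>a\<in>I. p a * psi a (w k)))\<^sup>2) / real m - M.expectation (\<lambda>x. (R * (\<Sum>a\<in>I. p a * psi a x))\<^sup>2)\<bar> \<le> 1 / 4"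
    by (elim bexE conjE) (rule that)
  define C where "C = {w \<in> space (\<Pi>\<^sub>M i\<in>{..<m}. ?M). \<forall>i\<in>{..<m}. w i \<in> cube d}"
  have C: "C \<in> sets (\<Pi>\<^sub>M i\<in>{..<m}. ?M)" unfolding C_def by measurable
  have "AE w in (\<Pi>\<^sub>M i\<in>{..<m}. ?M). \<forall>i\<in>{..<m}. w i \<in> cube d"
    by (intro AE_finite_allI AE_PiM_component[where P="\<lambda>y. y \<in> cube d"] AE_orth_measure prob_space_orth_measure) auto
  then have AEC: "AE w in (\<Pi>\<^sub>M i\<in>{..<m}. ?M). w \<in> E \<longleftrightarrow> w \<in> E \<inter> C"
    using AE_space by eventually_elim (auto simp: C_def)
  have PEC: "measure (\<Pi>\<^sub>M i\<in>{..<m}. ?M) (E \<inter> C) = measure (\<Pi>\<^sub>M i\<in>{..<m}. ?M) E"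
    by (rule measure_eq_AE) (use AEC E C in auto)
  have unit: "\<bar>(\<Sum>i<m. (\<Sum>\<nu>\<in>\<Lambda>. z \<nu> * Psi P d \<nu> (w i))\<^sup>2) / real m - 1\<bar> \<le> 1 / 4"
    if w: "w \<in> E \<inter> C" and low: "lower_set d \<Lambda>" and sub: "\<Lambda> \<subseteq> ?H" and card: "card \<Lambda> \<le> 3 * s"
      and z1: "(\<Sum>\<nu>\<in>\<Lambda>. (z \<nu>)\<^sup>2) = 1" for w \<Lambda> and z :: "(nat \<Rightarrow> nat) \<Rightarrow> real"
  proof -
    have finL: "finite \<Lambda>" using sub finite_hyperbolic_cross by (rule finite_subset)
    define b where "b \<nu> = (if \<nu> \<in> \<Lambda> then z \<nu> * W \<nu> else 0)" for \<nu>
    define r where "r = (R - (\<Sum>\<nu>\<in>?H. \<bar>b \<nu>\<bar>)) / N"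
    define p where "p a = (\<bar>b (fst a)\<bar> + r + sg (snd a) * b (fst a)) / (2 * R)" for a
    \<comment> \<open>Cauchy-Schwarz together with \<open>lower_set_sum_sup_sq\<close>; this is
      where the lower structure of the support and the bound on its cardinality enter.\<close>
    have "(\<Sum>\<nu>\<in>?H. \<bar>b \<nu>\<bar>) = (\<Sum>\<nu>\<in>\<Lambda>. \<bar>z \<nu>\<bar> * \<bar>W \<nu>\<bar>)"
      using sub by (intro sum.mono_neutral_cong_right) (auto simp: b_def abs_mult)
    also have "\<dots> \<le> L2_set z \<Lambda> * L2_set W \<Lambda>" by (rule L2_set_mult_ineq)
    also have "\<dots> = sqrt (\<Sum>\<nu>\<in>\<Lambda>. \<Prod>k<d. sup_sq fam (\<nu> k))"
      by (simp add: L2_set_def z1 W_def sup_weight_square)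
    also have "\<dots> \<le> sqrt (real (card \<Lambda>) powr (1 + beta' fam))"
      by (intro real_sqrt_le_mono lower_set_sum_sup_sq low finL)
    also have "\<dots> \<le> R" unfolding R using card alpha by (intro real_sqrt_le_mono powr_mono2) auto
    finally have r0: "0 \<le> r" using N0 by (simp add: r_def)
    have p0: "\<forall>a\<in>I. 0 \<le> p a" using r0 R1 by (auto simp: p_def sg_def)
    have sumI: "(\<Sum>a\<in>I. f a) = (\<Sum>\<nu>\<in>?H. f (\<nu>, True) + f (\<nu>, False))" for f :: "_ \<Rightarrow> real"
      unfolding I_def
      using sum.cartesian_product[of "\<lambda>\<nu> b. f (\<nu>, b)" "UNIV :: bool set" ?H] by (simp add: UNIV_bool add.commute)
    have p1: "sum p I = 1"
    proof -
      have "sum p I = (\<Sum>\<nu>\<in>?H. (\<bar>b \<nu>\<bar> + r) / R)" unfolding sumI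
      proof (intro sum.cong refl)
        fix \<nu>
        show "p (\<nu>, True) + p (\<nu>, False) = (\<bar>b \<nu>\<bar> + r) / R"
          using R1 by (simp add: p_def sg_def field_simps)
      qed
      also have "\<dots> = ((\<Sum>\<nu>\<in>?H. \<bar>b \<nu>\<bar>) + N * r) / R" unfolding sum_divide_distrib[symmetric] by (simp add: sum.distrib N_def)
      also have "N * r = R - (\<Sum>\<nu>\<in>?H. \<bar>b \<nu>\<bar>)" using N0 by (simp add: r_def)
      also have "((\<Sum>\<nu>\<in>?H. \<bar>b \<nu>\<bar>) + (R - (\<Sum>\<nu>\<in>?H. \<bar>b \<nu>\<bar>))) / R = 1" using R1 by simp
      finally show ?thesis .
    qed
    have F: "R * (\<Sum>a\<in>I. p a * psi a y) = (\<Sum>\<nu>\<in>\<Lambda>. z \<nu> * Psi P d \<nu> y)" if y: "y \<in> cube d" for y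
    proof -
      have "R * (\<Sum>a\<in>I. p a * psi a y) = (\<Sum>\<nu>\<in>?H. b \<nu> * \<phi> \<nu> y)"
        unfolding sumI sum_distrib_left
      proof (intro sum.cong refl)
        fix \<nu>
        have alg: "R * ((x + u) / (2 * R) * v + (x - u) / (2 * R) * (- v)) = u * v" for x u v :: real
          using R1 by (simp add: field_simps)
        show "R * (p (\<nu>, True) * psi (\<nu>, True) y + p (\<nu>, False) * psi (\<nu>, False) y) = b \<nu> * \<phi> \<nu> y"
          using alg[of "\<bar>b \<nu>\<bar> + r" "b \<nu>" "\<phi> \<nu> y"] by (simp add: p_def psi_def sg_def)
      qed
      also have "\<dots> = (\<Sum>\<nu>\<in>\<Lambda>. z \<nu> * Psi P d \<nu> y)"
        using sub W0 y by (intro sum.mono_neutral_cong_right) (auto simp: b_def \<phi>_def less_imp_neq[symmetric])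
      finally show ?thesis .
    qed
    have Lm: "\<Lambda> \<subseteq> multi_indices d" using low by (simp add: lower_set_def)
    have "M.expectation (\<lambda>y. (R * (\<Sum>a\<in>I. p a * psi a y))\<^sup>2) = M.expectation (\<lambda>y. (\<Sum>\<nu>\<in>\<Lambda>. z \<nu> * Psi P d \<nu> y)\<^sup>2)"
    proof (rule integral_cong_AE)
      show "AE y in ?M. (R * (\<Sum>a\<in>I. p a * psi a y))\<^sup>2 = (\<Sum>\<nu>\<in>\<Lambda>. z \<nu> * Psi P d \<nu> y)\<^sup>2"
        using AE_orth_measure by eventually_elim (simp add: F)
    qed (use meas in measurable)
    also have "\<dots> = 1" using integral_Psi_sum_square(2)[OF finL Lm, of z] z1 by simp
    finally have A1: "M.expectation (\<lambda>y. (R * (\<Sum>a\<in>I. p a * psi a y))\<^sup>2) = 1" .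
    have "w k \<in> cube d" if "k < m" for k using w that by (auto simp: C_def)
    then have "(\<Sum>k<m. (R * (\<Sum>a\<in>I. p a * psi a (w k)))\<^sup>2) = (\<Sum>i<m. (\<Sum>\<nu>\<in>\<Lambda>. z \<nu> * Psi P d \<nu> (w i))\<^sup>2)"
      by (intro sum.cong refl) (simp add: F)
    moreover have "\<bar>(\<Sum>k<m. (R * (\<Sum>a\<in>I. p a * psi a (w k)))\<^sup>2) / real m - 1\<bar> \<le> 1 / 4"
    proof -
      have "w \<in> E" using w by simp
      from dev[rule_format, OF this, of p] show ?thesis unfolding A1 using p0 p1 by simp
    qed
    ultimately show ?thesis by simp
  qed
  have general: "\<bar>(\<Sum>i<m. (\<Sum>\<nu>\<in>\<Lambda>. z \<nu> * Psi P d \<nu> (w i))\<^sup>2) / real m - (\<Sum>\<nu>\<in>\<Lambda>. (z \<nu>)\<^sup>2)\<bar> \<le> 1 / 4 * (\<Sum>\<nu>\<in>\<Lambda>. (z \<nu>)\<^sup>2)"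
    if w: "w \<in> E \<inter> C" and low: "lower_set d \<Lambda>" and sub: "\<Lambda> \<subseteq> ?H" and card: "card \<Lambda> \<le> 3 * s"
    for w \<Lambda> and z :: "(nat \<Rightarrow> nat) \<Rightarrow> real"
  proof (cases "(\<Sum>\<nu>\<in>\<Lambda>. (z \<nu>)\<^sup>2) = 0")
    case True
    have finL: "finite \<Lambda>" using sub finite_hyperbolic_cross by (rule finite_subset)
    then have "\<forall>\<nu>\<in>\<Lambda>. z \<nu> = 0" using True by (simp add: sum_nonneg_eq_0_iff)
    then show ?thesis by simp
  next
    case False
    define S where "S = (\<Sum>\<nu>\<in>\<Lambda>. (z \<nu>)\<^sup>2)"
    have S0: "0 < S" using False by (auto simp: S_def order_less_le sum_nonneg)
    have "(\<Sum>\<nu>\<in>\<Lambda>. (z \<nu> / sqrt S)\<^sup>2) = 1"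
      using S0 by (simp add: power_divide sum_divide_distrib[symmetric] S_def[symmetric])
    from unit[OF w low sub card this]
    have "\<bar>(\<Sum>i<m. (\<Sum>\<nu>\<in>\<Lambda>. z \<nu> / sqrt S * Psi P d \<nu> (w i))\<^sup>2) / real m - 1\<bar> \<le> 1 / 4" .
    moreover have "(\<Sum>i<m. (\<Sum>\<nu>\<in>\<Lambda>. z \<nu> / sqrt S * Psi P d \<nu> (w i))\<^sup>2)
        = (\<Sum>i<m. (\<Sum>\<nu>\<in>\<Lambda>. z \<nu> * Psi P d \<nu> (w i))\<^sup>2) / S"
      using S0 by (simp add: sum_divide_distrib[symmetric] power_divide)
    ultimately have "\<bar>(\<Sum>i<m. (\<Sum>\<nu>\<in>\<Lambda>. z \<nu> * Psi P d \<nu> (w i))\<^sup>2) / real m / S - 1\<bar> \<le> 1 / 4"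
      by (simp add: mult.commute)
    then have le: "S * \<bar>(\<Sum>i<m. (\<Sum>\<nu>\<in>\<Lambda>. z \<nu> * Psi P d \<nu> (w i))\<^sup>2) / real m / S - 1\<bar> \<le> S * (1 / 4)"
      using S0 by (intro mult_left_mono) auto
    have eq: "S * \<bar>x / S - 1\<bar> = \<bar>x - S\<bar>" for x
    proof -
      have "S * \<bar>x / S - 1\<bar> = \<bar>S * (x / S - 1)\<bar>" using S0 by (simp add: abs_mult)
      also have "S * (x / S - 1) = x - S" using S0 by (simp add: field_simps)
      finally show ?thesis .
    qed
    show ?thesis using le unfolding S_def[symmetric] eq by (simp only: mult.commute)
  qed
  show ?thesis
    unfolding sample_measure_def
  proof (intro bexI[of _ "E \<inter> C"] conjI ballI allI impI)
    show "1 - \<gamma> / 2 \<le> measure (\<Pi>\<^sub>M i\<in>{..<m}. ?M) (E \<inter> C)" using PE PEC by simp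
    show "E \<inter> C \<in> sets (\<Pi>\<^sub>M i\<in>{..<m}. ?M)" using E C by (rule sets.Int)
  qed (elim conjE, rule general)
qed

end

section \<open>Sample size\<close>

lemma ln2_ge_half: "1 / 2 \<le> ln (2::real)"
proof -
  have "exp (1 / 2) \<le> 1 + 1 / 2 + (1 / 2 :: real)\<^sup>2"
    by (rule exp_bound) auto
  then have "exp (1 / 2) \<le> (2::real)" by (simp add: power2_eq_square)
  then show ?thesis by (subst ln_ge_iff) auto
qed

text \<open>The top level \<open>2 ^ L / 6\<close> must dominate the sup bound \<open>R\<close>, so
  that no part of the square is cut off, and may exceed it only by a constant factor, since
  \<open>eta\<close> is inversely proportional to its square.\<close>

lemma dyadic_scale:
  fixes R :: real
  assumes "1 \<le> R"
  obtains L :: nat where "R \<le> 2 ^ L / 6" "2 ^ L / 6 \<le> 2 * R" "1 \<le> L"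
proof -
  obtain n :: nat where n: "6 * R < 2 ^ n" using real_arch_pow[of 2 "6 * R"] by auto
  define L where "L = (LEAST n. 6 * R \<le> 2 ^ n)"
  have L: "6 * R \<le> 2 ^ L" unfolding L_def by (rule LeastI[of _ n]) (use n in simp)
  have "L \<noteq> 0" using L assms by (intro notI) simp
  then obtain k where k: "L = Suc k" by (cases L) auto
  have "\<not> 6 * R \<le> 2 ^ k" using not_less_Least[of k "\<lambda>n. 6 * R \<le> 2 ^ n"] k by (simp add: L_def[symmetric])
  then have "2 ^ L / 6 \<le> 2 * R" using k by simp
  then show thesis using that[of L] L k by simp
qed

text \<open>With \<open>l = ln s\<close>, the factors \<open>L\<close>,
  \<open>ln (1536 * R\<^sup>2)\<close> and \<open>ln (2 * N)\<close> are bounded by multiples of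
  \<open>l\<close>, \<open>l\<close> and \<open>l + d\<close>. The second claim serves the Chernoff
  bound for the sampled residual and keeps its failure probability below
  \<open>\<gamma> / 2\<close>.\<close>

lemma sample_size_bounds:
  fixes s d m L :: nat and \<gamma> R N :: real
  assumes s: "2 \<le> s" and d: "1 \<le> d" and \<gamma>: "0 < \<gamma>" "\<gamma> < 1"
    and m: "real m \<ge> 2 ^ 50 * real s powr (1 + beta' fam) *
        max ((ln (real s))\<^sup>2 * (ln (real s) + real d)) (ln (real s) * ln (ln (real s) / \<gamma>))"
    and R: "R = sqrt (real (3 * s) powr (1 + beta' fam))"
    and L: "2 ^ L / 6 \<le> 2 * R" "1 \<le> L"
    and N: "1 \<le> N" "N \<le> (real s)\<^sup>2 * 2 ^ d"
  shows "real m \<ge> 3072 * real L * R\<^sup>2 *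
           ((2 ^ 24 * ln (1536 * R\<^sup>2) + 1) * ln (2 * N) + ln (4 * real L / \<gamma>))" (is ?A)
    and "2 / \<gamma> < exp (2 * real m / real s powr (1 + beta' fam))" (is ?B)
proof -
  define l where "l = ln (real s)"
  define D where "D = l + real d"
  define a where "a = 1 + beta' fam"
  define S where "S = real s powr a"
  define M where "M = max (l\<^sup>2 * D) (l * ln (l / \<gamma>))"
  have ln2: "1 / 2 \<le> ln (2::real)" "ln (2::real) \<le> 1"
    using ln2_ge_half ln_le_minus_one[of "2::real"] by auto
  have l2: "ln 2 \<le> l" unfolding l_def using s by (subst ln_le_cancel_iff) auto
  have lh: "1 / 2 \<le> l" using ln2 l2 by linarith
  have l0: "0 < l" using lh by linarith
  have D1: "1 \<le> D" using d l0 by (simp add: D_def)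
  have a: "1 \<le> a" "a \<le> 2"
  proof -
    have "ln (3::real) \<le> ln (2 ^ 2)" by (subst ln_le_cancel_iff) auto
    also have "\<dots> = 2 * ln 2" by (subst ln_realpow) auto
    finally have "ln 3 / ln 2 \<le> (2::real)" by (simp add: field_simps)
    moreover have "1 \<le> ln 3 / ln (2::real)" by simp
    ultimately show "1 \<le> a" "a \<le> 2" by (cases fam; simp add: a_def)+
  qed
  have S0: "0 < S" using s by (simp add: S_def)
  have A_pos: "1 / 4 \<le> l\<^sup>2 * D"
  proof -
    have "(1 / 2)\<^sup>2 * 1 \<le> l\<^sup>2 * D" using lh D1 by (intro mult_mono power_mono) auto
    then show ?thesis by (simp add: power2_eq_square)
  qed
  have M: "l\<^sup>2 * D \<le> M" "l * ln (l / \<gamma>) \<le> M" "1 / 4 \<le> M" using A_pos by (auto simp: M_def)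
  have mM: "real m \<ge> 2 ^ 50 * (S * M)" using m by (simp add: l_def D_def S_def M_def a_def mult.assoc)
  \<comment> \<open>Since \<open>l\<close> is at least \<open>ln 2\<close>, logarithms of numerical
    constants are absorbed into multiples of \<open>l\<close>.\<close>
  have ln_pow2: "ln x \<le> real k * l" if "x \<le> 2 ^ k" "0 < x" for x :: real and k :: nat
  proof -
    have "ln x \<le> ln (2 ^ k)" using that by (subst ln_le_cancel_iff) auto
    also have "\<dots> \<le> real k * l" using l2 by (simp add: ln_realpow mult_left_mono)
    finally show ?thesis .
  qed
  have R2: "R\<^sup>2 = real (3 * s) powr a" by (simp add: R a_def)
  have R2le: "R\<^sup>2 \<le> 9 * S"
  proof -
    have "R\<^sup>2 = 3 powr a * S" unfolding R2 S_def by (simp add: powr_mult)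
    also have "\<dots> \<le> 3 powr 2 * S" using a S0 by (intro mult_right_mono powr_mono) auto
    finally show ?thesis by simp
  qed
  have Rpos: "1 \<le> R\<^sup>2" unfolding R2 using s a by (intro ge_one_powr_ge_zero) auto
  have R0: "0 < R" using s by (simp add: R)
  have lnR2: "ln (R\<^sup>2) \<le> 6 * l"
  proof -
    have "ln (R\<^sup>2) = a * (ln 3 + l)" unfolding R2 using s by (simp add: ln_powr ln_mult l_def)
    also have "\<dots> \<le> 2 * (2 * l + l)" using a ln_pow2[of 3 2] l0 by (intro mult_mono) auto
    finally show ?thesis by simp
  qed
  have lnR: "ln (1536 * R\<^sup>2) \<le> 17 * l"
    using ln_pow2[of 1536 11] lnR2 Rpos R0 by (simp add: ln_mult)
  have lnR0: "0 \<le> ln (1536 * R\<^sup>2)" using Rpos by (intro ln_ge_zero) simp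
  have Lle: "real L \<le> 14 * l"
  proof -
    have "ln (2 ^ L) \<le> ln (12 * R)" using L(1) R0 by (subst ln_le_cancel_iff) auto
    also have "\<dots> = ln 12 + ln (R\<^sup>2) / 2" using R0 by (simp add: ln_mult ln_realpow)
    also have "\<dots> \<le> 4 * l + 6 * l / 2" using ln_pow2[of 12 4] lnR2 by (intro add_mono divide_right_mono) auto
    finally have "real L * ln 2 \<le> 7 * l" by (simp add: ln_realpow)
    moreover have "real L * (1 / 2) \<le> real L * ln 2" using ln2 by (intro mult_left_mono) auto
    ultimately show ?thesis by simp
  qed
  have lnN: "ln (2 * N) \<le> 2 * D"
  proof -
    have "ln (2 * N) \<le> ln (2 * ((real s)\<^sup>2 * 2 ^ d))" using N by (subst ln_le_cancel_iff) auto
    also have "\<dots> = ln 2 + (2 * l + real d * ln 2)" using s by (simp add: ln_mult ln_realpow l_def)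
    also have "\<dots> \<le> 1 + (2 * l + real d * 1)" using ln2 by (intro add_mono mult_left_mono) auto
    also have "\<dots> \<le> 2 * D" using d by (simp add: D_def)
    finally show ?thesis .
  qed
  have lnN0: "0 \<le> ln (2 * N)" using N by (intro ln_ge_zero) simp
  have lnL: "ln (4 * real L / \<gamma>) \<le> 6 * l + ln (l / \<gamma>)"
  proof -
    have "4 * real L / \<gamma> \<le> 56 * (l / \<gamma>)" using Lle \<gamma> by (simp add: divide_right_mono)
    then have "ln (4 * real L / \<gamma>) \<le> ln (56 * (l / \<gamma>))" using L \<gamma> l0 by (subst ln_le_cancel_iff) auto
    also have "\<dots> = ln 56 + ln (l / \<gamma>)" using l0 \<gamma> by (subst ln_mult) auto
    also have "\<dots> \<le> 6 * l + ln (l / \<gamma>)" using ln_pow2[of 56 6] by simp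
    finally show ?thesis .
  qed
  have lnL0: "0 \<le> ln (4 * real L / \<gamma>)"
  proof -
    have "\<gamma> * 1 \<le> 1 * (4 * real L)" using L \<gamma> by (intro mult_mono) auto
    then show ?thesis using \<gamma> by (intro ln_ge_zero) (simp add: field_simps)
  qed
  define V where "V = (2 ^ 24 * ln (1536 * R\<^sup>2) + 1) * ln (2 * N) + ln (4 * real L / \<gamma>)"
  have V0: "0 \<le> V" unfolding V_def using lnR0 lnN0 lnL0 by simp
  have "l * V \<le> 2 ^ 31 * M"
  proof -
    have "2 ^ 24 * ln (1536 * R\<^sup>2) + 1 \<le> 2 ^ 29 * l" using lnR lh by simp
    then have "(2 ^ 24 * ln (1536 * R\<^sup>2) + 1) * ln (2 * N) \<le> 2 ^ 29 * l * (2 * D)"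
      using lnN lnN0 l0 lnR0 by (intro mult_mono) auto
    then have "V \<le> 2 ^ 29 * l * (2 * D) + (6 * l + ln (l / \<gamma>))"
      unfolding V_def using lnL by (rule add_mono)
    then have "l * V \<le> l * (2 ^ 29 * l * (2 * D) + (6 * l + ln (l / \<gamma>)))"
      using l0 by (intro mult_left_mono) auto
    also have "\<dots> = 2 ^ 30 * (l\<^sup>2 * D) + 6 * l\<^sup>2 + l * ln (l / \<gamma>)"
      by (simp add: algebra_simps power2_eq_square)
    also have "\<dots> \<le> 2 ^ 30 * M + 6 * M + M"
    proof (intro add_mono mult_left_mono M)
      have "l\<^sup>2 * 1 \<le> l\<^sup>2 * D" using D1 by (intro mult_left_mono) auto
      then show "l\<^sup>2 \<le> M" using M by simp
    qed auto
    also have "\<dots> \<le> 2 ^ 31 * M" using M(3) by simp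
    finally show ?thesis .
  qed
  have "3072 * real L * R\<^sup>2 * V \<le> 3072 * (14 * l) * (9 * S) * V"
    using Lle R2le V0 l0 S0 by (intro mult_right_mono mult_mono) auto
  also have "\<dots> = 387072 * S * (l * V)" by simp
  also have "\<dots> \<le> 387072 * S * (2 ^ 31 * M)" using S0 \<open>l * V \<le> 2 ^ 31 * M\<close> by (intro mult_left_mono) auto
  also have "\<dots> = (387072 * 2 ^ 31) * (S * M)" by simp
  \<comment> \<open>\<open>387072 = 3072 * 14 * 9\<close> is below \<open>2 ^ 19\<close>, which
    explains the constant \<open>2 ^ 50\<close>.\<close>
  also have "\<dots> \<le> 2 ^ 50 * (S * M)" using S0 M(3) by (intro mult_right_mono) auto
  finally show ?A using mM unfolding V_def by linarith
  have "ln (2 / \<gamma>) \<le> 10 * M"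
  proof -
    have "2 / \<gamma> = (2 / l) * (l / \<gamma>)" using l0 by simp
    then have "ln (2 / \<gamma>) = ln (2 / l) + ln (l / \<gamma>)" using l0 \<gamma> by (simp only: ln_mult_pos divide_pos_pos zero_less_numeral)
    moreover have "ln (2 / l) \<le> 2"
    proof -
      have "2 / l \<le> 2 ^ 2" using lh l0 by (simp add: field_simps)
      then have "ln (2 / l) \<le> ln (2 ^ 2)" using l0 by (subst ln_le_cancel_iff) auto
      also have "\<dots> = 2 * ln 2" by (subst ln_realpow) auto
      also have "\<dots> \<le> 2" using ln2 by simp
      finally show ?thesis .
    qed
    \<comment> \<open>This logarithm is negative when \<open>l\<close> is smaller than \<gamma>; the
      first entry of the maximum, at least \<open>1 / 4\<close>, then takes over.\<close>
    moreover have "ln (l / \<gamma>) \<le> 2 * M"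
    proof (cases "0 \<le> ln (l / \<gamma>)")
      case True
      have "1 / 2 * ln (l / \<gamma>) \<le> l * ln (l / \<gamma>)" using True lh by (intro mult_right_mono) auto
      then show ?thesis using M(2) by linarith
    next
      case False
      then show ?thesis using M(3) by linarith
    qed
    ultimately show ?thesis using M(3) by linarith
  qed
  also have "10 * M < 2 * (2 ^ 50 * M)" using M(3) by simp
  also have "\<dots> \<le> 2 * real m / S"
    using mM S0 by (simp add: field_simps)
  finally have "ln (2 / \<gamma>) < 2 * real m / S" .
  then have "exp (ln (2 / \<gamma>)) < exp (2 * real m / S)" by simp
  then show ?B using \<gamma> by (simp add: S_def a_def)
qed

section \<open>Truncation error\<close>

lemma L2_norm_nonneg: "0 \<le> L2_norm M f"
  by (simp add: L2_norm_def)

lemma L2_norm_square: "(L2_norm M f)\<^sup>2 = (\<integral>y. (cmod (f y))\<^sup>2 \<partial>M)"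
  by (simp add: L2_norm_def)

text \<open>Minkowski's inequality by integrating a weighted form of the square of a sum, sharp when
  \<open>p\<close> and \<open>q\<close> are the two norms. The slack \<open>e\<close> keeps both
  positive when a norm vanishes.\<close>

lemma L2_norm_triangle:
  fixes u v :: "'a \<Rightarrow> complex"
  assumes meas [measurable]: "u \<in> borel_measurable M" "v \<in> borel_measurable M"
    and u: "integrable M (\<lambda>y. (cmod (u y))\<^sup>2)" and v: "integrable M (\<lambda>y. (cmod (v y))\<^sup>2)"
  shows "integrable M (\<lambda>y. (cmod (u y + v y))\<^sup>2)"
    and "L2_norm M (\<lambda>y. u y + v y) \<le> L2_norm M u + L2_norm M v"
proof -
  have pw: "(cmod (u y + v y))\<^sup>2 \<le> (1 + q / p) * (cmod (u y))\<^sup>2 + (1 + p / q) * (cmod (v y))\<^sup>2"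
    if p: "0 < p" and q: "0 < q" for p q :: real and y
  proof -
    have "(cmod (u y + v y))\<^sup>2 \<le> (cmod (u y) + cmod (v y))\<^sup>2" by (intro power_mono norm_triangle_ineq) auto
    also have "\<dots> \<le> (1 + q / p) * (cmod (u y))\<^sup>2 + (1 + p / q) * (cmod (v y))\<^sup>2"
    proof -
      have "0 \<le> (q * cmod (u y) - p * cmod (v y))\<^sup>2 / (p * q)" using p q by (intro divide_nonneg_pos) auto
      also have "\<dots> = (1 + q / p) * (cmod (u y))\<^sup>2 + (1 + p / q) * (cmod (v y))\<^sup>2 - (cmod (u y) + cmod (v y))\<^sup>2"
        using p q by (simp add: field_simps power2_eq_square)
      finally show ?thesis by simp
    qed
    finally show ?thesis .
  qed
  show i: "integrable M (\<lambda>y. (cmod (u y + v y))\<^sup>2)"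
  proof (rule Bochner_Integration.integrable_bound)
    show "integrable M (\<lambda>y. 2 * (cmod (u y))\<^sup>2 + 2 * (cmod (v y))\<^sup>2)" using u v by simp
    show "AE y in M. norm ((cmod (u y + v y))\<^sup>2) \<le> norm (2 * (cmod (u y))\<^sup>2 + 2 * (cmod (v y))\<^sup>2)"
      using pw[of 1 1] by (intro AE_I2) simp
  qed measurable
  define a where "a = L2_norm M u"
  define b where "b = L2_norm M v"
  have a0: "0 \<le> a" and b0: "0 \<le> b" by (simp_all add: a_def b_def L2_norm_nonneg)
  show "L2_norm M (\<lambda>y. u y + v y) \<le> L2_norm M u + L2_norm M v"
  proof (rule field_le_epsilon)
    fix e :: real assume e: "0 < e"
    define p where "p = a + e / 2"
    define q where "q = b + e / 2"
    have p: "0 < p" "a \<le> p" and q: "0 < q" "b \<le> q" using a0 b0 e by (auto simp: p_def q_def)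
    have "(L2_norm M (\<lambda>y. u y + v y))\<^sup>2 \<le> (\<integral>y. (1 + q / p) * (cmod (u y))\<^sup>2 + (1 + p / q) * (cmod (v y))\<^sup>2 \<partial>M)"
      unfolding L2_norm_square using u v by (intro integral_mono i pw p q) auto
    also have "\<dots> = (1 + q / p) * a\<^sup>2 + (1 + p / q) * b\<^sup>2"
      using u v by (simp add: a_def b_def L2_norm_square)
    also have "\<dots> \<le> (1 + q / p) * p\<^sup>2 + (1 + p / q) * q\<^sup>2"
      using p q a0 b0 by (intro add_mono mult_left_mono power_mono) auto
    also have "\<dots> = (p + q)\<^sup>2" using p q by (simp add: field_simps power2_eq_square)
    finally have "L2_norm M (\<lambda>y. u y + v y) \<le> p + q" by (rule power2_le_imp_le) (use p q in simp)
    then show "L2_norm M (\<lambda>y. u y + v y) \<le> L2_norm M u + L2_norm M v + e"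
      by (simp add: p_def q_def a_def b_def)
  qed
qed

text \<open>\<open>real_of_ereal\<close> sends an infinite supremum to 0, so an a priori bound
  \<open>B\<close> is what makes \<open>Linf_norm\<close> the true essential supremum.\<close>

lemma (in prob_space) Linf_norm_bounds:
  fixes f :: "'a \<Rightarrow> real"
  assumes [measurable]: "f \<in> borel_measurable M" and B: "AE x in M. \<bar>f x\<bar> \<le> B"
  shows "AE x in M. \<bar>f x\<bar> \<le> Linf_norm M f" and "0 \<le> Linf_norm M f" and "Linf_norm M f \<le> B"
proof -
  define S where "S = esssup M (\<lambda>x. ereal \<bar>f x\<bar>)"
  have le: "S \<le> ereal B" unfolding S_def using B by (intro esssup_I) auto
  have ae: "AE x in M. ereal \<bar>f x\<bar> \<le> S" unfolding S_def by (rule esssup_AE)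
  have "0 = esssup M (\<lambda>x. 0 :: ereal)" by (rule esssup_const[symmetric]) (simp add: emeasure_space_1)
  also have "\<dots> \<le> S" unfolding S_def by (rule esssup_mono) auto
  finally have ge: "0 \<le> S" .
  have S: "S = ereal (Linf_norm M f)"
    unfolding Linf_norm_def S_def[symmetric] using le ge by (cases S) auto
  show "AE x in M. \<bar>f x\<bar> \<le> Linf_norm M f" using ae unfolding S by simp
  show "0 \<le> Linf_norm M f" "Linf_norm M f \<le> B" using le ge unfolding S by simp_all
qed

context orthonormal_family
begin

text \<open>Below, the zero multi-index lies in every nonempty lower set and its basis function has
  square 1. Above, \<open>lower_set_sum_sup_sq\<close> applies; this allows the exponent
  \<open>m / K\<close> to be compared with the sample size.\<close>

lemma K_sup_bounds:
  assumes d: "1 \<le> d" and s: "1 \<le> s"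
  shows "1 \<le> K_sup fam P d s" and "K_sup fam P d s \<le> real s powr (1 + beta' fam)"
proof -
  interpret M: prob_space "orth_measure fam d" by (rule prob_space_orth_measure)
  let ?A = "{\<Lambda>. \<Lambda> \<subseteq> hyperbolic_cross d s \<and> lower_set d \<Lambda> \<and> card \<Lambda> = s}"
  have le: "K_set fam P d \<Lambda> \<le> real s powr (1 + beta' fam)" and ge: "1 \<le> K_set fam P d \<Lambda>"
    if L: "\<Lambda> \<in> ?A" for \<Lambda>
  proof -
    have fin: "finite \<Lambda>" using L s card_ge_0_finite[of \<Lambda>] by auto
    define f where "f y = (\<Sum>\<nu>\<in>\<Lambda>. \<bar>Psi P d \<nu> y\<bar>\<^sup>2)" for y
    have fm: "f \<in> borel_measurable (orth_measure fam d)" unfolding f_def by measurable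
    have b: "AE y in orth_measure fam d. \<bar>f y\<bar> \<le> real s powr (1 + beta' fam)"
      using AE_orth_measure
    proof eventually_elim
      case (elim y)
      have "\<bar>f y\<bar> = (\<Sum>\<nu>\<in>\<Lambda>. (Psi P d \<nu> y)\<^sup>2)" by (simp add: f_def sum_nonneg)
      also have "\<dots> \<le> (\<Sum>\<nu>\<in>\<Lambda>. \<Prod>k<d. sup_sq fam (\<nu> k))" by (intro sum_mono Psi_square_le elim)
      also have "\<dots> \<le> real (card \<Lambda>) powr (1 + beta' fam)" using L fin by (intro lower_set_sum_sup_sq) auto
      finally show ?case using L by simp
    qed
    note bounds = M.Linf_norm_bounds[OF fm b]
    have K: "K_set fam P d \<Lambda> = Linf_norm (orth_measure fam d) f" by (simp add: K_set_def f_def[abs_def])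
    show "K_set fam P d \<Lambda> \<le> real s powr (1 + beta' fam)" unfolding K by (rule bounds(3))
    obtain \<nu> where \<nu>: "\<nu> \<in> \<Lambda>" using L s by (metis (mono_tags, lifting) card.empty ex_in_conv mem_Collect_eq not_one_le_zero)
    define orig where "orig = (\<lambda>k\<in>{..<d}. 0 :: nat)"
    have "orig \<in> multi_indices d" "\<forall>k<d. orig k \<le> \<nu> k" by (auto simp: orig_def multi_indices_def)
    then have orig: "orig \<in> \<Lambda>" using L \<nu> unfolding lower_set_def by blast
    have "(Psi P d orig y)\<^sup>2 = 1" for y
      unfolding Psi_def prod_power_distrib by (intro prod.neutral) (simp add: orig_def P_0_square)
    moreover have "(Psi P d orig y)\<^sup>2 \<le> f y" for y
      unfolding f_def using fin orig by (subst sum.remove[of _ orig]) (auto intro: sum_nonneg)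
    ultimately have f1: "1 \<le> f y" for y by metis
    have "AE y in orth_measure fam d. 1 \<le> Linf_norm (orth_measure fam d) f"
      using bounds(1)
    proof eventually_elim
      case (elim y)
      then show ?case using f1[of y] by linarith
    qed
    then show "1 \<le> K_set fam P d \<Lambda>" unfolding K by simp
  qed
  have "lower_set d {}" by (simp add: lower_set_def)
  then obtain \<Lambda> where "lower_set d \<Lambda>" "finite \<Lambda>" "card \<Lambda> = s"
    using lower_set_extend[of d "{}" s] d by auto
  then have \<Lambda>: "\<Lambda> \<in> ?A" using lower_set_subset_hyperbolic_cross by blast
  have bdd: "bdd_above (K_set fam P d ` ?A)" using le by (rule bdd_aboveI2)
  show "1 \<le> K_sup fam P d s" unfolding K_sup_def
    using cSUP_upper[OF \<Lambda> bdd] ge[OF \<Lambda>] by linarith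
  show "K_sup fam P d s \<le> real s powr (1 + beta' fam)" unfolding K_sup_def
    using \<Lambda> le by (intro cSUP_least) auto
qed

lemma weight_bounds:
  shows "AE y in orth_measure fam d. \<bar>Psi P d \<nu> y\<bar> \<le> weight fam P d \<nu>" and "0 \<le> weight fam P d \<nu>"
proof -
  interpret M: prob_space "orth_measure fam d" by (rule prob_space_orth_measure)
  have b: "AE y in orth_measure fam d. \<bar>Psi P d \<nu> y\<bar> \<le> sup_weight fam d \<nu>"
    using AE_orth_measure by eventually_elim (rule Psi_le)
  show "AE y in orth_measure fam d. \<bar>Psi P d \<nu> y\<bar> \<le> weight fam P d \<nu>" "0 \<le> weight fam P d \<nu>"
    unfolding weight_def by (rule M.Linf_norm_bounds[OF borel_measurable_Psi b])+
qed

lemma borel_measurable_expansion [measurable]: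
  "expansion_on P d c \<Lambda> \<in> borel_measurable (orth_measure fam d)"
  unfolding expansion_on_def[abs_def] by measurable

text \<open>The partial sums stay within \<open>B\<close> of \<open>g\<^sub>\<Lambda>\<close> and converge to \<open>g\<close> in \<open>L\<^sup>2\<close>,
  so the excess of \<open>\<bar>g - g\<^sub>\<Lambda>\<bar>\<close> over \<open>B\<close> has \<open>L\<^sup>2\<close>-norm \<open>0\<close>.\<close>

lemma AE_expansion_compl_le:
  assumes g: "has_expansion fam P d g c" and w: "weighted_l1_finite fam P d c"
    and L: "finite \<Lambda>" "\<Lambda> \<subseteq> multi_indices d"
  shows "AE y in orth_measure fam d. cmod (expansion_compl P d g c \<Lambda> y)
           \<le> weighted_l1 fam P d c (multi_indices d - \<Lambda>)"
proof -
  let ?M = "orth_measure fam d"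
  interpret M: prob_space ?M by (rule prob_space_orth_measure)
  have gm [measurable]: "g \<in> borel_measurable ?M" and gi: "integrable ?M (\<lambda>y. (cmod (g y))\<^sup>2)"
    using g by (auto simp: has_expansion_def)
  have lim: "((\<lambda>F. L2_norm ?M (\<lambda>y. g y - expansion_on P d c F y)) \<longlongrightarrow> 0) (finite_subsets_at_top (multi_indices d))"
    using g by (simp add: has_expansion_def)
  define B where "B = weighted_l1 fam P d c (multi_indices d - \<Lambda>)"
  define X where "X y = max 0 (cmod (expansion_compl P d g c \<Lambda> y) - B)" for y
  have Xm [measurable]: "X \<in> borel_measurable ?M"
    unfolding X_def expansion_compl_def by measurable
  have summ: "(\<lambda>\<nu>. weight fam P d \<nu> * cmod (c \<nu>)) summable_on (multi_indices d - \<Lambda>)"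
    using w unfolding weighted_l1_finite_def by (rule summable_on_subset_banach) auto
  have sumB: "(\<Sum>\<nu>\<in>F. weight fam P d \<nu> * cmod (c \<nu>)) \<le> B" if F: "finite F" "F \<subseteq> multi_indices d - \<Lambda>" for F
    unfolding B_def weighted_l1_def
    by (rule finite_sum_le_infsum[OF summ F]) (simp add: weight_bounds(2))
  define I where "I = (\<integral>y. (X y)\<^sup>2 \<partial>?M)"
  have key: "integrable ?M (\<lambda>y. (X y)\<^sup>2) \<and> sqrt I \<le> L2_norm ?M (\<lambda>y. g y - expansion_on P d c F y)"
    if F: "finite F" "F \<subseteq> multi_indices d" "\<Lambda> \<subseteq> F" for F
  proof -
    have "AE y in ?M. \<forall>\<nu>\<in>F - \<Lambda>. \<bar>Psi P d \<nu> y\<bar> \<le> weight fam P d \<nu>"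
      using F by (intro AE_finite_allI weight_bounds) auto
    then have pw: "AE y in ?M. X y \<le> cmod (g y - expansion_on P d c F y)"
    proof eventually_elim
      case (elim y)
      have "expansion_on P d c F y = expansion_on P d c \<Lambda> y + expansion_on P d c (F - \<Lambda>) y"
        unfolding expansion_on_def using F by (simp add: sum.subset_diff add.commute)
      then have "expansion_compl P d g c \<Lambda> y = (g y - expansion_on P d c F y) + expansion_on P d c (F - \<Lambda>) y"
        by (simp add: expansion_compl_def)
      then have "cmod (expansion_compl P d g c \<Lambda> y) \<le> cmod (g y - expansion_on P d c F y) + cmod (expansion_on P d c (F - \<Lambda>) y)"
        by (simp add: norm_triangle_ineq)
      also have "cmod (expansion_on P d c (F - \<Lambda>) y) \<le> (\<Sum>\<nu>\<in>F - \<Lambda>. cmod (c \<nu> * complex_of_real (Psi P d \<nu> y)))"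
        unfolding expansion_on_def by (rule norm_sum)
      also have "\<dots> \<le> (\<Sum>\<nu>\<in>F - \<Lambda>. weight fam P d \<nu> * cmod (c \<nu>))"
        using elim by (intro sum_mono) (auto simp: norm_mult mult.commute intro: mult_left_mono)
      also have "\<dots> \<le> B" using F by (intro sumB) auto
      finally show ?case unfolding X_def by simp
    qed
    have Fi: "integrable ?M (\<lambda>y. (cmod (g y - expansion_on P d c F y))\<^sup>2)"
      using L2_norm_triangle(1)[of g ?M "\<lambda>y. - expansion_on P d c F y"] gi L2_norm_expansion(1)[OF F(1,2)] by simp
    have pw2: "AE y in ?M. (X y)\<^sup>2 \<le> (cmod (g y - expansion_on P d c F y))\<^sup>2"
      using pw by eventually_elim (auto intro!: power_mono simp: X_def)
    have Xi: "integrable ?M (\<lambda>y. (X y)\<^sup>2)"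
      by (rule Bochner_Integration.integrable_bound[OF Fi]) (use pw2 in auto)
    moreover have "sqrt I \<le> L2_norm ?M (\<lambda>y. g y - expansion_on P d c F y)"
      unfolding I_def L2_norm_def using pw2 Xi Fi by (intro real_sqrt_le_mono integral_mono_AE)
    ultimately show ?thesis by simp
  qed
  have "eventually (\<lambda>F. finite F \<and> \<Lambda> \<subseteq> F \<and> F \<subseteq> multi_indices d) (finite_subsets_at_top (multi_indices d))"
    unfolding eventually_finite_subsets_at_top using L by (intro exI[of _ \<Lambda>]) auto
  then have "eventually (\<lambda>F. sqrt I \<le> L2_norm ?M (\<lambda>y. g y - expansion_on P d c F y)) (finite_subsets_at_top (multi_indices d))"
    by eventually_elim (use key in blast)
  then have "sqrt I \<le> 0" by (intro tendsto_lowerbound[OF lim]) auto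
  moreover have "0 \<le> I" unfolding I_def by (rule Bochner_Integration.integral_nonneg) simp
  ultimately have "I = 0" by simp
  moreover have "integrable ?M (\<lambda>y. (X y)\<^sup>2)" using key[of \<Lambda>] L by blast
  ultimately have "AE y in ?M. (X y)\<^sup>2 = 0"
    unfolding I_def by (subst integral_nonneg_eq_0_iff_AE[symmetric]) auto
  then show ?thesis
    unfolding B_def[symmetric] by eventually_elim (auto simp: X_def max_def split: if_splits)
qed

text \<open>The upper Chernoff tail at \<open>l = 1\<close> doubles the mean, which is the source of
  \<open>sqrt 2\<close>; the slack \<open>2 * B\<^sup>2 / K\<close> is chosen so that the failure
  probability depends on \<open>m / K\<close> alone.\<close>

lemma sampled_residual_bound:
  fixes h :: "(nat \<Rightarrow> real) \<Rightarrow> complex" and B K :: real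
  assumes hm [measurable]: "h \<in> borel_measurable (orth_measure fam d)"
    and hB: "AE y in orth_measure fam d. cmod (h y) \<le> B" and K: "0 < K" and m: "0 < m"
  shows "\<exists>E\<in>sets (sample_measure fam d m). measure (sample_measure fam d m) E \<ge> 1 - exp (- (2 * real m / K)) \<and>
     (\<forall>y\<in>E. L2_set (\<lambda>i. cmod (h (y i))) {..<m} / sqrt (real m)
        \<le> sqrt 2 * (L2_norm (orth_measure fam d) h + B / sqrt K))"
proof -
  let ?M = "orth_measure fam d"
  interpret M: prob_space ?M by (rule prob_space_orth_measure)
  let ?PM = "\<Pi>\<^sub>M i\<in>{..<m}. ?M"
  interpret PM: product_prob_space "\<lambda>_. ?M" "{..<m}" by unfold_locales
  define X where "X y = (cmod (h y))\<^sup>2" for y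
  have Xm [measurable]: "X \<in> borel_measurable ?M" unfolding X_def by measurable
  define \<sigma> where "\<sigma> = L2_norm ?M h"
  have \<sigma>: "0 \<le> \<sigma>" "\<sigma>\<^sup>2 = M.expectation X" by (simp_all add: \<sigma>_def L2_norm_nonneg L2_norm_square X_def[abs_def])
  have B0: "0 \<le> B"
  proof -
    have "AE y in ?M. 0 \<le> B" using hB by eventually_elim (rule order_trans[OF norm_ge_zero])
    then show ?thesis by simp
  qed
  have X: "AE y in ?M. 0 \<le> X y \<and> X y \<le> B\<^sup>2"
    using hB by eventually_elim (auto simp: X_def intro: power_mono)
  have final: "L2_set (\<lambda>i. cmod (h (y i))) {..<m} / sqrt (real m) \<le> sqrt 2 * (\<sigma> + B / sqrt K)"
    if "(\<Sum>i<m. X (y i)) \<le> real m * (2 * \<sigma>\<^sup>2 + 2 * B\<^sup>2 / K)" for y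
  proof -
    have "L2_set (\<lambda>i. cmod (h (y i))) {..<m} / sqrt (real m) = sqrt ((\<Sum>i<m. X (y i)) / real m)"
      by (simp add: L2_set_def X_def real_sqrt_divide)
    also have "\<dots> \<le> sqrt (2 * \<sigma>\<^sup>2 + 2 * B\<^sup>2 / K)"
      using that m by (intro real_sqrt_le_mono) (simp add: field_simps)
    also have "\<dots> \<le> sqrt 2 * (\<sigma> + B / sqrt K)"
    proof (rule real_le_lsqrt)
      have "(sqrt 2 * (\<sigma> + B / sqrt K))\<^sup>2 = 2 * (\<sigma> + B / sqrt K)\<^sup>2" by (simp add: power_mult_distrib)
      also have "\<dots> = 2 * \<sigma>\<^sup>2 + 2 * B\<^sup>2 / K + 4 * \<sigma> * (B / sqrt K)"
        using K by (simp add: power2_sum power_divide algebra_simps)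
      finally show "2 * \<sigma>\<^sup>2 + 2 * B\<^sup>2 / K \<le> (sqrt 2 * (\<sigma> + B / sqrt K))\<^sup>2"
        using \<sigma>(1) B0 K by simp
    qed (use \<sigma>(1) B0 K in auto)
    finally show ?thesis .
  qed
  have "\<exists>E\<in>sets ?PM. measure ?PM E \<ge> 1 - exp (- (2 * real m / K)) \<and>
      (\<forall>y\<in>E. (\<Sum>i<m. X (y i)) \<le> real m * (2 * \<sigma>\<^sup>2 + 2 * B\<^sup>2 / K))"
  \<comment> \<open>\<open>relative_chernoff\<close> divides by the bound, so the case of an almost
    everywhere vanishing \<open>h\<close> is separate.\<close>
  proof (cases "B = 0")
    case True
    define E where "E = {w \<in> space ?PM. \<forall>i\<in>{..<m}. X (w i) = 0}"
    have "AE w in ?PM. \<forall>i\<in>{..<m}. X (w i) = 0"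
      using X True
      by (intro AE_finite_allI AE_PiM_component[where P="\<lambda>y. X y = 0"] prob_space_orth_measure) auto
    moreover have E: "E \<in> sets ?PM" unfolding E_def by measurable
    ultimately have "measure ?PM E = 1"
      unfolding E_def by (subst PM.prob_Collect_eq_1) auto
    moreover have "0 \<le> real m * (2 * \<sigma>\<^sup>2 + 2 * B\<^sup>2 / K)" using K by simp
    ultimately show ?thesis using E by (intro bexI[of _ E]) (auto simp: E_def)
  next
    case False
    then have B: "0 < B\<^sup>2" by simp
    define Bad where "Bad = {w \<in> space ?PM. 1 * (\<Sum>i<m. X (w i)) \<ge> real m * ((1 + 1\<^sup>2) * M.expectation X + 2 * B\<^sup>2 / K)}"
    have Badm: "Bad \<in> sets ?PM" unfolding Bad_def by measurable
    have "measure ?PM Bad \<le> exp (- real m * (2 * B\<^sup>2 / K) / B\<^sup>2)"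
      unfolding Bad_def by (rule M.relative_chernoff[OF Xm X B]) simp
    also have "\<dots> = exp (- (2 * real m / K))" using B by simp
    finally have le: "measure ?PM Bad \<le> exp (- (2 * real m / K))" .
    show ?thesis
    proof (intro bexI[of _ "space ?PM - Bad"] conjI ballI)
      show "measure ?PM (space ?PM - Bad) \<ge> 1 - exp (- (2 * real m / K))"
        using le PM.prob_compl[OF Badm] by simp
      show "(\<Sum>i<m. X (y i)) \<le> real m * (2 * \<sigma>\<^sup>2 + 2 * B\<^sup>2 / K)" if "y \<in> space ?PM - Bad" for y
        using that by (auto simp: Bad_def \<sigma>)
    qed (use Badm in auto)
  qed
  then show ?thesis unfolding sample_measure_def \<sigma>_def[symmetric] using final by blast
qed

end

section \<open>Convergence\<close>

context orthonormal_family
begin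

lemma expansion_on_restrict:
  assumes "finite J" "\<Lambda> \<subseteq> J"
  shows "expansion_on P d c \<Lambda> t = expansion_on P d (\<lambda>\<nu>. if \<nu> \<in> \<Lambda> then c \<nu> else 0) J t"
  unfolding expansion_on_def using assms by (intro sum.mono_neutral_cong_left) auto

lemma matrix_apply_sampling:
  "matrix_apply (sampling_matrix P d m y) J z i = expansion_on P d z J (y i) / complex_of_real (sqrt (real m))"
  unfolding matrix_apply_def sampling_matrix_def expansion_on_def sum_divide_distrib
  by (intro sum.cong refl) simp

text \<open>The basis functions are real, so all squared norms split into real and imaginary parts,
  each covered by the real isometry.\<close>

lemma lower_restricted_isometry_complex:
  assumes rip: "\<forall>\<Lambda> (z :: (nat \<Rightarrow> nat) \<Rightarrow> real).
        lower_set d \<Lambda> \<and> \<Lambda> \<subseteq> hyperbolic_cross d s \<and> card \<Lambda> \<le> 3 * s \<longrightarrow>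
        \<bar>(\<Sum>i<m. (\<Sum>\<nu>\<in>\<Lambda>. z \<nu> * Psi P d \<nu> (y i))\<^sup>2) / real m - (\<Sum>\<nu>\<in>\<Lambda>. (z \<nu>)\<^sup>2)\<bar>
          \<le> 1 / 4 * (\<Sum>\<nu>\<in>\<Lambda>. (z \<nu>)\<^sup>2)"
    and W: "lower_set d W" "W \<subseteq> hyperbolic_cross d s" "card W \<le> 3 * s"
    and z: "\<And>\<nu>. \<nu> \<notin> W \<Longrightarrow> z \<nu> = 0"
  shows "\<bar>sq_norm {..<m} (matrix_apply (sampling_matrix P d m y) (hyperbolic_cross d s) z) - sq_norm (hyperbolic_cross d s) z\<bar>
           \<le> 1 / 4 * sq_norm (hyperbolic_cross d s) z"
proof -
  let ?H = "hyperbolic_cross d s"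
  have zW: "(\<lambda>\<nu>. if \<nu> \<in> W then z \<nu> else 0) = z" using z by auto
  have exp: "expansion_on P d z ?H t = expansion_on P d z W t" for t
    using expansion_on_restrict[OF finite_hyperbolic_cross W(2), of d z t] unfolding zW by simp
  define q where "q u = (\<Sum>i<m. (\<Sum>\<nu>\<in>W. u \<nu> * Psi P d \<nu> (y i))\<^sup>2) / real m" for u
  have A: "sq_norm {..<m} (matrix_apply (sampling_matrix P d m y) ?H z) = q (\<lambda>\<nu>. Re (z \<nu>)) + q (\<lambda>\<nu>. Im (z \<nu>))"
    unfolding sq_norm_def matrix_apply_sampling norm_divide power_divide exp cmod_expansion_square q_def
    by (simp add: sum.distrib add_divide_distrib flip: sum_divide_distrib)
  have "sq_norm ?H z = (\<Sum>\<nu>\<in>W. (cmod (z \<nu>))\<^sup>2)"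
    unfolding sq_norm_def using W(2) z by (intro sum.mono_neutral_right) auto
  also have "\<dots> = (\<Sum>\<nu>\<in>W. (Re (z \<nu>))\<^sup>2) + (\<Sum>\<nu>\<in>W. (Im (z \<nu>))\<^sup>2)"
    by (simp add: cmod_power2 sum.distrib)
  finally have B: "sq_norm ?H z = (\<Sum>\<nu>\<in>W. (Re (z \<nu>))\<^sup>2) + (\<Sum>\<nu>\<in>W. (Im (z \<nu>))\<^sup>2)" .
  have r: "\<bar>q u - (\<Sum>\<nu>\<in>W. (u \<nu>)\<^sup>2)\<bar> \<le> 1 / 4 * (\<Sum>\<nu>\<in>W. (u \<nu>)\<^sup>2)" for u
    unfolding q_def using rip W by blast
  show ?thesis unfolding A B using r[of "\<lambda>\<nu>. Re (z \<nu>)"] r[of "\<lambda>\<nu>. Im (z \<nu>)"] by argo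
qed

text \<open>Orthonormality turns function distances into the coefficient distances
  \<open>D n\<close>, and the data are the image of the truncated coefficients \<open>b\<close> plus
  the scaled residual \<open>e\<close>. As \<open>b\<close> is an admissible competitor in the
  thresholding, \<open>hard_threshold_step\<close> gives a recursion for \<open>D\<close>.\<close>

lemma iht_convergence:
  fixes c :: "(nat \<Rightarrow> nat) \<Rightarrow> complex"
  assumes rip: "\<forall>\<Lambda> (z :: (nat \<Rightarrow> nat) \<Rightarrow> real).
        lower_set d \<Lambda> \<and> \<Lambda> \<subseteq> hyperbolic_cross d s \<and> card \<Lambda> \<le> 3 * s \<longrightarrow>
        \<bar>(\<Sum>i<m. (\<Sum>\<nu>\<in>\<Lambda>. z \<nu> * Psi P d \<nu> (y i))\<^sup>2) / real m - (\<Sum>\<nu>\<in>\<Lambda>. (z \<nu>)\<^sup>2)\<bar>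
          \<le> 1 / 4 * (\<Sum>\<nu>\<in>\<Lambda>. (z \<nu>)\<^sup>2)"
    and d: "1 \<le> d" and m: "0 < m" and \<Lambda>: "lower_set d \<Lambda>" "finite \<Lambda>" "card \<Lambda> \<le> s"
    and iht: "iht_iterates P d s m y g x"
  shows "L2_norm (orth_measure fam d) (\<lambda>t. expansion_on P d (x n) (hyperbolic_cross d s) t - expansion_on P d c \<Lambda> t)
    \<le> (1 / 2) ^ n * L2_norm (orth_measure fam d) (\<lambda>t. expansion_on P d (x 0) (hyperbolic_cross d s) t - expansion_on P d c \<Lambda> t)
      + 5 / sqrt (real m) * L2_set (\<lambda>i. cmod (expansion_compl P d g c \<Lambda> (y i))) {..<m}"
proof -
  let ?H = "hyperbolic_cross d s"
  let ?A = "sampling_matrix P d m y"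
  define b where "b \<nu> = (if \<nu> \<in> \<Lambda> then c \<nu> else 0)" for \<nu>
  define e where "e i = expansion_compl P d g c \<Lambda> (y i) / complex_of_real (sqrt (real m))" for i
  define v where "v n i = g (y i) / complex_of_real (sqrt (real m)) - matrix_apply ?A ?H (x n) i" for n i
  define D where "D n = L2_set (\<lambda>\<nu>. cmod (x n \<nu> - b \<nu>)) ?H" for n
  \<comment> \<open>Twice the \<open>5 / 2\<close> of \<open>hard_threshold_step\<close>, because a
    recursion with ratio \<open>1 / 2\<close> doubles the noise.\<close>
  define E where "E = 5 * L2_set (\<lambda>i. cmod (e i)) {..<m}"
  have \<Lambda>H: "\<Lambda> \<subseteq> ?H" using \<Lambda> by (rule lower_set_subset_hyperbolic_cross)
  have Hm: "?H \<subseteq> multi_indices d" by (auto simp: hyperbolic_cross_def)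
  have norm_eq: "L2_norm (orth_measure fam d) (\<lambda>t. expansion_on P d (x n) ?H t - expansion_on P d c \<Lambda> t) = D n" for n
  proof -
    have "expansion_on P d (x n) ?H t - expansion_on P d c \<Lambda> t = expansion_on P d (\<lambda>\<nu>. x n \<nu> - b \<nu>) ?H t" for t
      unfolding expansion_on_restrict[OF finite_hyperbolic_cross \<Lambda>H] b_def[symmetric]
      unfolding expansion_on_def by (simp add: left_diff_distrib sum_subtractf)
    then show ?thesis unfolding D_def by (simp add: L2_norm_expansion(2)[OF finite_hyperbolic_cross Hm, symmetric])
  qed
  have step: "hard_lower_threshold d s (\<lambda>\<nu>. x n \<nu> + adjoint_apply ?A m ?H (v n) \<nu>) (x (Suc n))" for n
    using iht unfolding iht_iterates_def Let_def v_def[abs_def] by blast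
  have sparse: "sparse_lower d s (x n)" for n
  proof (cases n)
    case 0
    then show ?thesis using iht by (simp add: iht_iterates_def)
  next
    case (Suc k)
    then show ?thesis using step[of k] by (simp add: hard_lower_threshold_def is_arg_min_def)
  qed
  have sparse_b: "sparse_lower d s b"
  proof -
    obtain L' where "\<Lambda> \<subseteq> L'" "lower_set d L'" "finite L'" "card L' = s"
      using lower_set_extend[OF \<Lambda>(1,2) d \<Lambda>(3)] by blast
    then show ?thesis using \<Lambda>H unfolding sparse_lower_def b_def by (intro conjI exI[of _ L']) auto
  qed
  have supp: "\<exists>S. lower_set d S \<and> S \<subseteq> ?H \<and> card S \<le> s \<and> (\<forall>\<nu>. \<nu> \<notin> S \<longrightarrow> u \<nu> = 0)"
    if "sparse_lower d s u" for u
  proof -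
    obtain S where S: "lower_set d S" "finite S" "card S = s" "{\<nu>. u \<nu> \<noteq> 0} \<subseteq> S"
      using \<open>sparse_lower d s u\<close> unfolding sparse_lower_def by blast
    have "S \<subseteq> ?H" using S by (intro lower_set_subset_hyperbolic_cross) auto
    then show ?thesis using S by (intro exI[of _ S]) auto
  qed
  have rec: "D (Suc n) \<le> 1 / 2 * D n + E / 2" for n
  proof -
    obtain S where S: "lower_set d S" "S \<subseteq> ?H" "card S \<le> s" "\<forall>\<nu>. \<nu> \<notin> S \<longrightarrow> x n \<nu> = 0"
      using supp[OF sparse] by blast
    obtain S' where S': "lower_set d S'" "S' \<subseteq> ?H" "card S' \<le> s" "\<forall>\<nu>. \<nu> \<notin> S' \<longrightarrow> x (Suc n) \<nu> = 0"
      using supp[OF sparse] by blast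
    define W where "W = S \<union> S' \<union> \<Lambda>"
    have W: "lower_set d W" "W \<subseteq> ?H" using S S' \<Lambda> \<Lambda>H by (auto simp: W_def intro!: lower_set_Un)
    have "card W \<le> card S + card S' + card \<Lambda>"
      unfolding W_def using card_Un_le[of "S \<union> S'" \<Lambda>] card_Un_le[of S S'] by linarith
    then have Wc: "card W \<le> 3 * s" using S S' \<Lambda> by linarith
    have r: "\<bar>sq_norm {..<m} (matrix_apply ?A ?H (\<lambda>\<nu>. a * (x n \<nu> - b \<nu>) + a' * (x (Suc n) \<nu> - b \<nu>)))
            - sq_norm ?H (\<lambda>\<nu>. a * (x n \<nu> - b \<nu>) + a' * (x (Suc n) \<nu> - b \<nu>))\<bar>
          \<le> 1 / 4 * sq_norm ?H (\<lambda>\<nu>. a * (x n \<nu> - b \<nu>) + a' * (x (Suc n) \<nu> - b \<nu>))" for a a' :: real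
      by (rule lower_restricted_isometry_complex[OF rip W Wc]) (use S S' in \<open>auto simp: W_def b_def\<close>)
    have res: "v n i = matrix_apply ?A ?H b i + e i - matrix_apply ?A ?H (x n) i" for i
    proof -
      have "g (y i) = expansion_on P d b ?H (y i) + expansion_compl P d g c \<Lambda> (y i)"
        unfolding expansion_compl_def expansion_on_restrict[OF finite_hyperbolic_cross \<Lambda>H] b_def[symmetric] by simp
      then show ?thesis
        unfolding v_def e_def matrix_apply_sampling by (simp add: add_divide_distrib)
    qed
    have opt: "L2_set (\<lambda>\<nu>. cmod (x n \<nu> + adjoint_apply ?A m ?H (v n) \<nu> - x (Suc n) \<nu>)) ?H
        \<le> L2_set (\<lambda>\<nu>. cmod (x n \<nu> + adjoint_apply ?A m ?H (v n) \<nu> - b \<nu>)) ?H"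
      using step[of n] sparse_b unfolding hard_lower_threshold_def is_arg_min_def by (meson not_less)
    have "D (Suc n) \<le> 1 / 2 * D n + 5 / 2 * L2_set (\<lambda>i. cmod (e i)) {..<m}"
      unfolding D_def by (rule hard_threshold_step[OF finite_hyperbolic_cross r res opt])
    then show ?thesis by (simp add: E_def)
  qed
  have E0: "0 \<le> E" by (simp add: E_def L2_set_nonneg)
  have "E = 5 / sqrt (real m) * L2_set (\<lambda>i. cmod (expansion_compl P d g c \<Lambda> (y i))) {..<m}"
  proof -
    have "L2_set (\<lambda>i. cmod (e i)) {..<m} = L2_set (\<lambda>i. cmod (expansion_compl P d g c \<Lambda> (y i)) * (1 / sqrt (real m))) {..<m}"
      by (simp add: e_def norm_divide)
    also have "\<dots> = L2_set (\<lambda>i. cmod (expansion_compl P d g c \<Lambda> (y i))) {..<m} * (1 / sqrt (real m))"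
      by (rule L2_set_left_distrib[symmetric]) simp
    finally show ?thesis by (simp add: E_def)
  qed
  then show ?thesis using geometric_recursion[of D E n, OF rec E0] unfolding norm_eq by simp
qed

text \<open>The isometry event \<open>E1\<close> does not involve \<open>g\<close>, which makes the
  first bound uniform. The event \<open>E2\<close> controls the sampled residual of one
  \<open>g\<close>, hence the fixed function in the second. Each event may fail with at most half of
  \<gamma>.\<close>

lemma iht_error_bounds:
  fixes s d m :: nat and \<gamma> :: real
  assumes d: "1 \<le> d" and s: "2 \<le> s" and \<gamma>: "0 < \<gamma>" "\<gamma> < 1"
    and m: "real m \<ge> 2 ^ 50 * real s powr (1 + beta' fam) *
        max ((ln (real s))\<^sup>2 * (ln (real s) + real d)) (ln (real s) * ln (ln (real s) / \<gamma>))"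
  shows "\<exists>E \<in> sets (sample_measure fam d m). measure (sample_measure fam d m) E > 1 - \<gamma> \<and>
        (\<forall>y\<in>E. \<forall>g c \<Lambda> x n.
          has_expansion fam P d g c \<and> best_lower_support fam P d s g c \<Lambda> \<and>
          iht_iterates P d s m y g x \<longrightarrow>
          L2_norm (orth_measure fam d)
              (\<lambda>t. expansion_on P d (x n) (hyperbolic_cross d s) t - expansion_on P d c \<Lambda> t)
            \<le> (1 / 2) ^ n * L2_norm (orth_measure fam d)
                (\<lambda>t. expansion_on P d (x 0) (hyperbolic_cross d s) t - expansion_on P d c \<Lambda> t)
              + 5 / sqrt (real m) * L2_set (\<lambda>i. cmod (expansion_compl P d g c \<Lambda> (y i))) {..<m})"
    (is ?uniform)
    and "\<And>g c \<Lambda>. has_expansion fam P d g c \<Longrightarrow> weighted_l1_finite fam P d c \<Longrightarrow>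
        best_lower_support fam P d s g c \<Lambda> \<Longrightarrow>
        \<exists>E \<in> sets (sample_measure fam d m).
          measure (sample_measure fam d m) E > 1 - \<gamma> \<and>
          (\<forall>y\<in>E. \<forall>x n.
            iht_iterates P d s m y g x \<longrightarrow>
            L2_norm (orth_measure fam d)
                (\<lambda>t. expansion_on P d (x n) (hyperbolic_cross d s) t - g t)
              \<le> (1 / 2) ^ n * L2_norm (orth_measure fam d)
                  (\<lambda>t. expansion_on P d (x 0) (hyperbolic_cross d s) t - expansion_on P d c \<Lambda> t)
                + (5 * sqrt 2 + 1) * L2_norm (orth_measure fam d) (expansion_compl P d g c \<Lambda>)
                + 5 * sqrt 2 / sqrt (K_sup fam P d s)
                    * weighted_l1 fam P d c (multi_indices d - \<Lambda>))"
proof -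
  let ?H = "hyperbolic_cross d s"
  let ?M = "orth_measure fam d"
  let ?PM = "sample_measure fam d m"
  define R where "R = sqrt (real (3 * s) powr (1 + beta' fam))"
  have s1: "1 \<le> s" using s by simp
  have "0 \<le> beta' fam" by (cases fam) auto
  then have "1 \<le> real (3 * s) powr (1 + beta' fam)" using s by (intro ge_one_powr_ge_zero) auto
  then have R1: "1 \<le> R" by (simp add: R_def)
  obtain L :: nat where L: "R \<le> 2 ^ L / 6" "2 ^ L / 6 \<le> 2 * R" "1 \<le> L" using dyadic_scale[OF R1] .
  have "(\<lambda>k\<in>{..<d}. 0) \<in> ?H" using s by (auto simp: hyperbolic_cross_def multi_indices_def)
  then have N1: "1 \<le> real (card ?H)"
    by (metis One_nat_def Suc_leI card_gt_0_iff empty_iff finite_hyperbolic_cross of_nat_1 of_nat_mono)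
  note size = sample_size_bounds[OF s d \<gamma> m R_def L(2,3) N1 card_hyperbolic_cross_le]
  have m0: "0 < m"
  proof (rule ccontr)
    assume "\<not> 0 < m"
    then have "2 / \<gamma> < 1" using size(2) by simp
    then show False using \<gamma> by (simp add: field_simps)
  qed
  obtain E1 where E1: "E1 \<in> sets ?PM" "measure ?PM E1 \<ge> 1 - \<gamma> / 2"
    and rip: "\<forall>y\<in>E1. \<forall>\<Lambda> (z :: (nat \<Rightarrow> nat) \<Rightarrow> real).
        lower_set d \<Lambda> \<and> \<Lambda> \<subseteq> ?H \<and> card \<Lambda> \<le> 3 * s \<longrightarrow>
        \<bar>(\<Sum>i<m. (\<Sum>\<nu>\<in>\<Lambda>. z \<nu> * Psi P d \<nu> (y i))\<^sup>2) / real m - (\<Sum>\<nu>\<in>\<Lambda>. (z \<nu>)\<^sup>2)\<bar>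
          \<le> 1 / 4 * (\<Sum>\<nu>\<in>\<Lambda>. (z \<nu>)\<^sup>2)"
    using lower_restricted_isometry_real[OF d s1 R_def L(1,2) \<gamma> size(1)] by (elim bexE conjE) (rule that)
  have best: "lower_set d \<Lambda>" "finite \<Lambda>" "card \<Lambda> \<le> s" if "best_lower_support fam P d s g c \<Lambda>" for g c \<Lambda>
    using that by (auto simp: best_lower_support_def is_arg_min_def)
  show ?uniform
  proof (intro bexI[OF _ E1(1)] conjI ballI allI impI; (elim conjE)?)
    show "1 - \<gamma> < measure ?PM E1" using E1(2) \<gamma> by linarith
  qed (rule iht_convergence[OF bspec[OF rip] d m0 best(1) best(2) best(3)], assumption+)
  fix g c \<Lambda>
  assume g: "has_expansion fam P d g c" and w: "weighted_l1_finite fam P d c"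
    and bl: "best_lower_support fam P d s g c \<Lambda>"
  note \<Lambda> = best[OF bl]
  have \<Lambda>m: "\<Lambda> \<subseteq> multi_indices d" using \<Lambda> by (simp add: lower_set_def)
  define h where "h = expansion_compl P d g c \<Lambda>"
  define \<sigma> where "\<sigma> = L2_norm ?M h"
  define B where "B = weighted_l1 fam P d c (multi_indices d - \<Lambda>)"
  define K where "K = K_sup fam P d s"
  have gm [measurable]: "g \<in> borel_measurable ?M" using g by (simp add: has_expansion_def)
  have hm [measurable]: "h \<in> borel_measurable ?M" unfolding h_def expansion_compl_def[abs_def] by measurable
  have K: "1 \<le> K" "K \<le> real s powr (1 + beta' fam)" unfolding K_def by (rule K_sup_bounds[OF d s1])+
  have hB: "AE y in ?M. cmod (h y) \<le> B"
    unfolding h_def B_def by (rule AE_expansion_compl_le[OF g w \<Lambda>(2) \<Lambda>m])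
  have K0: "0 < K" using K by simp
  obtain E2 where E2: "E2 \<in> sets ?PM" "measure ?PM E2 \<ge> 1 - exp (- (2 * real m / K))"
    and res: "\<forall>y\<in>E2. L2_set (\<lambda>i. cmod (h (y i))) {..<m} / sqrt (real m) \<le> sqrt 2 * (L2_norm ?M h + B / sqrt K)"
    using sampled_residual_bound[OF hm hB K0 m0] by (elim bexE conjE) (rule that)
  interpret PM: prob_space ?PM unfolding sample_measure_def by (intro prob_space_PiM prob_space_orth_measure)
  have "2 / \<gamma> < exp (2 * real m / K)"
  proof -
    have "2 * real m / real s powr (1 + beta' fam) \<le> 2 * real m / K" using K s by (intro divide_left_mono mult_pos_pos) auto
    then show ?thesis using size(2) by (meson exp_le_cancel_iff less_le_trans)
  qed
  \<comment> \<open>Strictness here yields the strict bound on the measure of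
    \<open>E1 \<inter> E2\<close>.\<close>
  then have small: "exp (- (2 * real m / K)) < \<gamma> / 2" using \<gamma> by (simp add: exp_minus field_simps)
  have "measure ?PM E1 \<le> measure ?PM ((E1 \<inter> E2) \<union> (space ?PM - E2))"
    using E1 E2 sets.sets_into_space[OF E1(1)] by (intro PM.finite_measure_mono) auto
  also have "\<dots> \<le> measure ?PM (E1 \<inter> E2) + measure ?PM (space ?PM - E2)"
    using E1 E2 by (intro measure_Un_le) auto
  also have "measure ?PM (space ?PM - E2) = 1 - measure ?PM E2" by (rule PM.prob_compl[OF E2(1)])
  finally have PE: "1 - \<gamma> < measure ?PM (E1 \<inter> E2)" using E1(2) E2(2) small by linarith
  have main: "L2_norm ?M (\<lambda>t. expansion_on P d (x n) ?H t - g t)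
      \<le> (1 / 2) ^ n * L2_norm ?M (\<lambda>t. expansion_on P d (x 0) ?H t - expansion_on P d c \<Lambda> t)
         + (5 * sqrt 2 + 1) * \<sigma> + 5 * sqrt 2 / sqrt K * B"
    if y: "y \<in> E1 \<inter> E2" and iht: "iht_iterates P d s m y g x" for y x n
  proof -
    let ?f = "\<lambda>t. expansion_on P d (x n) ?H t - expansion_on P d c \<Lambda> t"
    have Hm: "?H \<subseteq> multi_indices d" by (auto simp: hyperbolic_cross_def)
    have "integrable ?M (\<lambda>t. (cmod (expansion_on P d (x n) ?H t + - expansion_on P d c \<Lambda> t))\<^sup>2)"
      by (rule L2_norm_triangle(1)) (use L2_norm_expansion(1)[OF finite_hyperbolic_cross Hm] L2_norm_expansion(1)[OF \<Lambda>(2) \<Lambda>m] in \<open>auto simp: norm_minus_cancel\<close>)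
    then have fi: "integrable ?M (\<lambda>t. (cmod (?f t))\<^sup>2)" by simp
    have "integrable ?M (\<lambda>t. (cmod (g t + - expansion_on P d c \<Lambda> t))\<^sup>2)"
      by (rule L2_norm_triangle(1)) (use g L2_norm_expansion(1)[OF \<Lambda>(2) \<Lambda>m] in \<open>auto simp: norm_minus_cancel has_expansion_def\<close>)
    then have hi: "integrable ?M (\<lambda>t. (cmod (- h t))\<^sup>2)" unfolding norm_minus_cancel h_def expansion_compl_def by simp
    \<comment> \<open>Passing from the truncated function to \<open>g\<close> costs one further
      \<open>\<sigma>\<close>, the summand 1 in its coefficient.\<close>
    have "L2_norm ?M (\<lambda>t. expansion_on P d (x n) ?H t - g t) = L2_norm ?M (\<lambda>t. ?f t + - h t)"
      by (simp add: h_def expansion_compl_def)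
    also have "\<dots> \<le> L2_norm ?M ?f + L2_norm ?M (\<lambda>t. - h t)"
      by (rule L2_norm_triangle(2)[OF _ _ fi hi]) measurable
    also have "L2_norm ?M (\<lambda>t. - h t) = \<sigma>" by (simp add: \<sigma>_def L2_norm_def)
    finally have tri: "L2_norm ?M (\<lambda>t. expansion_on P d (x n) ?H t - g t) \<le> L2_norm ?M ?f + \<sigma>" .
    have "y \<in> E1" using y by simp
    note conv = iht_convergence[OF bspec[OF rip this] d m0 \<Lambda> iht, of n c, folded h_def]
    have "5 / sqrt (real m) * L2_set (\<lambda>i. cmod (h (y i))) {..<m} = 5 * (L2_set (\<lambda>i. cmod (h (y i))) {..<m} / sqrt (real m))"
      by simp
    also have "\<dots> \<le> 5 * (sqrt 2 * (\<sigma> + B / sqrt K))"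
      unfolding \<sigma>_def using res y by (intro mult_left_mono) auto
    also have "\<dots> = 5 * sqrt 2 * \<sigma> + 5 * sqrt 2 / sqrt K * B" by (simp add: algebra_simps)
    finally have "5 / sqrt (real m) * L2_set (\<lambda>i. cmod (h (y i))) {..<m} \<le> 5 * sqrt 2 * \<sigma> + 5 * sqrt 2 / sqrt K * B" .
    moreover have "(5 * sqrt 2 + 1) * \<sigma> = 5 * sqrt 2 * \<sigma> + \<sigma>" by (simp add: algebra_simps)
    ultimately show ?thesis using tri conv by linarith
  qed
  show "\<exists>E \<in> sets ?PM. measure ?PM E > 1 - \<gamma> \<and>
          (\<forall>y\<in>E. \<forall>x n. iht_iterates P d s m y g x \<longrightarrow>
            L2_norm ?M (\<lambda>t. expansion_on P d (x n) ?H t - g t)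
              \<le> (1 / 2) ^ n * L2_norm ?M (\<lambda>t. expansion_on P d (x 0) ?H t - expansion_on P d c \<Lambda> t)
                + (5 * sqrt 2 + 1) * L2_norm ?M (expansion_compl P d g c \<Lambda>)
                + 5 * sqrt 2 / sqrt (K_sup fam P d s) * weighted_l1 fam P d c (multi_indices d - \<Lambda>))"
    unfolding h_def[symmetric] \<sigma>_def[symmetric] K_def[symmetric] B_def[symmetric]
    using PE main E1(1) E2(1) by (intro bexI[of _ "E1 \<inter> E2"]) auto
qed

end

theorem theorem4p9:
  shows "\<exists>(C::real) (\<rho>::real) (\<tau>::real). C > 0 \<and> 0 < \<rho> \<and> \<rho> < 1 \<and> \<tau> > 0 \<and>
    (\<forall>(fam::poly_family) (P::nat \<Rightarrow> real poly) (d::nat) (s::nat) (m::nat) (\<gamma>::real).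
      orthonormal_polys (base_measure fam) P \<and> 1 \<le> d \<and> 2 \<le> s \<and> 0 < \<gamma> \<and> \<gamma> < 1 \<and>
      real m \<ge> C * real s powr (1 + beta' fam) *
        max ((ln (real s))\<^sup>2 * (ln (real s) + real d))
            (ln (real s) * ln (ln (real s) / \<gamma>))
      \<longrightarrow>
      (\<exists>E \<in> sets (sample_measure fam d m).
        measure (sample_measure fam d m) E > 1 - \<gamma> \<and>
        (\<forall>y\<in>E. \<forall>g c \<Lambda> x n.
          has_expansion fam P d g c \<and> best_lower_support fam P d s g c \<Lambda> \<and>
          iht_iterates P d s m y g x \<longrightarrow>
          L2_norm (orth_measure fam d)
              (\<lambda>t. expansion_on P d (x n) (hyperbolic_cross d s) t - expansion_on P d c \<Lambda> t)
            \<le> \<rho> ^ n * L2_norm (orth_measure fam d)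
                (\<lambda>t. expansion_on P d (x 0) (hyperbolic_cross d s) t - expansion_on P d c \<Lambda> t)
              + \<tau> / sqrt (real m) * L2_set (\<lambda>i. cmod (expansion_compl P d g c \<Lambda> (y i))) {..<m}))
      \<and>
      (\<forall>g c \<Lambda>.
        has_expansion fam P d g c \<and> weighted_l1_finite fam P d c \<and>
        best_lower_support fam P d s g c \<Lambda> \<longrightarrow>
        (\<exists>E \<in> sets (sample_measure fam d m).
          measure (sample_measure fam d m) E > 1 - \<gamma> \<and>
          (\<forall>y\<in>E. \<forall>x n.
            iht_iterates P d s m y g x \<longrightarrow>
            L2_norm (orth_measure fam d)
                (\<lambda>t. expansion_on P d (x n) (hyperbolic_cross d s) t - g t)
              \<le> \<rho> ^ n * L2_norm (orth_measure fam d)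
                  (\<lambda>t. expansion_on P d (x 0) (hyperbolic_cross d s) t - expansion_on P d c \<Lambda> t)
                + (\<tau> * sqrt 2 + 1) * L2_norm (orth_measure fam d) (expansion_compl P d g c \<Lambda>)
                + \<tau> * sqrt 2 / sqrt (K_sup fam P d s)
                    * weighted_l1 fam P d c (multi_indices d - \<Lambda>)))))"
\<comment> \<open>\<open>2 ^ 50\<close> is the constant of \<open>sample_size_bounds\<close>; the
  rate \<open>1 / 2\<close> and the factor \<open>5\<close> are those of
  \<open>iht_convergence\<close>.\<close>
proof (rule exI[of _ "2 ^ 50"], rule exI[of _ "1 / 2"], rule exI[of _ 5], intro conjI allI impI; (elim conjE)?)
  fix fam P d s m \<gamma>
  assume orth: "orthonormal_polys (base_measure fam) P" and d: "1 \<le> d" and s: "2 \<le> s"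
    and \<gamma>: "0 < \<gamma>" "\<gamma> < 1"
    and m: "2 ^ 50 * real s powr (1 + beta' fam) *
        max ((ln (real s))\<^sup>2 * (ln (real s) + real d)) (ln (real s) * ln (ln (real s) / \<gamma>)) \<le> real m"
  interpret orthonormal_family fam P by unfold_locales (rule orth)
  note bounds = iht_error_bounds[OF d s \<gamma> m]
  show "\<exists>E \<in> sets (sample_measure fam d m).
        measure (sample_measure fam d m) E > 1 - \<gamma> \<and>
        (\<forall>y\<in>E. \<forall>g c \<Lambda> x n.
          has_expansion fam P d g c \<and> best_lower_support fam P d s g c \<Lambda> \<and>
          iht_iterates P d s m y g x \<longrightarrow>
          L2_norm (orth_measure fam d)
              (\<lambda>t. expansion_on P d (x n) (hyperbolic_cross d s) t - expansion_on P d c \<Lambda> t)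
            \<le> (1 / 2) ^ n * L2_norm (orth_measure fam d)
                (\<lambda>t. expansion_on P d (x 0) (hyperbolic_cross d s) t - expansion_on P d c \<Lambda> t)
              + 5 / sqrt (real m) * L2_set (\<lambda>i. cmod (expansion_compl P d g c \<Lambda> (y i))) {..<m})"
    by (rule bounds(1))
  fix g c \<Lambda>
  assume "has_expansion fam P d g c" "weighted_l1_finite fam P d c" "best_lower_support fam P d s g c \<Lambda>"
  then show "\<exists>E \<in> sets (sample_measure fam d m).
          measure (sample_measure fam d m) E > 1 - \<gamma> \<and>
          (\<forall>y\<in>E. \<forall>x n.
            iht_iterates P d s m y g x \<longrightarrow>
            L2_norm (orth_measure fam d)
                (\<lambda>t. expansion_on P d (x n) (hyperbolic_cross d s) t - g t)
              \<le> (1 / 2) ^ n * L2_norm (orth_measure fam d)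
                  (\<lambda>t. expansion_on P d (x 0) (hyperbolic_cross d s) t - expansion_on P d c \<Lambda> t)
                + (5 * sqrt 2 + 1) * L2_norm (orth_measure fam d) (expansion_compl P d g c \<Lambda>)
                + 5 * sqrt 2 / sqrt (K_sup fam P d s)
                    * weighted_l1 fam P d c (multi_indices d - \<Lambda>))"
    by (rule bounds(2))
qed auto

end
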